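(* Let $X$ and $Y$ be filtered spaces of the same stratified dimension $n$, with $X_{n-1}=X_{n-2}$ and $Y_{n-1}=Y_{n-2}$, and let $\bar p$ be a perversity. Suppose that $g:Y\to X$ is a stratum-preserving homotopy equivalence with stratum-preserving homotopy inverse $f:X\to Y$, that $\mathcal G$ is a local coefficient system on the top stratum $X-X_{n-2}$, and that $f(X_i-X_{i-1})\subset Y_i-Y_{i-1}$ and $g(Y_i-Y_{i-1})\subset X_i-X_{i-1}$ for each $i$. Then the intersection homology map $g_*:IH^{\bar p}_i(Y;g^*\mathcal G)\to IH^{\bar p}_i(X;\mathcal G)$, induced by $g$ covered over $X-X_{n-2}$ by the natural map $g^*\mathcal G\to\mathcal G$, is an isomorphism.
   Context: A filtered space is a space $X$ with closed subspaces $\emptyset=X_{-1}\subset X_0\subset\cdots\subset X_n=X$ (equalities allowed); $n$ is its stratified dimension and the sets $X_i-X_{i-1}$ are its strata. $X\times I$ is filtered by $\{X_i\times I\}$. A map of filtered spaces is stratum-preserving if the image of each component of a stratum lies in a stratum; a homotopy $X\times I\to Y$ is stratum-preserving if it is so as a map of filtered spaces. $g:Y\to X$ is a stratum-preserving homotopy equivalence with inverse $f$ if $f,g$ are stratum-preserving and $fg$, $gf$ are stratum-preserving homotopic to the identities. A perversity $\bar p$ is a sequence of integers $\bar p(0),\bar p(1),\ldots$ with $\bar p(i)\le\bar p(i+1)\le\bar p(i)+1$ and $\bar p(0)=\bar p(1)=\bar p(2)=0$. A singular simplex $\sigma:\Delta^i\to X$ is $\bar p$-allowable if for each $k$, $\sigma^{-1}(X_{n-k}-X_{n-k-1})$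 lies in the $(i-k+\bar p(k))$-skeleton of $\Delta^i$. Intersection homology with local coefficients: let $\mathcal G$ be a local coefficient system (bundle of modules, viewed as a covering space) on $X-X_{n-2}$, where $X_{n-1}=X_{n-2}$. The coefficient of an allowable simplex $\sigma$ is a lift of $\sigma|\sigma^{-1}(X-X_{n-2})$ to $\mathcal G$ (this set contains the interior of $\Delta^i$ and the interiors of its facets); lifts of the same simplex are added and multiplied by scalars pointwise, and the zero lift is $0$. The boundary is the usual alternating sum of faces with restricted lifts as coefficients. A chain is $\bar p$-allowable if it and its boundary are combinations of $\bar p$-allowable simplices; such chains form $IC^{\bar p}_*(X;\mathcal G)$, with homology $IH^{\bar p}_*(X;\mathcal G)$. A map $g$ covered over the top strata by a bundle map $\tilde g$ acts on chains by $\sum n_j\sigma_j\mapsto\sum(\tilde g\circ n_j)(g\circ\sigma_j)$. *)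

theory Defs
  imports "HOL-Homology.Homology" "HOL-Algebra.Module" "HOL-Algebra.AbelCoset"
begin

section \<open>Filtered spaces and stratum-preserving maps\<close>

record 'a filtered =
  fspace :: "'a topology"
  skel :: "int \<Rightarrow> 'a set"
  sdim :: nat

text \<open>The closed filtration is extended to all integer indices by \<open>X\<^sub>i = {}\<close> for
  \<open>i < 0\<close> and \<open>X\<^sub>i = X\<close> for \<open>i \<ge> n\<close>, so that \<open>X\<^bsub>n-2\<^esub>\<close> also makes sense when \<open>n < 2\<close>.\<close>

definition filtered_space :: "'a filtered \<Rightarrow> bool" where
  "filtered_space X \<longleftrightarrow>
     (\<forall>i. closedin (fspace X) (skel X i)) \<and>
     (\<forall>i. skel X (i - 1) \<subseteq> skel X i) \<and>
     (\<forall>i<0. skel X i = {}) \<and>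
     (\<forall>i\<ge>int (sdim X). skel X i = topspace (fspace X))"

definition stratum :: "'a filtered \<Rightarrow> int \<Rightarrow> 'a set" where
  "stratum X i = skel X i - skel X (i - 1)"

definition cylinder :: "'a filtered \<Rightarrow> ('a \<times> real) filtered" where
  "cylinder X =
     \<lparr>fspace = prod_topology (fspace X) (top_of_set {0..1}),
      skel = (\<lambda>i. skel X i \<times> {0..1}),
      sdim = sdim X\<rparr>"

definition stratum_preserving :: "'a filtered \<Rightarrow> 'b filtered \<Rightarrow> ('a \<Rightarrow> 'b) \<Rightarrow> bool" where
  "stratum_preserving X Y f \<longleftrightarrow>
     continuous_map (fspace X) (fspace Y) f \<and>
     (\<forall>i. \<forall>C \<in> connected_components_of (subtopology (fspace X) (stratum X i)).
        \<exists>j. f ` C \<subseteq> stratum Y j)"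

definition sp_homotopic :: "'a filtered \<Rightarrow> 'b filtered \<Rightarrow> ('a \<Rightarrow> 'b) \<Rightarrow> ('a \<Rightarrow> 'b) \<Rightarrow> bool" where
  "sp_homotopic X Y f g \<longleftrightarrow>
     (\<exists>H. stratum_preserving (cylinder X) Y H \<and>
          (\<forall>x \<in> topspace (fspace X). H (x, 0) = f x \<and> H (x, 1) = g x))"

definition sp_homotopy_equivalence ::
    "'b filtered \<Rightarrow> 'a filtered \<Rightarrow> ('b \<Rightarrow> 'a) \<Rightarrow> ('a \<Rightarrow> 'b) \<Rightarrow> bool" where
  "sp_homotopy_equivalence Y X g f \<longleftrightarrow>
     stratum_preserving Y X g \<and> stratum_preserving X Y f \<and>
     sp_homotopic Y Y (f \<circ> g) id \<and> sp_homotopic X X (g \<circ> f) id"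


section \<open>Perversities and allowable simplices\<close>

definition perversity :: "(nat \<Rightarrow> int) \<Rightarrow> bool" where
  "perversity p \<longleftrightarrow>
     p 0 = 0 \<and> p 1 = 0 \<and> p 2 = 0 \<and> (\<forall>i. p i \<le> p (i + 1) \<and> p (i + 1) \<le> p i + 1)"

text \<open>The union of the faces of dimension at most \<open>j\<close>; empty for negative \<open>j\<close>. The face spanned
  by a vertex set \<open>S\<close> has dimension \<open>card S - 1\<close>.\<close>

definition simplex_skeleton :: "nat \<Rightarrow> int \<Rightarrow> (nat \<Rightarrow> real) set" where
  "simplex_skeleton d j =
     (\<Union>S \<in> {S. S \<subseteq> {..d} \<and> int (card S) - 1 \<le> j}.
        {x \<in> standard_simplex d. \<forall>m. m \<notin> S \<longrightarrow> x m = 0})"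

definition allowable :: "(nat \<Rightarrow> int) \<Rightarrow> 'a filtered \<Rightarrow> nat \<Rightarrow> ((nat \<Rightarrow> real) \<Rightarrow> 'a) \<Rightarrow> bool" where
  "allowable p X d \<sigma> \<longleftrightarrow>
     singular_simplex d (fspace X) \<sigma> \<and>
     (\<forall>k. {x \<in> standard_simplex d. \<sigma> x \<in> stratum X (int (sdim X) - int k)}
           \<subseteq> simplex_skeleton d (int d - int k + p k))"


section \<open>Modules\<close>

text \<open>The library's locale \<open>module\<close> requires the ring of scalars to be commutative, which is not
  assumed here. The fields \<open>mult\<close> and \<open>one\<close> that module records inherit from rings
  are irrelevant.\<close>

locale left_module = R?: ring R + M?: abelian_group M
  for R :: "('r, 'k) ring_scheme" (structure) and M :: "('r, 'm, 'z) module_scheme" (structure) +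
  assumes smult_closed:
      "\<lbrakk>a \<in> carrier R; x \<in> carrier M\<rbrakk> \<Longrightarrow> a \<odot>\<^bsub>M\<^esub> x \<in> carrier M"
    and smult_l_distr:
      "\<lbrakk>a \<in> carrier R; b \<in> carrier R; x \<in> carrier M\<rbrakk> \<Longrightarrow>
        (a \<oplus>\<^bsub>R\<^esub> b) \<odot>\<^bsub>M\<^esub> x = a \<odot>\<^bsub>M\<^esub> x \<oplus>\<^bsub>M\<^esub> b \<odot>\<^bsub>M\<^esub> x"
    and smult_r_distr:
      "\<lbrakk>a \<in> carrier R; x \<in> carrier M; y \<in> carrier M\<rbrakk> \<Longrightarrow>
        a \<odot>\<^bsub>M\<^esub> (x \<oplus>\<^bsub>M\<^esub> y) = a \<odot>\<^bsub>M\<^esub> x \<oplus>\<^bsub>M\<^esub> a \<odot>\<^bsub>M\<^esub> y"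
    and smult_assoc:
      "\<lbrakk>a \<in> carrier R; b \<in> carrier R; x \<in> carrier M\<rbrakk> \<Longrightarrow>
        (a \<otimes>\<^bsub>R\<^esub> b) \<odot>\<^bsub>M\<^esub> x = a \<odot>\<^bsub>M\<^esub> (b \<odot>\<^bsub>M\<^esub> x)"
    and smult_one:
      "x \<in> carrier M \<Longrightarrow> \<one>\<^bsub>R\<^esub> \<odot>\<^bsub>M\<^esub> x = x"

definition module_iso ::
    "('r, 'k) ring_scheme \<Rightarrow> ('r, 'm) module \<Rightarrow> ('r, 'n) module \<Rightarrow> ('m \<Rightarrow> 'n) set" where
  "module_iso R M N =
     {h. bij_betw h (carrier M) (carrier N) \<and>
         (\<forall>x \<in> carrier M. \<forall>y \<in> carrier M. h (x \<oplus>\<^bsub>M\<^esub> y) = h x \<oplus>\<^bsub>N\<^esub> h y) \<and>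
         (\<forall>r \<in> carrier R. \<forall>x \<in> carrier M. h (r \<odot>\<^bsub>M\<^esub> x) = r \<odot>\<^bsub>N\<^esub> h x)}"

definition quotient_module :: "('r, 'm) module \<Rightarrow> 'm set \<Rightarrow> ('r, 'm set) module" where
  "quotient_module M N =
     \<lparr>carrier = a_rcosets\<^bsub>M\<^esub> N, mult = undefined, one = undefined, zero = N,
      add = set_add M, smult = (\<lambda>r S. \<Union>x \<in> S. N +>\<^bsub>M\<^esub> (r \<odot>\<^bsub>M\<^esub> x))\<rparr>"


section \<open>Local coefficient systems\<close>

record ('r, 'a, 'e) coeff_system =
  cs_total :: "'e topology"
  cs_proj :: "'e \<Rightarrow> 'a"
  cs_fiber :: "'a \<Rightarrow> ('r, 'e) module"

text \<open>A bundle of left \<open>R\<close>-modules over \<open>B\<close> with discrete fibres, that is, a covering space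
  whose fibres are modules. The trivialization around \<open>b\<close> is modelled on the fibre over \<open>b\<close>;
  as it is linear on fibres, it is automatically a map over \<open>U\<close>.\<close>

definition local_system ::
    "('r, 'k) ring_scheme \<Rightarrow> 'a topology \<Rightarrow> ('r, 'a, 'e) coeff_system \<Rightarrow> bool" where
  "local_system R B G \<longleftrightarrow>
     ring R \<and>
     continuous_map (cs_total G) B (cs_proj G) \<and>
     (\<forall>b \<in> topspace B. left_module R (cs_fiber G b) \<and>
        carrier (cs_fiber G b) = {e \<in> topspace (cs_total G). cs_proj G e = b}) \<and>
     (\<forall>b \<in> topspace B. \<exists>U \<phi>. openin B U \<and> b \<in> U \<and>
        homeomorphic_map
          (prod_topology (subtopology B U) (discrete_topology (carrier (cs_fiber G b))))
          (subtopology (cs_total G) {e \<in> topspace (cs_total G). cs_proj G e \<in> U}) \<phi> \<and>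
        (\<forall>x \<in> U. (\<lambda>m. \<phi> (x, m)) \<in> module_iso R (cs_fiber G b) (cs_fiber G x)))"

text \<open>The natural bundle map from the pullback along \<open>g\<close> to \<open>G\<close> is the second projection.\<close>

definition pullback_system ::
    "'b topology \<Rightarrow> ('b \<Rightarrow> 'a) \<Rightarrow> ('r, 'a, 'e) coeff_system \<Rightarrow> ('r, 'b, 'b \<times> 'e) coeff_system" where
  "pullback_system B g G =
     \<lparr>cs_total = subtopology (prod_topology B (cs_total G)) {(y, e). g y = cs_proj G e},
      cs_proj = fst,
      cs_fiber = (\<lambda>y. let M = cs_fiber G (g y) in
        \<lparr>carrier = {y} \<times> carrier M, mult = undefined, one = undefined, zero = (y, \<zero>\<^bsub>M\<^esub>),
         add = (\<lambda>u v. (y, snd u \<oplus>\<^bsub>M\<^esub> snd v)), smult = (\<lambda>r u. (y, r \<odot>\<^bsub>M\<^esub> snd u))\<rparr>)\<rparr>"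


section \<open>Intersection chains with local coefficients\<close>

text \<open>The space \<open>X - X\<^bsub>n-2\<^esub>\<close> that carries the coefficient system.\<close>

definition top_part :: "'a filtered \<Rightarrow> 'a topology" where
  "top_part X = subtopology (fspace X) (topspace (fspace X) - skel X (int (sdim X) - 2))"

definition lift_domain :: "'a filtered \<Rightarrow> nat \<Rightarrow> ((nat \<Rightarrow> real) \<Rightarrow> 'a) \<Rightarrow> (nat \<Rightarrow> real) set" where
  "lift_domain X d \<sigma> = {x \<in> standard_simplex d. \<sigma> x \<in> topspace (top_part X)}"

text \<open>The module of possible coefficients of \<open>\<sigma>\<close>: lifts of \<open>\<sigma>\<close>, restricted to the preimage of
  \<open>X - X\<^bsub>n-2\<^esub>\<close>, to the total space of \<open>G\<close>, with pointwise operations.\<close>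

definition lift_module ::
    "'a filtered \<Rightarrow> ('r, 'a, 'e) coeff_system \<Rightarrow> nat \<Rightarrow> ((nat \<Rightarrow> real) \<Rightarrow> 'a)
     \<Rightarrow> ('r, (nat \<Rightarrow> real) \<Rightarrow> 'e) module" where
  "lift_module X G d \<sigma> = (let D = lift_domain X d \<sigma> in
     \<lparr>carrier = {l \<in> extensional D.
        continuous_map (subtopology (powertop_real UNIV) D) (cs_total G) l \<and>
        (\<forall>x \<in> D. cs_proj G (l x) = \<sigma> x)},
      mult = undefined, one = undefined,
      zero = (\<lambda>x \<in> D. \<zero>\<^bsub>cs_fiber G (\<sigma> x)\<^esub>),
      add = (\<lambda>l l'. \<lambda>x \<in> D. l x \<oplus>\<^bsub>cs_fiber G (\<sigma> x)\<^esub> l' x),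
      smult = (\<lambda>r l. \<lambda>x \<in> D. r \<odot>\<^bsub>cs_fiber G (\<sigma> x)\<^esub> l x)\<rparr>)"

type_synonym ('a, 'e) coeff_chain = "((nat \<Rightarrow> real) \<Rightarrow> 'a) \<Rightarrow> ((nat \<Rightarrow> real) \<Rightarrow> 'e)"

definition coeff_support ::
    "'a filtered \<Rightarrow> ('r, 'a, 'e) coeff_system \<Rightarrow> nat \<Rightarrow> ('a, 'e) coeff_chain
     \<Rightarrow> ((nat \<Rightarrow> real) \<Rightarrow> 'a) set" where
  "coeff_support X G d c =
     {\<sigma> \<in> singular_simplex_set d (fspace X). c \<sigma> \<noteq> \<zero>\<^bsub>lift_module X G d \<sigma>\<^esub>}"

text \<open>Finite combinations of arbitrary singular simplices, allowable or not, with lifts as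
  coefficients. This is where the boundary of an allowable simplex lives.\<close>

definition coeff_chain_module ::
    "'a filtered \<Rightarrow> ('r, 'a, 'e) coeff_system \<Rightarrow> nat \<Rightarrow> ('r, ('a, 'e) coeff_chain) module" where
  "coeff_chain_module X G d = (let S = singular_simplex_set d (fspace X) in
     \<lparr>carrier = {c \<in> (\<Pi>\<^sub>E \<sigma> \<in> S. carrier (lift_module X G d \<sigma>)). finite (coeff_support X G d c)},
      mult = undefined, one = undefined,
      zero = (\<lambda>\<sigma> \<in> S. \<zero>\<^bsub>lift_module X G d \<sigma>\<^esub>),
      add = (\<lambda>c c'. \<lambda>\<sigma> \<in> S. c \<sigma> \<oplus>\<^bsub>lift_module X G d \<sigma>\<^esub> c' \<sigma>),
      smult = (\<lambda>r c. \<lambda>\<sigma> \<in> S. r \<odot>\<^bsub>lift_module X G d \<sigma>\<^esub> c \<sigma>)\<rparr>)"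

text \<open>The coefficient of \<open>\<tau>\<close> in the boundary of \<open>c\<close> collects the contributions of all simplices
  in \<open>c\<close> that have \<open>\<tau>\<close> as a face, possibly several times. In degree \<open>0\<close> the boundary is the
  zero chain, where the index \<open>d - 1\<close> of the target is just \<open>0\<close>.\<close>

definition coeff_boundary ::
    "'a filtered \<Rightarrow> ('r, 'a, 'e) coeff_system \<Rightarrow> nat \<Rightarrow> ('a, 'e) coeff_chain
     \<Rightarrow> ('a, 'e) coeff_chain" where
  "coeff_boundary X G d c =
     (if d = 0 then \<zero>\<^bsub>coeff_chain_module X G 0\<^esub>
      else (\<lambda>\<tau> \<in> singular_simplex_set (d - 1) (fspace X).
        let L = lift_module X G (d - 1) \<tau>
        in finsum L
             (\<lambda>(\<sigma>, k).
                let l = restrict (c \<sigma> \<circ> simplical_face k) (lift_domain X (d - 1) \<tau>)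
                in if even k then l else \<ominus>\<^bsub>L\<^esub> l)
             {(\<sigma>, k). \<sigma> \<in> coeff_support X G d c \<and> k \<le> d \<and> singular_face d k \<sigma> = \<tau>}))"

definition IC ::
    "(nat \<Rightarrow> int) \<Rightarrow> 'a filtered \<Rightarrow> ('r, 'a, 'e) coeff_system \<Rightarrow> nat \<Rightarrow> ('a, 'e) coeff_chain set" where
  "IC p X G d =
     {c \<in> carrier (coeff_chain_module X G d).
        (\<forall>\<sigma> \<in> coeff_support X G d c. allowable p X d \<sigma>) \<and>
        (\<forall>\<tau> \<in> coeff_support X G (d - 1) (coeff_boundary X G d c). allowable p X (d - 1) \<tau>)}"

definition IC_cycles ::
    "(nat \<Rightarrow> int) \<Rightarrow> 'a filtered \<Rightarrow> ('r, 'a, 'e) coeff_system \<Rightarrow> nat \<Rightarrow> ('a, 'e) coeff_chain set" where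
  "IC_cycles p X G d =
     {c \<in> IC p X G d. coeff_boundary X G d c = \<zero>\<^bsub>coeff_chain_module X G (d - 1)\<^esub>}"

definition IC_boundaries ::
    "(nat \<Rightarrow> int) \<Rightarrow> 'a filtered \<Rightarrow> ('r, 'a, 'e) coeff_system \<Rightarrow> nat \<Rightarrow> ('a, 'e) coeff_chain set" where
  "IC_boundaries p X G d = coeff_boundary X G (d + 1) ` IC p X G (d + 1)"

definition IH ::
    "(nat \<Rightarrow> int) \<Rightarrow> 'a filtered \<Rightarrow> ('r, 'a, 'e) coeff_system \<Rightarrow> nat
     \<Rightarrow> ('r, ('a, 'e) coeff_chain set) module" where
  "IH p X G d =
     quotient_module (coeff_chain_module X G d \<lparr>carrier := IC_cycles p X G d\<rparr>)
       (IC_boundaries p X G d)"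

text \<open>The map on chains given by \<open>g\<close> and a bundle map \<open>h\<close> covering it over the top strata;
  \<open>h\<close> acts from the system \<open>G'\<close> of \<open>Y\<close> to the system \<open>G\<close> of \<open>X\<close>.\<close>

definition coeff_chain_map ::
    "'b filtered \<Rightarrow> ('r, 'b, 'd) coeff_system \<Rightarrow> 'a filtered \<Rightarrow> ('r, 'a, 'e) coeff_system
     \<Rightarrow> ('b \<Rightarrow> 'a) \<Rightarrow> ('d \<Rightarrow> 'e) \<Rightarrow> nat \<Rightarrow> ('b, 'd) coeff_chain \<Rightarrow> ('a, 'e) coeff_chain" where
  "coeff_chain_map Y G' X G g h d c =
     (\<lambda>\<tau> \<in> singular_simplex_set d (fspace X).
        \<Oplus>\<^bsub>lift_module X G d \<tau>\<^esub> \<sigma> \<in> {\<sigma> \<in> coeff_support Y G' d c. simplex_map d g \<sigma> = \<tau>}.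
          restrict (h \<circ> c \<sigma>) (lift_domain X d \<tau>))"

text \<open>The class of the cycle \<open>c\<close> is sent to the class of its image: for an additive chain map,
  all members of the union are the same coset.\<close>

definition IH_induced ::
    "(nat \<Rightarrow> int) \<Rightarrow> 'b filtered \<Rightarrow> ('r, 'b, 'd) coeff_system
     \<Rightarrow> 'a filtered \<Rightarrow> ('r, 'a, 'e) coeff_system
     \<Rightarrow> ('b \<Rightarrow> 'a) \<Rightarrow> ('d \<Rightarrow> 'e) \<Rightarrow> nat \<Rightarrow> ('b, 'd) coeff_chain set \<Rightarrow> ('a, 'e) coeff_chain set" where
  "IH_induced p Y G' X G g h d A =
     (\<Union>c \<in> A. IC_boundaries p X G d +>\<^bsub>coeff_chain_module X G d\<^esub> coeff_chain_map Y G' X G g h d c)"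

end

theory Submission
  imports Defs
begin

text \<open>The homotopies keep every point in its stratum, so the coefficients can be transported along
  them: a homotopy \<open>K\<close> on spaces lifts uniquely to a fibrewise linear homotopy \<open>H\<close> of coefficient systems, by
  path lifting in coverings. Composing with the prism triangulation of \<open>\<Delta> \<times> I\<close> gives a chain homotopy
  between the two ends, and it preserves allowability since the part of a prism above a face of
  dimension \<open>j\<close> lies in the \<open>(j + 1)\<close>-skeleton of each piece.

  Cover \<open>f\<close> by transport along the homotopy from \<open>gf\<close> to the identity. Then \<open>g\<^sub>* f\<^sub>*\<close> is the identity on
  homology. The homotopy from \<open>fg\<close> to the identity, in contrast, only shows that \<open>f\<^sub>* g\<^sub>*\<close> is induced by a
  bundle map over the identity of \<open>Y\<close>, the monodromy around the loops formed by the two homotopies. It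
  is invertible by transport in the opposite direction, hence \<open>g\<^sub>*\<close> is injective.\<close>

section \<open>Homomorphisms and direct sums of modules\<close>

text \<open>The coefficients are what makes \<open>f\<close> differ from \<open>g\<close>. The map
  \<open>g\<close> comes with a natural cover, but over \<open>f\<close> the system
  \<open>f^* g^* G\<close> is the pullback of \<open>G\<close> along \<open>g f\<close>, not
  \<open>G\<close> itself, so a cover has to be chosen; once it is fitted to one homotopy, nothing
  is left to adjust for the other. Hence surjectivity and injectivity on homology have separate
  proofs, and injectivity asks only for a left inverse of the monodromy, obtained by retracing the
  same paths. A stratum-preserving homotopy may a priori move a component into a stratum of any
  index. Here both homotopies end at the identity, and this end pins the index for all times.
  Intersection chains also restrict the boundary, yet allowability of the pieces of a prism is
  enough: on a cycle the boundary of the prism is the difference of the two ends, and these are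
  allowable because they preserve strata. The pieces are allowable because the bound
  \<open>i - k + p k\<close> rises by one with the degree \<open>i\<close>, exactly as much as the
  skeleton does.\<close>

definition ahom :: "('r, 'm, 'x) module_scheme \<Rightarrow> ('r, 'n, 'y) module_scheme \<Rightarrow> ('m \<Rightarrow> 'n) set" where
  "ahom M N = {h \<in> carrier M \<rightarrow> carrier N.
     \<forall>x \<in> carrier M. \<forall>y \<in> carrier M. h (x \<oplus>\<^bsub>M\<^esub> y) = h x \<oplus>\<^bsub>N\<^esub> h y}"

definition mhom ::
    "('r, 'k) ring_scheme \<Rightarrow> ('r, 'm, 'x) module_scheme \<Rightarrow> ('r, 'n, 'y) module_scheme \<Rightarrow> ('m \<Rightarrow> 'n) set" where
  "mhom R M N = {h \<in> ahom M N.
     \<forall>r \<in> carrier R. \<forall>x \<in> carrier M. h (r \<odot>\<^bsub>M\<^esub> x) = r \<odot>\<^bsub>N\<^esub> h x}"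

lemma ahomI:
  assumes "\<And>x. x \<in> carrier M \<Longrightarrow> h x \<in> carrier N"
    and "\<And>x y. \<lbrakk>x \<in> carrier M; y \<in> carrier M\<rbrakk> \<Longrightarrow> h (x \<oplus>\<^bsub>M\<^esub> y) = h x \<oplus>\<^bsub>N\<^esub> h y"
  shows "h \<in> ahom M N"
  using assms by (auto simp: ahom_def)

lemma ahom_closed: "\<lbrakk>h \<in> ahom M N; x \<in> carrier M\<rbrakk> \<Longrightarrow> h x \<in> carrier N"
  by (auto simp: ahom_def)

lemma ahom_add:
  "\<lbrakk>h \<in> ahom M N; x \<in> carrier M; y \<in> carrier M\<rbrakk> \<Longrightarrow> h (x \<oplus>\<^bsub>M\<^esub> y) = h x \<oplus>\<^bsub>N\<^esub> h y"
  by (auto simp: ahom_def)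

lemma ahom_comp: "\<lbrakk>h \<in> ahom M N; k \<in> ahom N P\<rbrakk> \<Longrightarrow> (\<lambda>x. k (h x)) \<in> ahom M P"
  by (auto simp: ahom_def Pi_iff)

lemma ahom_zero:
  assumes "abelian_group M" "abelian_group N" "h \<in> ahom M N"
  shows "h \<zero>\<^bsub>M\<^esub> = \<zero>\<^bsub>N\<^esub>"
proof -
  interpret M: abelian_group M by fact
  interpret N: abelian_group N by fact
  have c: "h \<zero>\<^bsub>M\<^esub> \<in> carrier N"
    using ahom_closed[OF assms(3)] by simp
  have "h \<zero>\<^bsub>M\<^esub> \<oplus>\<^bsub>N\<^esub> h \<zero>\<^bsub>M\<^esub> = h \<zero>\<^bsub>M\<^esub>"
    using ahom_add[OF assms(3), of "\<zero>\<^bsub>M\<^esub>" "\<zero>\<^bsub>M\<^esub>"] by simp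
  then show ?thesis
    using c N.add.l_cancel_one by blast
qed

lemma ahom_neg:
  assumes "abelian_group M" "abelian_group N" "h \<in> ahom M N" "x \<in> carrier M"
  shows "h (\<ominus>\<^bsub>M\<^esub> x) = \<ominus>\<^bsub>N\<^esub> h x"
proof -
  interpret M: abelian_group M by fact
  interpret N: abelian_group N by fact
  have "h (\<ominus>\<^bsub>M\<^esub> x) \<oplus>\<^bsub>N\<^esub> h x = \<zero>\<^bsub>N\<^esub>"
    using ahom_add[OF assms(3), of "\<ominus>\<^bsub>M\<^esub> x" x] ahom_zero[OF assms(1-3)] assms(4)
    by (simp add: M.l_neg)
  then show ?thesis
    using assms ahom_closed[OF assms(3)] by (simp add: N.minus_equality)
qed

lemma ahom_finsum:
  assumes "abelian_group M" "abelian_group N" "h \<in> ahom M N" "\<And>i. i \<in> I \<Longrightarrow> u i \<in> carrier M"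
  shows "h (\<Oplus>\<^bsub>M\<^esub>i\<in>I. u i) = (\<Oplus>\<^bsub>N\<^esub>i\<in>I. h (u i))"
proof -
  interpret M: abelian_group M by fact
  interpret N: abelian_group N by fact
  show ?thesis
    using assms(4)
  proof (induction I rule: infinite_finite_induct)
    case (insert i I)
    then show ?case
      using ahom_closed[OF assms(3)] ahom_add[OF assms(3)] by (simp add: Pi_iff)
  qed (simp_all add: ahom_zero[OF assms(1-3)])
qed

lemma ahom_add_fun:
  assumes "abelian_group N" "h \<in> ahom M N" "k \<in> ahom M N"
  shows "(\<lambda>x. h x \<oplus>\<^bsub>N\<^esub> k x) \<in> ahom M N"
proof -
  interpret N: abelian_group N by fact
  show ?thesis
    using assms(2,3) by (auto simp: ahom_def Pi_iff N.a_ac)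
qed

lemma ahom_neg_fun:
  assumes "abelian_group N" "h \<in> ahom M N"
  shows "(\<lambda>x. \<ominus>\<^bsub>N\<^esub> h x) \<in> ahom M N"
proof -
  interpret N: abelian_group N by fact
  show ?thesis
    using assms(2) by (auto simp: ahom_def Pi_iff N.minus_add)
qed

lemma ahom_zero_fun: "abelian_group N \<Longrightarrow> (\<lambda>x. \<zero>\<^bsub>N\<^esub>) \<in> ahom M N"
  by (simp add: ahom_def abelian_monoid.l_zero abelian_monoid.zero_closed abelian_group.axioms)

lemma mhom_ahom: "h \<in> mhom R M N \<Longrightarrow> h \<in> ahom M N"
  by (simp add: mhom_def)

lemma mhom_smult: "\<lbrakk>h \<in> mhom R M N; r \<in> carrier R; x \<in> carrier M\<rbrakk> \<Longrightarrow> h (r \<odot>\<^bsub>M\<^esub> x) = r \<odot>\<^bsub>N\<^esub> h x"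
  by (simp add: mhom_def)

lemma mhom_comp: "\<lbrakk>h \<in> mhom R M N; k \<in> mhom R N P\<rbrakk> \<Longrightarrow> (\<lambda>x. k (h x)) \<in> mhom R M P"
  by (auto simp: mhom_def ahom_comp ahom_closed)

lemma left_module_abelian_group: "left_module R M \<Longrightarrow> abelian_group M"
  by (simp add: left_module_def)

text \<open>Inverses come from \<open>zsm\<close>: as 0x = 0, the element (-1)x is an inverse of x.
  For modules of lifts this replaces a separate proof that negatives are continuous.\<close>

lemma left_moduleI:
  assumes "ring R"
    and add: "\<And>x y. \<lbrakk>x \<in> carrier M; y \<in> carrier M\<rbrakk> \<Longrightarrow> x \<oplus>\<^bsub>M\<^esub> y \<in> carrier M"
    and zero: "\<zero>\<^bsub>M\<^esub> \<in> carrier M"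
    and smult: "\<And>r x. \<lbrakk>r \<in> carrier R; x \<in> carrier M\<rbrakk> \<Longrightarrow> r \<odot>\<^bsub>M\<^esub> x \<in> carrier M"
    and assoc: "\<And>x y z. \<lbrakk>x \<in> carrier M; y \<in> carrier M; z \<in> carrier M\<rbrakk> \<Longrightarrow>
       (x \<oplus>\<^bsub>M\<^esub> y) \<oplus>\<^bsub>M\<^esub> z = x \<oplus>\<^bsub>M\<^esub> (y \<oplus>\<^bsub>M\<^esub> z)"
    and comm: "\<And>x y. \<lbrakk>x \<in> carrier M; y \<in> carrier M\<rbrakk> \<Longrightarrow> x \<oplus>\<^bsub>M\<^esub> y = y \<oplus>\<^bsub>M\<^esub> x"
    and lzero: "\<And>x. x \<in> carrier M \<Longrightarrow> \<zero>\<^bsub>M\<^esub> \<oplus>\<^bsub>M\<^esub> x = x"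
    and ldist: "\<And>a b x. \<lbrakk>a \<in> carrier R; b \<in> carrier R; x \<in> carrier M\<rbrakk> \<Longrightarrow>
       (a \<oplus>\<^bsub>R\<^esub> b) \<odot>\<^bsub>M\<^esub> x = a \<odot>\<^bsub>M\<^esub> x \<oplus>\<^bsub>M\<^esub> b \<odot>\<^bsub>M\<^esub> x"
    and rdist: "\<And>a x y. \<lbrakk>a \<in> carrier R; x \<in> carrier M; y \<in> carrier M\<rbrakk> \<Longrightarrow>
       a \<odot>\<^bsub>M\<^esub> (x \<oplus>\<^bsub>M\<^esub> y) = a \<odot>\<^bsub>M\<^esub> x \<oplus>\<^bsub>M\<^esub> a \<odot>\<^bsub>M\<^esub> y"
    and sassoc: "\<And>a b x. \<lbrakk>a \<in> carrier R; b \<in> carrier R; x \<in> carrier M\<rbrakk> \<Longrightarrow>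
       (a \<otimes>\<^bsub>R\<^esub> b) \<odot>\<^bsub>M\<^esub> x = a \<odot>\<^bsub>M\<^esub> (b \<odot>\<^bsub>M\<^esub> x)"
    and one: "\<And>x. x \<in> carrier M \<Longrightarrow> \<one>\<^bsub>R\<^esub> \<odot>\<^bsub>M\<^esub> x = x"
    and zsm: "\<And>x. x \<in> carrier M \<Longrightarrow> \<zero>\<^bsub>R\<^esub> \<odot>\<^bsub>M\<^esub> x = \<zero>\<^bsub>M\<^esub>"
  shows "left_module R M"
proof -
  interpret R: ring R by fact
  have "abelian_group M"
  proof (rule abelian_groupI)
    fix x assume x: "x \<in> carrier M"
    have "(\<ominus>\<^bsub>R\<^esub> \<one>\<^bsub>R\<^esub>) \<odot>\<^bsub>M\<^esub> x \<oplus>\<^bsub>M\<^esub> \<one>\<^bsub>R\<^esub> \<odot>\<^bsub>M\<^esub> x = \<zero>\<^bsub>M\<^esub>"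
      using ldist[of "\<ominus>\<^bsub>R\<^esub> \<one>\<^bsub>R\<^esub>" "\<one>\<^bsub>R\<^esub>" x] x by (simp add: R.l_neg zsm)
    then show "\<exists>y\<in>carrier M. y \<oplus>\<^bsub>M\<^esub> x = \<zero>\<^bsub>M\<^esub>"
      using x smult one by (metis R.a_inv_closed R.one_closed)
  qed (use add zero assoc comm lzero in auto)
  then show ?thesis
    unfolding left_module_def left_module_axioms_def
    using assms by auto
qed

context left_module
begin

lemma zero_smult: "x \<in> carrier M \<Longrightarrow> \<zero>\<^bsub>R\<^esub> \<odot>\<^bsub>M\<^esub> x = \<zero>\<^bsub>M\<^esub>"
  using smult_l_distr[of "\<zero>\<^bsub>R\<^esub>" "\<zero>\<^bsub>R\<^esub>" x] smult_closed[of "\<zero>\<^bsub>R\<^esub>" x]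
  by (metis R.zero_closed R.l_zero M.add.l_cancel_one)

lemma smult_ahom: "r \<in> carrier R \<Longrightarrow> (\<lambda>x. r \<odot>\<^bsub>M\<^esub> x) \<in> ahom M M"
  by (rule ahomI) (auto simp: smult_closed smult_r_distr)

lemma neg_smult: "x \<in> carrier M \<Longrightarrow> \<ominus>\<^bsub>M\<^esub> x = (\<ominus>\<^bsub>R\<^esub> \<one>\<^bsub>R\<^esub>) \<odot>\<^bsub>M\<^esub> x"
proof -
  assume x: "x \<in> carrier M"
  have "(\<ominus>\<^bsub>R\<^esub> \<one>\<^bsub>R\<^esub>) \<odot>\<^bsub>M\<^esub> x \<oplus>\<^bsub>M\<^esub> x = \<zero>\<^bsub>M\<^esub>"
    using smult_l_distr[of "\<ominus>\<^bsub>R\<^esub> \<one>\<^bsub>R\<^esub>" "\<one>\<^bsub>R\<^esub>" x] x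
    by (simp add: R.l_neg zero_smult smult_one)
  then show ?thesis
    using x smult_closed by (simp add: M.minus_equality)
qed

lemma smult_neg: "\<lbrakk>r \<in> carrier R; x \<in> carrier M\<rbrakk> \<Longrightarrow> r \<odot>\<^bsub>M\<^esub> (\<ominus>\<^bsub>M\<^esub> x) = \<ominus>\<^bsub>M\<^esub> (r \<odot>\<^bsub>M\<^esub> x)"
  using ahom_neg[OF _ _ smult_ahom] M.abelian_group_axioms by simp

end

lemma mhom_finsum_fun:
  assumes "left_module R N" "\<And>i. i \<in> I \<Longrightarrow> h i \<in> mhom R M N"
  shows "(\<lambda>x. \<Oplus>\<^bsub>N\<^esub>i\<in>I. h i x) \<in> mhom R M N"
proof -
  interpret N: left_module R N by fact
  have cl: "h i x \<in> carrier N" if "i \<in> I" "x \<in> carrier M" for i x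
    using ahom_closed[OF mhom_ahom[OF assms(2)]] that by blast
  have "(\<lambda>x. \<Oplus>\<^bsub>N\<^esub>i\<in>I. h i x) \<in> ahom M N"
  proof (rule ahomI)
    fix x y assume xy: "x \<in> carrier M" "y \<in> carrier M"
    have "(\<Oplus>\<^bsub>N\<^esub>i\<in>I. h i (x \<oplus>\<^bsub>M\<^esub> y)) = (\<Oplus>\<^bsub>N\<^esub>i\<in>I. h i x \<oplus>\<^bsub>N\<^esub> h i y)"
      by (rule N.finsum_cong') (use xy cl assms(2) ahom_add mhom_ahom in \<open>auto, fastforce\<close>)
    then show "(\<Oplus>\<^bsub>N\<^esub>i\<in>I. h i (x \<oplus>\<^bsub>M\<^esub> y)) = (\<Oplus>\<^bsub>N\<^esub>i\<in>I. h i x) \<oplus>\<^bsub>N\<^esub> (\<Oplus>\<^bsub>N\<^esub>i\<in>I. h i y)"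
      using N.finsum_addf[of "\<lambda>i. h i x" I "\<lambda>i. h i y"] xy cl by (simp add: Pi_iff)
  qed (use cl in \<open>auto intro: N.finsum_closed\<close>)
  moreover have "(\<Oplus>\<^bsub>N\<^esub>i\<in>I. h i (r \<odot>\<^bsub>M\<^esub> x)) = r \<odot>\<^bsub>N\<^esub> (\<Oplus>\<^bsub>N\<^esub>i\<in>I. h i x)"
    if "r \<in> carrier R" "x \<in> carrier M" for r x
  proof -
    have "(\<Oplus>\<^bsub>N\<^esub>i\<in>I. h i (r \<odot>\<^bsub>M\<^esub> x)) = (\<Oplus>\<^bsub>N\<^esub>i\<in>I. r \<odot>\<^bsub>N\<^esub> h i x)"
      by (rule N.finsum_cong') (use that cl assms(2) mhom_smult N.smult_closed in \<open>auto, fastforce\<close>)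
    then show ?thesis
      using ahom_finsum[OF _ _ N.smult_ahom[OF that(1)], of I "\<lambda>i. h i x"] cl that
        N.M.abelian_group_axioms by simp
  qed
  ultimately show ?thesis
    by (simp add: mhom_def)
qed

lemma mhom_neg_fun:
  assumes "left_module R N" "h \<in> mhom R M N"
  shows "(\<lambda>x. \<ominus>\<^bsub>N\<^esub> h x) \<in> mhom R M N"
proof -
  interpret N: left_module R N by fact
  show ?thesis
    using assms(2) ahom_neg_fun[OF N.M.abelian_group_axioms mhom_ahom[OF assms(2)]]
    by (auto simp: mhom_def N.smult_neg ahom_closed)
qed

lemma (in abelian_monoid) finsum_mono_neutral:
  assumes "finite B" "A \<subseteq> B" "\<And>i. i \<in> B - A \<Longrightarrow> u i = \<zero>" "\<And>i. i \<in> A \<Longrightarrow> u i \<in> carrier G"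
  shows "finsum G u A = finsum G u B"
proof (rule add.finprod_mono_neutral_cong_left)
  show "u \<in> B \<rightarrow> carrier G"
    using assms(3,4) zero_closed by (metis Diff_iff Pi_I)
qed (use assms in auto)

lemma (in abelian_monoid) finsum_Sigma:
  assumes "finite A" "\<And>i. i \<in> A \<Longrightarrow> finite (B i)"
    "\<And>i j. \<lbrakk>i \<in> A; j \<in> B i\<rbrakk> \<Longrightarrow> u i j \<in> carrier G"
  shows "(\<Oplus>i\<in>A. \<Oplus>j\<in>B i. u i j) = finsum G (\<lambda>(i, j). u i j) (Sigma A B)"
  using assms
proof (induction A)
  case (insert a A)
  have eq: "Sigma (insert a A) B = Pair a ` B a \<union> Sigma A B"
    by auto
  have 1: "finsum G (\<lambda>(i, j). u i j) (Pair a ` B a) = (\<Oplus>j\<in>B a. u a j)"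
    using insert by (subst finsum_reindex) (auto simp: inj_on_def)
  have "finsum G (\<lambda>(i, j). u i j) (Sigma (insert a A) B)
      = finsum G (\<lambda>(i, j). u i j) (Pair a ` B a) \<oplus> finsum G (\<lambda>(i, j). u i j) (Sigma A B)"
    unfolding eq using insert by (subst finsum_Un_disjoint) auto
  also have "\<dots> = (\<Oplus>j\<in>B a. u a j) \<oplus> (\<Oplus>i\<in>A. \<Oplus>j\<in>B i. u i j)"
    using insert 1 by simp
  also have "\<dots> = (\<Oplus>i\<in>insert a A. \<Oplus>j\<in>B i. u i j)"
    by (subst finsum_insert) (use insert in \<open>auto intro!: finsum_closed\<close>)
  finally show ?case by simp
qed simp

section \<open>Direct sums of a family of modules\<close>

definition direct_support :: "'i set \<Rightarrow> ('i \<Rightarrow> ('r, 'm, 'x) module_scheme) \<Rightarrow> ('i \<Rightarrow> 'm) \<Rightarrow> 'i set" where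
  "direct_support S L c = {i \<in> S. c i \<noteq> \<zero>\<^bsub>L i\<^esub>}"

text \<open>Built with the same fields as \<open>coeff_chain_module\<close>, so that chains are
  literally a direct sum over the singular simplices, each of which has its own module of
  coefficients.\<close>

definition direct_sum :: "'i set \<Rightarrow> ('i \<Rightarrow> ('r, 'm, 'x) module_scheme) \<Rightarrow> ('r, 'i \<Rightarrow> 'm) module" where
  "direct_sum S L =
     \<lparr>carrier = {c \<in> (\<Pi>\<^sub>E i\<in>S. carrier (L i)). finite (direct_support S L c)},
      mult = undefined, one = undefined,
      zero = (\<lambda>i\<in>S. \<zero>\<^bsub>L i\<^esub>),
      add = (\<lambda>c c'. \<lambda>i\<in>S. c i \<oplus>\<^bsub>L i\<^esub> c' i),
      smult = (\<lambda>r c. \<lambda>i\<in>S. r \<odot>\<^bsub>L i\<^esub> c i)\<rparr>"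

definition direct_single :: "'i set \<Rightarrow> ('i \<Rightarrow> ('r, 'm, 'x) module_scheme) \<Rightarrow> 'i \<Rightarrow> 'm \<Rightarrow> 'i \<Rightarrow> 'm" where
  "direct_single S L i m = (\<lambda>j\<in>S. if j = i then m else \<zero>\<^bsub>L j\<^esub>)"

text \<open>The universal property: the map out of the direct sum that is \<open>\<theta> i\<close>
  on the summand \<open>i\<close>. Summing over the support keeps the index set finite; over an
  infinite set \<open>finsum\<close> is zero by default.\<close>

definition direct_lift ::
    "'i set \<Rightarrow> ('i \<Rightarrow> ('r, 'm, 'x) module_scheme) \<Rightarrow> ('r, 'n, 'y) module_scheme
     \<Rightarrow> ('i \<Rightarrow> 'm \<Rightarrow> 'n) \<Rightarrow> ('i \<Rightarrow> 'm) \<Rightarrow> 'n" where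
  "direct_lift S L N \<theta> c = (\<Oplus>\<^bsub>N\<^esub>i\<in>direct_support S L c. \<theta> i (c i))"

lemma direct_sum_simps:
  "carrier (direct_sum S L) = {c \<in> (\<Pi>\<^sub>E i\<in>S. carrier (L i)). finite (direct_support S L c)}"
  "\<zero>\<^bsub>direct_sum S L\<^esub> = (\<lambda>i\<in>S. \<zero>\<^bsub>L i\<^esub>)"
  "c \<oplus>\<^bsub>direct_sum S L\<^esub> c' = (\<lambda>i\<in>S. c i \<oplus>\<^bsub>L i\<^esub> c' i)"
  "r \<odot>\<^bsub>direct_sum S L\<^esub> c = (\<lambda>i\<in>S. r \<odot>\<^bsub>L i\<^esub> c i)"
  by (simp_all add: direct_sum_def)

lemma direct_support_zero: "direct_support S L \<zero>\<^bsub>direct_sum S L\<^esub> = {}"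
  by (auto simp: direct_support_def direct_sum_simps)

locale module_family =
  fixes R :: "('r, 'k) ring_scheme" and S :: "'i set"
    and L :: "'i \<Rightarrow> ('r, 'm, 'x) module_scheme"
  assumes ring: "ring R" and family: "i \<in> S \<Longrightarrow> left_module R (L i)"
begin

abbreviation DS where "DS \<equiv> direct_sum S L"

lemma family_group: "i \<in> S \<Longrightarrow> abelian_group (L i)"
  using family left_module_abelian_group by blast

lemma direct_support_add: "direct_support S L (c \<oplus>\<^bsub>DS\<^esub> c') \<subseteq> direct_support S L c \<union> direct_support S L c'"
proof
  fix i assume i: "i \<in> direct_support S L (c \<oplus>\<^bsub>DS\<^esub> c')"
  then interpret abelian_group "L i"
    using family_group by (simp add: direct_support_def)
  show "i \<in> direct_support S L c \<union> direct_support S L c'"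
    using i by (auto simp: direct_support_def direct_sum_simps)
qed

lemma direct_support_smult: "r \<in> carrier R \<Longrightarrow> direct_support S L (r \<odot>\<^bsub>DS\<^esub> c) \<subseteq> direct_support S L c"
proof
  fix i assume r: "r \<in> carrier R" and i: "i \<in> direct_support S L (r \<odot>\<^bsub>DS\<^esub> c)"
  then interpret left_module R "L i"
    using family by (simp add: direct_support_def)
  show "i \<in> direct_support S L c"
    using i r ahom_zero[OF M.abelian_group_axioms M.abelian_group_axioms smult_ahom]
    by (auto simp: direct_support_def direct_sum_simps)
qed

lemma left_module_direct_sum: "left_module R (DS)"
proof -
  note lm = left_module.smult_closed left_module.smult_l_distr left_module.smult_r_distr
    left_module.smult_assoc left_module.smult_one left_module.zero_smult
  note ag = abelian_group.axioms(1)[OF family_group]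
  have fin_add: "finite (direct_support S L (c \<oplus>\<^bsub>DS\<^esub> c'))"
    if "finite (direct_support S L c)" "finite (direct_support S L c')" for c c'
    using direct_support_add that by (meson finite_UnI finite_subset)
  have fin_sm: "finite (direct_support S L (r \<odot>\<^bsub>DS\<^esub> c))"
    if "finite (direct_support S L c)" "r \<in> carrier R" for r c
    using direct_support_smult that by (meson finite_subset)
  show ?thesis
  proof (rule left_moduleI[OF ring])
    show "\<zero>\<^bsub>DS\<^esub> \<in> carrier (DS)"
      by (auto simp: direct_sum_simps direct_support_def intro: abelian_monoid.zero_closed ag)
    show "x \<oplus>\<^bsub>DS\<^esub> y \<in> carrier (DS)"
      if "x \<in> carrier (DS)" "y \<in> carrier (DS)" for x y
      using that fin_add[of x y]
      by (auto simp: direct_sum_simps PiE_iff intro!: abelian_monoid.a_closed[OF ag])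
    show "r \<odot>\<^bsub>DS\<^esub> y \<in> carrier (DS)"
      if "r \<in> carrier R" "y \<in> carrier (DS)" for r y
      using that fin_sm[of y r]
      by (auto simp: direct_sum_simps PiE_iff intro!: lm(1)[OF family])
    show "x \<oplus>\<^bsub>DS\<^esub> y \<oplus>\<^bsub>DS\<^esub> z = x \<oplus>\<^bsub>DS\<^esub> (y \<oplus>\<^bsub>DS\<^esub> z)"
      if "x \<in> carrier (DS)" "y \<in> carrier (DS)" "z \<in> carrier (DS)" for x y z
      using that by (auto simp: direct_sum_simps PiE_iff fun_eq_iff intro!: abelian_monoid.a_assoc[OF ag])
    show "x \<oplus>\<^bsub>DS\<^esub> y = y \<oplus>\<^bsub>DS\<^esub> x"
      if "x \<in> carrier (DS)" "y \<in> carrier (DS)" for x y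
      using that by (auto simp: direct_sum_simps PiE_iff fun_eq_iff intro!: abelian_monoid.a_comm[OF ag])
    show "\<zero>\<^bsub>DS\<^esub> \<oplus>\<^bsub>DS\<^esub> x = x" if "x \<in> carrier (DS)" for x
      using that
      by (auto simp: direct_sum_simps PiE_iff fun_eq_iff abelian_monoid.l_zero[OF ag] extensional_def)
    show "(a \<oplus>\<^bsub>R\<^esub> b) \<odot>\<^bsub>DS\<^esub> x = a \<odot>\<^bsub>DS\<^esub> x \<oplus>\<^bsub>DS\<^esub> b \<odot>\<^bsub>DS\<^esub> x"
      if "a \<in> carrier R" "b \<in> carrier R" "x \<in> carrier (DS)" for a b x
      using that by (auto simp: direct_sum_simps PiE_iff fun_eq_iff intro!: lm(2)[OF family])
    show "a \<odot>\<^bsub>DS\<^esub> (x \<oplus>\<^bsub>DS\<^esub> y) = a \<odot>\<^bsub>DS\<^esub> x \<oplus>\<^bsub>DS\<^esub> a \<odot>\<^bsub>DS\<^esub> y"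
      if "a \<in> carrier R" "x \<in> carrier (DS)" "y \<in> carrier (DS)" for a x y
      using that by (auto simp: direct_sum_simps PiE_iff fun_eq_iff intro!: lm(3)[OF family])
    show "(a \<otimes>\<^bsub>R\<^esub> b) \<odot>\<^bsub>DS\<^esub> x = a \<odot>\<^bsub>DS\<^esub> (b \<odot>\<^bsub>DS\<^esub> x)"
      if "a \<in> carrier R" "b \<in> carrier R" "x \<in> carrier (DS)" for a b x
      using that by (auto simp: direct_sum_simps PiE_iff fun_eq_iff intro!: lm(4)[OF family])
    show "\<one>\<^bsub>R\<^esub> \<odot>\<^bsub>DS\<^esub> x = x" if "x \<in> carrier (DS)" for x
      using that
      by (auto simp: direct_sum_simps PiE_iff fun_eq_iff extensional_def intro!: lm(5)[OF family])
    show "\<zero>\<^bsub>R\<^esub> \<odot>\<^bsub>DS\<^esub> x = \<zero>\<^bsub>DS\<^esub>" if "x \<in> carrier (DS)" for x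
      using that by (auto simp: direct_sum_simps PiE_iff fun_eq_iff intro!: lm(6)[OF family])
  qed
qed

lemma direct_sum_group: "abelian_group (DS)"
  using left_module_direct_sum left_module_abelian_group by blast

lemma eval_ahom: "j \<in> S \<Longrightarrow> (\<lambda>c. c j) \<in> ahom (DS) (L j)"
  by (rule ahomI) (auto simp: direct_sum_simps)

lemma direct_single_closed:
  assumes "i \<in> S" "m \<in> carrier (L i)"
  shows "direct_single S L i m \<in> carrier (DS)"
proof -
  have "direct_support S L (direct_single S L i m) \<subseteq> {i}"
    by (auto simp: direct_support_def direct_single_def)
  then have "finite (direct_support S L (direct_single S L i m))"
    by (rule finite_subset) simp
  then show ?thesis
    using assms abelian_monoid.zero_closed[OF abelian_group.axioms(1)[OF family_group]]
    by (auto simp: direct_sum_simps direct_single_def)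
qed

lemma direct_support_direct_single: "direct_support S L (direct_single S L i m) \<subseteq> {i}"
  by (auto simp: direct_support_def direct_single_def)

lemma direct_single_mhom: "i \<in> S \<Longrightarrow> direct_single S L i \<in> mhom R (L i) (DS)"
proof -
  assume i: "i \<in> S"
  interpret Li: left_module R "L i" using family[OF i] .
  have "direct_single S L i \<in> ahom (L i) (DS)"
  proof (rule ahomI)
    show "direct_single S L i (x \<oplus>\<^bsub>L i\<^esub> y) = direct_single S L i x \<oplus>\<^bsub>DS\<^esub> direct_single S L i y" for x y
      using abelian_monoid.l_zero[OF abelian_group.axioms(1)[OF family_group]]
         abelian_monoid.zero_closed[OF abelian_group.axioms(1)[OF family_group]]
      by (auto simp: direct_sum_simps direct_single_def fun_eq_iff)
  qed (use i direct_single_closed in auto)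
  moreover have "direct_single S L i (r \<odot>\<^bsub>L i\<^esub> x) = r \<odot>\<^bsub>DS\<^esub> direct_single S L i x"
    if "r \<in> carrier R" for r x
  proof
    fix j
    show "direct_single S L i (r \<odot>\<^bsub>L i\<^esub> x) j = (r \<odot>\<^bsub>DS\<^esub> direct_single S L i x) j"
    proof (cases "j \<in> S \<and> j \<noteq> i")
      case True
      interpret Lj: left_module R "L j" using family True by blast
      show ?thesis
        using True ahom_zero[OF Lj.M.abelian_group_axioms Lj.M.abelian_group_axioms Lj.smult_ahom[OF that]]
        by (auto simp: direct_sum_simps direct_single_def)
    qed (auto simp: direct_sum_simps direct_single_def)
  qed
  ultimately show ?thesis
    by (simp add: mhom_def)
qed

text \<open>Cancellation makes the support of a sum unpredictable. Evaluating over a common finite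
  superset is what allows additivity to be proved term by term.\<close>

lemma direct_lift_superset:
  assumes N: "abelian_group N" and \<theta>: "\<And>i. i \<in> S \<Longrightarrow> \<theta> i \<in> ahom (L i) N"
    and c: "c \<in> carrier (DS)" and T: "finite T" "direct_support S L c \<subseteq> T" "T \<subseteq> S"
  shows "direct_lift S L N \<theta> c = (\<Oplus>\<^bsub>N\<^esub>i\<in>T. \<theta> i (c i))"
proof -
  interpret N: abelian_group N by fact
  have cl: "\<theta> i (c i) \<in> carrier N" if "i \<in> S" for i
    using that \<theta> c ahom_closed by (fastforce simp: direct_sum_simps PiE_iff)
  have "\<theta> i (c i) = \<zero>\<^bsub>N\<^esub>" if "i \<in> T - direct_support S L c" for i
  proof -
    have i: "i \<in> S" "c i = \<zero>\<^bsub>L i\<^esub>"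
      using that T by (auto simp: direct_support_def)
    then show ?thesis
      using ahom_zero[OF family_group N \<theta>] by simp
  qed
  then show ?thesis
    unfolding direct_lift_def using T cl by (intro N.finsum_mono_neutral) auto
qed

lemma direct_lift_mhom:
  assumes N: "left_module R N" and \<theta>: "\<And>i. i \<in> S \<Longrightarrow> \<theta> i \<in> mhom R (L i) N"
  shows "direct_lift S L N \<theta> \<in> mhom R (DS) N"
proof -
  interpret N: left_module R N by fact
  interpret D: left_module R "DS" by (rule left_module_direct_sum)
  have \<theta>': "\<theta> i \<in> ahom (L i) N" if "i \<in> S" for i
    using \<theta>[OF that] by (rule mhom_ahom)
  note sup = direct_lift_superset[OF N.M.abelian_group_axioms \<theta>']
  have cl: "\<theta> i (c i) \<in> carrier N" if "c \<in> carrier (DS)" "i \<in> S" for i c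
    using that \<theta>' ahom_closed by (fastforce simp: direct_sum_simps PiE_iff)
  have mem: "c i \<in> carrier (L i)" if "c \<in> carrier (DS)" "i \<in> S" for i c
    using that by (auto simp: direct_sum_simps)
  have "direct_lift S L N \<theta> \<in> ahom (DS) N"
  proof (rule ahomI)
    show "direct_lift S L N \<theta> c \<in> carrier N" if "c \<in> carrier (DS)" for c
      unfolding direct_lift_def using cl[OF that] by (intro N.finsum_closed) (auto simp: direct_support_def)
  next
    fix c c' assume c: "c \<in> carrier (DS)" "c' \<in> carrier (DS)"
    let ?T = "direct_support S L c \<union> direct_support S L c'"
    have T: "finite ?T" "?T \<subseteq> S"
      using c by (auto simp: direct_sum_simps direct_support_def)
    have "direct_lift S L N \<theta> (c \<oplus>\<^bsub>DS\<^esub> c') = (\<Oplus>\<^bsub>N\<^esub>i\<in>?T. \<theta> i ((c \<oplus>\<^bsub>DS\<^esub> c') i))"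
      using sup D.M.a_closed[OF c] T direct_support_add by blast
    also have "\<dots> = (\<Oplus>\<^bsub>N\<^esub>i\<in>?T. \<theta> i (c i) \<oplus>\<^bsub>N\<^esub> \<theta> i (c' i))"
    proof (rule N.finsum_cong')
      fix i assume "i \<in> ?T"
      then have i: "i \<in> S" using T by blast
      show "\<theta> i ((c \<oplus>\<^bsub>DS\<^esub> c') i) = \<theta> i (c i) \<oplus>\<^bsub>N\<^esub> \<theta> i (c' i)"
        using ahom_add[OF \<theta>'[OF i] mem[OF c(1) i] mem[OF c(2) i]] i by (simp add: direct_sum_simps)
    qed (use cl c T in auto)
    also have "\<dots> = (\<Oplus>\<^bsub>N\<^esub>i\<in>?T. \<theta> i (c i)) \<oplus>\<^bsub>N\<^esub> (\<Oplus>\<^bsub>N\<^esub>i\<in>?T. \<theta> i (c' i))"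
      using cl c T by (intro N.finsum_addf) auto
    also have "\<dots> = direct_lift S L N \<theta> c \<oplus>\<^bsub>N\<^esub> direct_lift S L N \<theta> c'"
      using sup[OF _ c(1) T(1) _ T(2)] sup[OF _ c(2) T(1) _ T(2)] by simp
    finally show "direct_lift S L N \<theta> (c \<oplus>\<^bsub>DS\<^esub> c') = direct_lift S L N \<theta> c \<oplus>\<^bsub>N\<^esub> direct_lift S L N \<theta> c'" .
  qed
  moreover have "direct_lift S L N \<theta> (r \<odot>\<^bsub>DS\<^esub> c) = r \<odot>\<^bsub>N\<^esub> direct_lift S L N \<theta> c"
    if r: "r \<in> carrier R" and c: "c \<in> carrier (DS)" for r c
  proof -
    let ?T = "direct_support S L c"
    have T: "finite ?T" "?T \<subseteq> S"
      using c by (auto simp: direct_sum_simps direct_support_def)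
    have "direct_lift S L N \<theta> (r \<odot>\<^bsub>DS\<^esub> c) = (\<Oplus>\<^bsub>N\<^esub>i\<in>?T. \<theta> i ((r \<odot>\<^bsub>DS\<^esub> c) i))"
      using sup[OF _ D.smult_closed[OF r c] T(1) direct_support_smult[OF r] T(2)] by simp
    also have "\<dots> = (\<Oplus>\<^bsub>N\<^esub>i\<in>?T. r \<odot>\<^bsub>N\<^esub> \<theta> i (c i))"
    proof (rule N.finsum_cong')
      fix i assume "i \<in> ?T"
      then have i: "i \<in> S" using T by blast
      show "\<theta> i ((r \<odot>\<^bsub>DS\<^esub> c) i) = r \<odot>\<^bsub>N\<^esub> \<theta> i (c i)"
        using mhom_smult[OF \<theta>[OF i] r mem[OF c i]] i by (simp add: direct_sum_simps)
    qed (use cl c T r N.smult_closed in auto)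
    also have "\<dots> = r \<odot>\<^bsub>N\<^esub> direct_lift S L N \<theta> c"
      unfolding direct_lift_def
      using ahom_finsum[OF N.M.abelian_group_axioms N.M.abelian_group_axioms N.smult_ahom[OF r],
          of ?T "\<lambda>i. \<theta> i (c i)"] cl[OF c subsetD[OF T(2)]] by simp
    finally show ?thesis .
  qed
  ultimately show ?thesis
    by (simp add: mhom_def)
qed

lemma direct_lift_direct_single:
  assumes N: "abelian_group N" and \<theta>: "\<And>i. i \<in> S \<Longrightarrow> \<theta> i \<in> ahom (L i) N"
    and i: "i \<in> S" and m: "m \<in> carrier (L i)"
  shows "direct_lift S L N \<theta> (direct_single S L i m) = \<theta> i m"
proof -
  interpret N: abelian_group N by fact
  have "direct_lift S L N \<theta> (direct_single S L i m) = (\<Oplus>\<^bsub>N\<^esub>j\<in>{i}. \<theta> j (direct_single S L i m j))"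
    by (rule direct_lift_superset[OF N \<theta> direct_single_closed]) (use i m direct_support_direct_single in auto)
  also have "\<dots> = \<theta> i m"
    using i m ahom_closed[OF \<theta>[OF i] m] by (simp add: direct_single_def)
  finally show ?thesis .
qed

lemma direct_sum_expand:
  assumes c: "c \<in> carrier (DS)"
  shows "(\<Oplus>\<^bsub>DS\<^esub>i\<in>direct_support S L c. direct_single S L i (c i)) = c"
proof
  interpret D: left_module R "DS" by (rule left_module_direct_sum)
  have mem: "c i \<in> carrier (L i)" if "i \<in> S" for i
    using that c by (auto simp: direct_sum_simps)
  have sm: "direct_single S L i (c i) \<in> carrier (DS)" if "i \<in> direct_support S L c" for i
    using that mem by (intro direct_single_closed) (auto simp: direct_support_def)
  have fin: "finite (direct_support S L c)"
    using c by (simp add: direct_sum_simps)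
  fix j
  show "(\<Oplus>\<^bsub>DS\<^esub>i\<in>direct_support S L c. direct_single S L i (c i)) j = c j"
  proof (cases "j \<in> S")
    case True
    interpret Lj: left_module R "L j" using family[OF True] .
    have "(\<Oplus>\<^bsub>DS\<^esub>i\<in>direct_support S L c. direct_single S L i (c i)) j = (\<Oplus>\<^bsub>L j\<^esub>i\<in>direct_support S L c. direct_single S L i (c i) j)"
      by (rule ahom_finsum[OF D.M.abelian_group_axioms Lj.M.abelian_group_axioms eval_ahom[OF True]])
        (use sm in auto)
    \<comment> \<open>Inserting \<open>j\<close> makes this a sum with one distinguished index even
      when \<open>c j\<close> is zero.\<close>
    also have "\<dots> = (\<Oplus>\<^bsub>L j\<^esub>i\<in>insert j (direct_support S L c). if j = i then c i else \<zero>\<^bsub>L j\<^esub>)"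
      using True fin mem
      by (intro Lj.M.add.finprod_mono_neutral_cong_left) (auto simp: direct_single_def direct_support_def)
    also have "\<dots> = (\<Oplus>\<^bsub>L j\<^esub>i\<in>insert j (direct_support S L c). if j = i then c j else \<zero>\<^bsub>L j\<^esub>)"
      using mem[OF True] by (intro Lj.M.finsum_cong') auto
    also have "\<dots> = c j"
      using True fin mem Lj.M.finsum_singleton[of j "insert j (direct_support S L c)" "\<lambda>_. c j"] by auto
    finally show ?thesis .
  next
    case False
    have "(\<Oplus>\<^bsub>DS\<^esub>i\<in>direct_support S L c. direct_single S L i (c i)) \<in> carrier (DS)"
      using sm by (intro D.M.finsum_closed) auto
    then show ?thesis
      using False c by (auto simp: direct_sum_simps PiE_iff extensional_def)
  qed
qed

text \<open>Every identity between operators on chains is reduced by this to a single simplex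
  carrying a single lift.\<close>

lemma direct_sum_ext:
  assumes N: "abelian_group N" and h: "h \<in> ahom (DS) N" "k \<in> ahom (DS) N"
    and eq: "\<And>i m. \<lbrakk>i \<in> S; m \<in> carrier (L i)\<rbrakk> \<Longrightarrow> h (direct_single S L i m) = k (direct_single S L i m)"
    and c: "c \<in> carrier (DS)"
  shows "h c = k c"
proof -
  interpret N: abelian_group N by fact
  have mem: "c i \<in> carrier (L i)" if "i \<in> S" for i
    using that c by (auto simp: direct_sum_simps)
  have sm: "direct_single S L i (c i) \<in> carrier (DS)" if "i \<in> direct_support S L c" for i
    using that mem by (intro direct_single_closed) (auto simp: direct_support_def)
  have "h c = h (\<Oplus>\<^bsub>DS\<^esub>i\<in>direct_support S L c. direct_single S L i (c i))"
    using direct_sum_expand[OF c] by simp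
  also have "\<dots> = (\<Oplus>\<^bsub>N\<^esub>i\<in>direct_support S L c. h (direct_single S L i (c i)))"
    by (rule ahom_finsum[OF direct_sum_group N h(1) sm])
  also have "\<dots> = (\<Oplus>\<^bsub>N\<^esub>i\<in>direct_support S L c. k (direct_single S L i (c i)))"
    using eq mem ahom_closed[OF h(2) sm] by (intro N.finsum_cong') (auto simp: direct_support_def)
  also have "\<dots> = k (\<Oplus>\<^bsub>DS\<^esub>i\<in>direct_support S L c. direct_single S L i (c i))"
    by (rule ahom_finsum[OF direct_sum_group N h(2) sm, symmetric])
  also have "\<dots> = k c"
    using direct_sum_expand[OF c] by simp
  finally show ?thesis .
qed

end

section \<open>Quotient modules\<close>

lemma (in abelian_group) a_rcos_eq:
  assumes B: "B \<subseteq> carrier G" "\<zero> \<in> B" "\<And>x y. \<lbrakk>x \<in> B; y \<in> B\<rbrakk> \<Longrightarrow> x \<oplus> y \<in> B" "\<And>x. x \<in> B \<Longrightarrow> \<ominus> x \<in> B"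
    and xy: "x \<in> carrier G" "y \<in> carrier G"
  shows "B +> x = B +> y \<longleftrightarrow> x \<ominus> y \<in> B"
proof
  assume "B +> x = B +> y"
  moreover have "x \<in> B +> x"
    using B(2) xy by (auto simp: a_r_coset_def' intro!: bexI[of _ \<zero>])
  ultimately obtain b where "b \<in> B" "x = b \<oplus> y"
    by (auto simp: a_r_coset_def')
  then show "x \<ominus> y \<in> B"
    using B(1) xy by (auto simp: minus_eq a_assoc r_neg)
next
  have *: "B +> u \<subseteq> B +> v" if "u \<in> carrier G" "v \<in> carrier G" "u \<ominus> v \<in> B" for u v
  proof
    fix z assume "z \<in> B +> u"
    then obtain b where b: "b \<in> B" "z = b \<oplus> u"
      by (auto simp: a_r_coset_def')
    then have "z = (b \<oplus> (u \<ominus> v)) \<oplus> v"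
      using that B(1) by (auto simp: minus_eq a_assoc l_neg)
    then show "z \<in> B +> v"
      using b that B(3) by (auto simp: a_r_coset_def')
  qed
  assume "x \<ominus> y \<in> B"
  moreover from this have "y \<ominus> x \<in> B"
    using B(4)[of "x \<ominus> y"] xy by (simp add: minus_eq minus_add a_comm)
  ultimately show "B +> x = B +> y"
    using * xy by blast
qed

text \<open>Negatives are covered by the scalars, since -x = (-1)x.\<close>

definition submod :: "('r, 'k) ring_scheme \<Rightarrow> ('r, 'm, 'x) module_scheme \<Rightarrow> 'm set \<Rightarrow> bool" where
  "submod R M B \<longleftrightarrow> B \<subseteq> carrier M \<and> \<zero>\<^bsub>M\<^esub> \<in> B \<and> (\<forall>x\<in>B. \<forall>y\<in>B. x \<oplus>\<^bsub>M\<^esub> y \<in> B) \<and>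
     (\<forall>r\<in>carrier R. \<forall>x\<in>B. r \<odot>\<^bsub>M\<^esub> x \<in> B)"

lemma submodD:
  assumes "submod R M B"
  shows "x \<in> B \<Longrightarrow> x \<in> carrier M" "\<zero>\<^bsub>M\<^esub> \<in> B"
    "\<lbrakk>x \<in> B; y \<in> B\<rbrakk> \<Longrightarrow> x \<oplus>\<^bsub>M\<^esub> y \<in> B"
    "\<lbrakk>r \<in> carrier R; x \<in> B\<rbrakk> \<Longrightarrow> r \<odot>\<^bsub>M\<^esub> x \<in> B"
  using assms by (auto simp: submod_def)

lemma submod_neg:
  assumes "left_module R M" "submod R M B" "x \<in> B"
  shows "\<ominus>\<^bsub>M\<^esub> x \<in> B"
proof -
  interpret left_module R M by fact
  show ?thesis
    using submodD[OF assms(2)] assms(3) by (auto simp: neg_smult)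
qed

lemma submod_finsum:
  assumes "left_module R M" "submod R M B" "\<And>i. i \<in> I \<Longrightarrow> u i \<in> B"
  shows "(\<Oplus>\<^bsub>M\<^esub>i\<in>I. u i) \<in> B"
proof -
  interpret left_module R M by fact
  note B = submodD[OF assms(2)]
  show ?thesis
    using assms(3)
  proof (induction I rule: infinite_finite_induct)
    case (insert i I)
    then have "(\<Oplus>\<^bsub>M\<^esub>i\<in>insert i I. u i) = u i \<oplus>\<^bsub>M\<^esub> (\<Oplus>\<^bsub>M\<^esub>i\<in>I. u i)"
      by (intro M.finsum_insert) (auto intro: B(1))
    then show ?case
      using B(3) insert by auto
  qed (simp_all add: B(2))
qed

lemma submod_vimage:
  assumes "left_module R M" "left_module R N" "h \<in> mhom R M N" "submod R N B"
  shows "submod R M {x \<in> carrier M. h x \<in> B}"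
proof -
  interpret M: left_module R M by fact
  interpret N: left_module R N by fact
  show ?thesis
    unfolding submod_def
    using submodD[OF assms(4)] M.smult_closed mhom_smult[OF assms(3)]
      ahom_add[OF mhom_ahom[OF assms(3)]]
      ahom_zero[OF M.M.abelian_group_axioms N.M.abelian_group_axioms mhom_ahom[OF assms(3)]]
    by auto
qed

lemma submod_image:
  assumes "left_module R M" "left_module R N" "h \<in> mhom R M N" "submod R M B"
  shows "submod R N (h ` B)"
proof -
  interpret M: left_module R M by fact
  interpret N: left_module R N by fact
  note B = submodD[OF assms(4)]
  note add = ahom_add[OF mhom_ahom[OF assms(3)]]
  show ?thesis
    unfolding submod_def
  proof (intro conjI ballI)
    show "h ` B \<subseteq> carrier N"
      using B(1) ahom_closed[OF mhom_ahom[OF assms(3)]] by auto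
    show "\<zero>\<^bsub>N\<^esub> \<in> h ` B"
      using ahom_zero[OF M.M.abelian_group_axioms N.M.abelian_group_axioms mhom_ahom[OF assms(3)]]
        B(2) by (metis imageI)
    show "x \<oplus>\<^bsub>N\<^esub> y \<in> h ` B" if xy: "x \<in> h ` B" "y \<in> h ` B" for x y
    proof -
      obtain u v where "u \<in> B" "v \<in> B" "x = h u" "y = h v" using xy by blast
      then show ?thesis using B(3)[of u v] add[OF B(1) B(1), of u v] xy by (metis imageI)
    qed
    show "r \<odot>\<^bsub>N\<^esub> x \<in> h ` B" if rx: "r \<in> carrier R" "x \<in> h ` B" for r x
    proof -
      obtain u where "u \<in> B" "x = h u" using rx by blast
      then show ?thesis
        using B(4)[of r u] mhom_smult[OF assms(3) _ B(1), of r u] rx by (metis imageI)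
    qed
  qed
qed

lemma submod_Int: "\<lbrakk>submod R M A; submod R M B\<rbrakk> \<Longrightarrow> submod R M (A \<inter> B)"
  by (auto simp: submod_def)

lemma submod_carrier: "left_module R M \<Longrightarrow> submod R M (carrier M)"
proof -
  assume "left_module R M"
  then interpret left_module R M .
  show ?thesis
    by (simp add: submod_def smult_closed)
qed

lemma submod_abelian_subgroup:
  assumes "left_module R M" "submod R M B"
  shows "abelian_subgroup B M"
proof (rule abelian_subgroupI3)
  interpret left_module R M by fact
  show "abelian_group M" ..
  note B = submodD[OF assms(2)]
  show "additive_subgroup B M"
  proof (rule additive_subgroupI, rule group.subgroupI[OF M.a_group])
    show "B \<subseteq> carrier (add_monoid M)" "B \<noteq> {}"
      using B(1,2) by auto
    show "inv\<^bsub>add_monoid M\<^esub> a \<in> B" if "a \<in> B" for a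
      using submod_neg[OF assms that] by (simp add: a_inv_def)
    show "a \<otimes>\<^bsub>add_monoid M\<^esub> b \<in> B" if "a \<in> B" "b \<in> B" for a b
      using B(3) that by simp
  qed
qed

lemma submod_zero: "left_module R M \<Longrightarrow> submod R M {\<zero>\<^bsub>M\<^esub>}"
proof -
  assume "left_module R M"
  then interpret left_module R M .
  show ?thesis
    using ahom_zero[OF M.abelian_group_axioms M.abelian_group_axioms smult_ahom]
    by (auto simp: submod_def)
qed

lemma submod_cosets:
  assumes M: "left_module R M" and B: "submod R M B"
  shows coset_self: "z \<in> carrier M \<Longrightarrow> z \<in> B +>\<^bsub>M\<^esub> z"
    and coset_eq: "\<lbrakk>x \<in> carrier M; y \<in> carrier M\<rbrakk> \<Longrightarrow> B +>\<^bsub>M\<^esub> x = B +>\<^bsub>M\<^esub> y \<longleftrightarrow> x \<ominus>\<^bsub>M\<^esub> y \<in> B"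
    and coset_absorb: "\<lbrakk>b \<in> B; z \<in> carrier M\<rbrakk> \<Longrightarrow> B +>\<^bsub>M\<^esub> (b \<oplus>\<^bsub>M\<^esub> z) = B +>\<^bsub>M\<^esub> z"
    and coset_add: "\<lbrakk>x \<in> carrier M; y \<in> carrier M\<rbrakk> \<Longrightarrow>
      set_add M (B +>\<^bsub>M\<^esub> x) (B +>\<^bsub>M\<^esub> y) = B +>\<^bsub>M\<^esub> (x \<oplus>\<^bsub>M\<^esub> y)"
    and coset_smult: "\<lbrakk>r \<in> carrier R; z \<in> carrier M\<rbrakk> \<Longrightarrow>
      (\<Union>x\<in>B +>\<^bsub>M\<^esub> z. B +>\<^bsub>M\<^esub> (r \<odot>\<^bsub>M\<^esub> x)) = B +>\<^bsub>M\<^esub> (r \<odot>\<^bsub>M\<^esub> z)"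
proof -
  interpret M: left_module R M by fact
  interpret B: abelian_subgroup B M by (rule submod_abelian_subgroup) fact+
  note Bs = submodD[OF B]
  show self: "z \<in> B +>\<^bsub>M\<^esub> z" if "z \<in> carrier M" for z
    using B.a_rcos_self that by blast
  have eq: "B +>\<^bsub>M\<^esub> x = B +>\<^bsub>M\<^esub> y \<longleftrightarrow> x \<ominus>\<^bsub>M\<^esub> y \<in> B" if "x \<in> carrier M" "y \<in> carrier M" for x y
    using that Bs submod_neg[OF M B] by (intro M.a_rcos_eq) auto
  then show "\<lbrakk>x \<in> carrier M; y \<in> carrier M\<rbrakk> \<Longrightarrow> B +>\<^bsub>M\<^esub> x = B +>\<^bsub>M\<^esub> y \<longleftrightarrow> x \<ominus>\<^bsub>M\<^esub> y \<in> B" .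
  show absorb: "B +>\<^bsub>M\<^esub> (b \<oplus>\<^bsub>M\<^esub> z) = B +>\<^bsub>M\<^esub> z" if "b \<in> B" "z \<in> carrier M" for b z
    using that Bs(1) by (subst eq) (auto simp: M.M.minus_eq M.M.a_assoc M.M.r_neg)
  show "\<lbrakk>x \<in> carrier M; y \<in> carrier M\<rbrakk> \<Longrightarrow>
      set_add M (B +>\<^bsub>M\<^esub> x) (B +>\<^bsub>M\<^esub> y) = B +>\<^bsub>M\<^esub> (x \<oplus>\<^bsub>M\<^esub> y)"
    by (rule B.a_rcos_sum)
  assume r: "r \<in> carrier R" and z: "z \<in> carrier M"
  have "B +>\<^bsub>M\<^esub> (r \<odot>\<^bsub>M\<^esub> x) = B +>\<^bsub>M\<^esub> (r \<odot>\<^bsub>M\<^esub> z)" if xB: "x \<in> B +>\<^bsub>M\<^esub> z" for x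
  proof -
    obtain b where "b \<in> B" "x = b \<oplus>\<^bsub>M\<^esub> z" using xB by (auto simp: a_r_coset_def')
    then show ?thesis
      using absorb[OF Bs(4) M.smult_closed] Bs(1) r z by (simp add: M.smult_r_distr)
  qed
  then show "(\<Union>x\<in>B +>\<^bsub>M\<^esub> z. B +>\<^bsub>M\<^esub> (r \<odot>\<^bsub>M\<^esub> x)) = B +>\<^bsub>M\<^esub> (r \<odot>\<^bsub>M\<^esub> z)"
    using self[OF z] by blast
qed

text \<open>Injectivity and surjectivity are required of cycles modulo boundaries, the form in which
  chain homotopies deliver them. The union over a coset is the formula of \<open>IH_induced\<close>;
  it collapses to one coset because \<open>h\<close> sends \<open>B\<close> into
  \<open>B'\<close>.\<close>

lemma quotient_module_iso:
  fixes M :: "('r, 'm) module" and N :: "('r, 'n) module"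
  assumes M: "left_module R M" and N: "left_module R N" and h: "h \<in> mhom R M N"
    and Z: "submod R M Z" and B: "submod R M B" and Z': "submod R N Z'" and B': "submod R N B'"
    and hZ: "\<And>z. z \<in> Z \<Longrightarrow> h z \<in> Z'" and hB: "\<And>z. z \<in> B \<Longrightarrow> h z \<in> B'"
    and inj: "\<And>z. \<lbrakk>z \<in> Z; h z \<in> B'\<rbrakk> \<Longrightarrow> z \<in> B"
    and surj: "\<And>z'. z' \<in> Z' \<Longrightarrow> \<exists>z\<in>Z. h z \<ominus>\<^bsub>N\<^esub> z' \<in> B'"
  shows "(\<lambda>A. \<Union>c\<in>A. B' +>\<^bsub>N\<^esub> h c)
     \<in> module_iso R (quotient_module (M\<lparr>carrier := Z\<rparr>) B) (quotient_module (N\<lparr>carrier := Z'\<rparr>) B')"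
proof -
  interpret M: left_module R M by fact
  interpret N: left_module R N by fact
  note Zs = submodD[OF Z] and Bs = submodD[OF B] and Zs' = submodD[OF Z']
  note hc = ahom_closed[OF mhom_ahom[OF h]] and ha = ahom_add[OF mhom_ahom[OF h]]
    and hm = mhom_smult[OF h]
  \<comment> \<open>A coset is formed with the addition alone, so shrinking the carrier to the
    cycles does not change it.\<close>
  have Mrc: "A +>\<^bsub>M\<lparr>carrier := Z\<rparr>\<^esub> x = A +>\<^bsub>M\<^esub> x" for A x
    by (simp add: a_r_coset_def')
  have Nrc: "A +>\<^bsub>N\<lparr>carrier := Z'\<rparr>\<^esub> x = A +>\<^bsub>N\<^esub> x" for A x
    by (simp add: a_r_coset_def')
  have Mcar: "carrier (quotient_module (M\<lparr>carrier := Z\<rparr>) B) = (\<lambda>z. B +>\<^bsub>M\<^esub> z) ` Z"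
    by (auto simp: quotient_module_def A_RCOSETS_def' Mrc)
  have Ncar: "carrier (quotient_module (N\<lparr>carrier := Z'\<rparr>) B') = (\<lambda>z. B' +>\<^bsub>N\<^esub> z) ` Z'"
    by (auto simp: quotient_module_def A_RCOSETS_def' Nrc)
  define \<Phi> where "\<Phi> A = (\<Union>c\<in>A. B' +>\<^bsub>N\<^esub> h c)" for A
  have \<Phi>: "\<Phi> (B +>\<^bsub>M\<^esub> z) = B' +>\<^bsub>N\<^esub> h z" if "z \<in> carrier M" for z
  proof -
    have "B' +>\<^bsub>N\<^esub> h c = B' +>\<^bsub>N\<^esub> h z" if cB: "c \<in> B +>\<^bsub>M\<^esub> z" for c
    proof -
      obtain b where "b \<in> B" "c = b \<oplus>\<^bsub>M\<^esub> z" using cB by (auto simp: a_r_coset_def')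
      then show ?thesis
        using coset_absorb[OF N B' hB hc] ha Bs(1) \<open>z \<in> carrier M\<close> by simp
    qed
    moreover have "z \<in> B +>\<^bsub>M\<^esub> z"
      by (rule coset_self[OF M B that])
    ultimately show ?thesis
      unfolding \<Phi>_def by blast
  qed
  have bij: "bij_betw \<Phi> ((\<lambda>z. B +>\<^bsub>M\<^esub> z) ` Z) ((\<lambda>z. B' +>\<^bsub>N\<^esub> z) ` Z')"
  proof (rule bij_betwI')
    fix A A' assume "A \<in> (\<lambda>z. B +>\<^bsub>M\<^esub> z) ` Z" "A' \<in> (\<lambda>z. B +>\<^bsub>M\<^esub> z) ` Z"
    then obtain x y where xy: "x \<in> Z" "y \<in> Z" "A = B +>\<^bsub>M\<^esub> x" "A' = B +>\<^bsub>M\<^esub> y"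
      by blast
    have "h (x \<ominus>\<^bsub>M\<^esub> y) = h x \<ominus>\<^bsub>N\<^esub> h y"
      using ha ahom_neg[OF M.M.abelian_group_axioms N.M.abelian_group_axioms mhom_ahom[OF h]]
        xy Zs(1) by (simp add: M.M.minus_eq N.M.minus_eq)
    moreover have "x \<ominus>\<^bsub>M\<^esub> y \<in> Z"
      using xy Zs(3) submod_neg[OF M Z] by (simp add: M.M.minus_eq)
    ultimately have "h x \<ominus>\<^bsub>N\<^esub> h y \<in> B' \<longleftrightarrow> x \<ominus>\<^bsub>M\<^esub> y \<in> B"
      by (metis hB inj)
    then show "\<Phi> A = \<Phi> A' \<longleftrightarrow> A = A'"
      using xy Zs(1) hc by (simp add: \<Phi> coset_eq[OF M B] coset_eq[OF N B'])
  next
    fix A assume "A \<in> (\<lambda>z. B +>\<^bsub>M\<^esub> z) ` Z"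
    then show "\<Phi> A \<in> (\<lambda>z. B' +>\<^bsub>N\<^esub> z) ` Z'"
      using \<Phi> Zs(1) hZ by auto
  next
    fix A assume "A \<in> (\<lambda>z. B' +>\<^bsub>N\<^esub> z) ` Z'"
    then obtain z' where z': "z' \<in> Z'" "A = B' +>\<^bsub>N\<^esub> z'" by blast
    then obtain z where z: "z \<in> Z" "h z \<ominus>\<^bsub>N\<^esub> z' \<in> B'" using surj by blast
    then have "A = \<Phi> (B +>\<^bsub>M\<^esub> z)"
      using z' Zs(1) Zs'(1) hc coset_eq[OF N B', of "h z" z'] by (simp add: \<Phi>)
    then show "\<exists>x\<in>(\<lambda>z. B +>\<^bsub>M\<^esub> z) ` Z. A = \<Phi> x"
      using z by blast
  qed
  have addM': "set_add (M\<lparr>carrier := Z\<rparr>) = set_add M" and addN': "set_add (N\<lparr>carrier := Z'\<rparr>) = set_add N"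
    by (auto simp: set_add_def' fun_eq_iff)
  have "\<Phi> \<in> module_iso R (quotient_module (M\<lparr>carrier := Z\<rparr>) B) (quotient_module (N\<lparr>carrier := Z'\<rparr>) B')"
    unfolding module_iso_def mem_Collect_eq Mcar Ncar
  proof (intro conjI ballI)
    fix A A' assume "A \<in> (\<lambda>z. B +>\<^bsub>M\<^esub> z) ` Z" "A' \<in> (\<lambda>z. B +>\<^bsub>M\<^esub> z) ` Z"
    then obtain x y where xy: "x \<in> Z" "y \<in> Z" "A = B +>\<^bsub>M\<^esub> x" "A' = B +>\<^bsub>M\<^esub> y"
      by blast
    then show "\<Phi> (A \<oplus>\<^bsub>quotient_module (M\<lparr>carrier := Z\<rparr>) B\<^esub> A')
        = \<Phi> A \<oplus>\<^bsub>quotient_module (N\<lparr>carrier := Z'\<rparr>) B'\<^esub> \<Phi> A'"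
      using Zs(1) hc by (simp add: quotient_module_def addM' addN' coset_add[OF M B] coset_add[OF N B'] \<Phi> ha)
  next
    fix r A assume r: "r \<in> carrier R" and "A \<in> (\<lambda>z. B +>\<^bsub>M\<^esub> z) ` Z"
    then obtain x where x: "x \<in> Z" "A = B +>\<^bsub>M\<^esub> x"
      by blast
    then show "\<Phi> (r \<odot>\<^bsub>quotient_module (M\<lparr>carrier := Z\<rparr>) B\<^esub> A)
        = r \<odot>\<^bsub>quotient_module (N\<lparr>carrier := Z'\<rparr>) B'\<^esub> \<Phi> A"
      using Zs(1) hc r by (simp add: quotient_module_def Mrc Nrc coset_smult[OF M B] coset_smult[OF N B'] \<Phi> hm M.smult_closed)
  qed (rule bij)
  then show ?thesis
    by (simp add: \<Phi>_def[abs_def])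
qed

section \<open>Parallel transport in local systems\<close>

lemma continuous_map_comp:
  "\<lbrakk>continuous_map Y Z g; continuous_map X Y f\<rbrakk> \<Longrightarrow> continuous_map X Z (\<lambda>x. g (f x))"
  using continuous_map_compose[of X Y f Z g] by (simp add: o_def)

lemma continuous_map_local:
  assumes "\<And>x. x \<in> topspace T \<Longrightarrow>
    \<exists>V. openin T V \<and> x \<in> V \<and> continuous_map (subtopology T V) Z u"
  shows "continuous_map T Z u"
proof -
  obtain V where V: "\<And>x. x \<in> topspace T \<Longrightarrow> openin T (V x) \<and> x \<in> V x \<and> continuous_map (subtopology T (V x)) Z u"
    using assms by metis
  show ?thesis
    by (rule pasting_lemma[where I = "topspace T" and T = V and f = "\<lambda>_. u"]) (use V in auto)
qed

text \<open>Fibre coordinates take values in a discrete space and are therefore locally constant;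
  this drives the uniqueness of lifts.\<close>

lemma openin_discrete_level:
  assumes k: "continuous_map (subtopology T N) (discrete_topology D) k" and N: "openin T N" and t: "t \<in> N"
  shows "openin T {a \<in> N. k a = k t}"
proof -
  have NT: "topspace (subtopology T N) = N"
    using N openin_subset by fastforce
  then have "k t \<in> D"
    using continuous_map_image_subset_topspace[OF k] t by auto
  then have "openin (subtopology T N) {a \<in> N. k a \<in> {k t}}"
    using openin_continuous_map_preimage[OF k, of "{k t}"] unfolding NT by simp
  then show ?thesis
    using N by (simp add: openin_trans_full)
qed

text \<open>A trivialization, split into the chart \<open>\<phi>\<close> and the fibre coordinate \<open>c\<close> of its inverse.\<close>

definition chart ::
    "('r, 'k) ring_scheme \<Rightarrow> 'a topology \<Rightarrow> ('r, 'a, 'e) coeff_system \<Rightarrow> 'a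
     \<Rightarrow> 'a set \<Rightarrow> ('a \<times> 'e \<Rightarrow> 'e) \<Rightarrow> ('e \<Rightarrow> 'e) \<Rightarrow> bool" where
  "chart R B G b U \<phi> c \<longleftrightarrow>
     openin B U \<and> b \<in> U \<and>
     continuous_map (prod_topology (subtopology B U) (discrete_topology (carrier (cs_fiber G b))))
       (cs_total G) \<phi> \<and>
     continuous_map (subtopology (cs_total G) {e \<in> topspace (cs_total G). cs_proj G e \<in> U})
       (discrete_topology (carrier (cs_fiber G b))) c \<and>
     (\<forall>x \<in> U. \<forall>m \<in> carrier (cs_fiber G b). c (\<phi> (x, m)) = m) \<and>
     (\<forall>e \<in> topspace (cs_total G). cs_proj G e \<in> U \<longrightarrow> \<phi> (cs_proj G e, c e) = e) \<and>
     (\<forall>x \<in> U. (\<lambda>m. \<phi> (x, m)) \<in> module_iso R (cs_fiber G b) (cs_fiber G x))"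

locale coeff_bundle =
  fixes R :: "('r, 'k) ring_scheme" and B :: "'a topology" and G :: "('r, 'a, 'e) coeff_system"
  assumes local_system: "local_system R B G"
begin

abbreviation E :: "'e topology" where "E \<equiv> cs_total G"
abbreviation proj :: "'e \<Rightarrow> 'a" where "proj \<equiv> cs_proj G"
abbreviation F :: "'a \<Rightarrow> ('r, 'e) module" where "F \<equiv> cs_fiber G"

lemma ring: "ring R"
  using local_system by (simp add: local_system_def)

lemma proj_cont: "continuous_map E B proj"
  using local_system by (simp add: local_system_def)

lemma fib_module: "b \<in> topspace B \<Longrightarrow> left_module R (F b)"
  using local_system by (simp add: local_system_def)

lemma fib_carrier: "b \<in> topspace B \<Longrightarrow> carrier (F b) = {e \<in> topspace E. proj e = b}"
  using local_system by (simp add: local_system_def)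

lemma proj_in: "e \<in> topspace E \<Longrightarrow> proj e \<in> topspace B"
  using continuous_map_image_subset_topspace[OF proj_cont] by blast

lemma in_fib: "e \<in> topspace E \<Longrightarrow> e \<in> carrier (F (proj e))"
  using fib_carrier[OF proj_in] by blast

lemma ex_chart:
  assumes b: "b \<in> topspace B"
  obtains U \<phi> c where "chart R B G b U \<phi> c"
proof -
  let ?D = "discrete_topology (carrier (F b))"
  obtain U \<phi> where U: "openin B U" "b \<in> U"
    and hm: "homeomorphic_map (prod_topology (subtopology B U) ?D)
          (subtopology E {e \<in> topspace E. proj e \<in> U}) \<phi>"
    and iso: "\<And>x. x \<in> U \<Longrightarrow> (\<lambda>m. \<phi> (x, m)) \<in> module_iso R (F b) (F x)"
    using local_system b by (force simp: local_system_def)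
  obtain \<psi> where \<psi>: "homeomorphic_maps (prod_topology (subtopology B U) ?D)
          (subtopology E {e \<in> topspace E. proj e \<in> U}) \<phi> \<psi>"
    using hm homeomorphic_map_maps by blast
  have UB: "U \<subseteq> topspace B"
    using U openin_subset by blast
  have \<phi>\<psi>: "\<phi> (\<psi> e) = e \<and> \<psi> e \<in> U \<times> carrier (F b)" if "e \<in> topspace E" "proj e \<in> U" for e
  proof -
    have "e \<in> topspace (subtopology E {e \<in> topspace E. proj e \<in> U})" using that by simp
    then have "\<psi> e \<in> topspace (prod_topology (subtopology B U) ?D)" "\<phi> (\<psi> e) = e"
      using \<psi> unfolding homeomorphic_maps_def
      by (meson continuous_map_image_subset_topspace image_subset_iff)+
    then show ?thesis by auto
  qed
  \<comment> \<open>A trivialization is not given as a map over \<open>U\<close>. It is one because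
    it carries the model fibre into the fibre over \<open>x\<close>.\<close>
  have pr\<phi>: "proj (\<phi> (x, m)) = x" if "x \<in> U" "m \<in> carrier (F b)" for x m
  proof -
    have "\<phi> (x, m) \<in> carrier (F x)"
      using iso[OF that(1)] that(2) by (auto simp: module_iso_def bij_betw_def)
    then show ?thesis using fib_carrier UB that by auto
  qed
  have "chart R B G b U \<phi> (snd \<circ> \<psi>)"
    unfolding chart_def
  proof (intro conjI ballI impI)
    show "continuous_map (prod_topology (subtopology B U) ?D) E \<phi>"
      using \<psi> by (auto simp: homeomorphic_maps_def continuous_map_in_subtopology)
    show "continuous_map (subtopology E {e \<in> topspace E. proj e \<in> U}) ?D (snd \<circ> \<psi>)"
      using \<psi> by (auto simp: homeomorphic_maps_def continuous_map_pairwise)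
    show "(snd \<circ> \<psi>) (\<phi> (x, m)) = m" if "x \<in> U" "m \<in> carrier (F b)" for x m
      using \<psi> that UB by (auto simp: homeomorphic_maps_def)
    show "\<phi> (proj e, (snd \<circ> \<psi>) e) = e" if "e \<in> topspace E" "proj e \<in> U" for e
    proof -
      have "proj e = fst (\<psi> e)"
        using \<phi>\<psi>[OF that] pr\<phi>[of "fst (\<psi> e)" "snd (\<psi> e)"] by (metis mem_Times_iff prod.collapse)
      then show ?thesis using \<phi>\<psi>[OF that] by simp
    qed
  qed (use U iso in auto)
  then show thesis by (rule that)
qed

context
  fixes b U \<phi> c assumes ch: "chart R B G b U \<phi> c"
begin

lemma chart_open: "openin B U" and chart_mem: "b \<in> U" and chart_sub: "U \<subseteq> topspace B"
  and chart_c\<phi>: "\<lbrakk>x \<in> U; m \<in> carrier (F b)\<rbrakk> \<Longrightarrow> c (\<phi> (x, m)) = m"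
  and chart_\<phi>c: "\<lbrakk>e \<in> topspace E; proj e \<in> U\<rbrakk> \<Longrightarrow> \<phi> (proj e, c e) = e"
  and chart_c: "\<lbrakk>e \<in> topspace E; proj e \<in> U\<rbrakk> \<Longrightarrow> c e \<in> carrier (F b)"
  and chart_iso: "x \<in> U \<Longrightarrow> (\<lambda>m. \<phi> (x, m)) \<in> module_iso R (F b) (F x)"
proof -
  show "openin B U" "b \<in> U"
    "\<lbrakk>x \<in> U; m \<in> carrier (F b)\<rbrakk> \<Longrightarrow> c (\<phi> (x, m)) = m"
    "\<lbrakk>e \<in> topspace E; proj e \<in> U\<rbrakk> \<Longrightarrow> \<phi> (proj e, c e) = e"
    "x \<in> U \<Longrightarrow> (\<lambda>m. \<phi> (x, m)) \<in> module_iso R (F b) (F x)"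
    using ch by (auto simp: chart_def)
  then show "U \<subseteq> topspace B" using openin_subset by blast
  have "continuous_map (subtopology E {e \<in> topspace E. proj e \<in> U}) (discrete_topology (carrier (F b))) c"
    using ch by (simp add: chart_def)
  then show "\<lbrakk>e \<in> topspace E; proj e \<in> U\<rbrakk> \<Longrightarrow> c e \<in> carrier (F b)"
    using continuous_map_image_subset_topspace by fastforce
qed

lemma chart_closed: "\<lbrakk>x \<in> U; m \<in> carrier (F b)\<rbrakk> \<Longrightarrow> \<phi> (x, m) \<in> carrier (F x)"
  using chart_iso[of x] by (auto simp: module_iso_def bij_betw_def)

lemma chart_proj: "\<lbrakk>x \<in> U; m \<in> carrier (F b)\<rbrakk> \<Longrightarrow> proj (\<phi> (x, m)) = x"
  using chart_closed fib_carrier chart_sub by blast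

lemma chart_section:
  assumes q: "continuous_map T B q" and k: "continuous_map T (discrete_topology (carrier (F b))) k"
    and sub: "\<And>x. x \<in> topspace T \<Longrightarrow> q x \<in> U"
  shows "continuous_map T E (\<lambda>x. \<phi> (q x, k x))"
proof -
  have "continuous_map (prod_topology (subtopology B U) (discrete_topology (carrier (F b)))) E \<phi>"
    using ch by (simp add: chart_def)
  moreover have "continuous_map T (prod_topology (subtopology B U) (discrete_topology (carrier (F b))))
      (\<lambda>x. (q x, k x))"
    using q k sub by (auto simp: continuous_map_paired continuous_map_in_subtopology)
  ultimately show ?thesis
    by (rule continuous_map_comp)
qed

lemma chart_coord:
  assumes s: "continuous_map T E s" and sub: "\<And>x. x \<in> topspace T \<Longrightarrow> proj (s x) \<in> U"
  shows "continuous_map T (discrete_topology (carrier (F b))) (\<lambda>x. c (s x))"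
proof -
  have "continuous_map (subtopology E {e \<in> topspace E. proj e \<in> U}) (discrete_topology (carrier (F b))) c"
    using ch by (simp add: chart_def)
  moreover have "continuous_map T (subtopology E {e \<in> topspace E. proj e \<in> U}) s"
    using s sub continuous_map_image_subset_topspace[OF s]
    by (auto simp: continuous_map_in_subtopology)
  ultimately show ?thesis
    by (rule continuous_map_comp)
qed

end

text \<open>All fibrewise operations preserve continuity because charts are linear and the fibres of a
  chart are discrete.\<close>

lemma section_local:
  assumes q: "continuous_map T B q"
    and loc: "\<And>b U \<phi> c V. \<lbrakk>chart R B G b U \<phi> c; V = subtopology T {x \<in> topspace T. q x \<in> U}\<rbrakk> \<Longrightarrow>
      \<exists>k. continuous_map V (discrete_topology (carrier (F b))) k \<and>
        (\<forall>x \<in> topspace V. u x = \<phi> (q x, k x))"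
  shows "continuous_map T E u"
proof (rule continuous_map_local)
  fix x assume x: "x \<in> topspace T"
  then have "q x \<in> topspace B"
    using continuous_map_image_subset_topspace[OF q] by blast
  then obtain U \<phi> c where ch: "chart R B G (q x) U \<phi> c"
    using ex_chart by blast
  let ?W = "{x \<in> topspace T. q x \<in> U}"
  obtain k where k: "continuous_map (subtopology T ?W) (discrete_topology (carrier (F (q x)))) k"
    "\<And>y. y \<in> topspace (subtopology T ?W) \<Longrightarrow> u y = \<phi> (q y, k y)"
    using loc[OF ch refl] by blast
  have "continuous_map (subtopology T ?W) E (\<lambda>y. \<phi> (q y, k y))"
    by (rule chart_section[OF ch _ k(1)]) (use q in \<open>auto intro: continuous_map_from_subtopology\<close>)
  then have "continuous_map (subtopology T ?W) E u"
    by (rule continuous_map_eq) (use k(2) in auto)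
  moreover have "openin T ?W"
    using q chart_open[OF ch] openin_continuous_map_preimage by blast
  ultimately show "\<exists>V. openin T V \<and> x \<in> V \<and> continuous_map (subtopology T V) E u"
    using x chart_mem[OF ch] by blast
qed

lemma section_add:
  assumes q: "continuous_map T B q" and s: "continuous_map T E s" "continuous_map T E t"
    and pr: "\<And>x. x \<in> topspace T \<Longrightarrow> proj (s x) = q x" "\<And>x. x \<in> topspace T \<Longrightarrow> proj (t x) = q x"
  shows "continuous_map T E (\<lambda>x. s x \<oplus>\<^bsub>F (q x)\<^esub> t x)"
proof (rule section_local[OF q])
  fix b U \<phi> c V assume ch: "chart R B G b U \<phi> c" and V: "V = subtopology T {x \<in> topspace T. q x \<in> U}"
  have b: "b \<in> topspace B" using chart_mem[OF ch] chart_sub[OF ch] by blast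
  interpret Fb: left_module R "F b" using fib_module[OF b] .
  let ?D = "discrete_topology (carrier (F b))"
  have cs: "continuous_map V ?D (\<lambda>x. c (s x))" "continuous_map V ?D (\<lambda>x. c (t x))"
    unfolding V by (rule chart_coord[OF ch]; use s pr in \<open>auto intro: continuous_map_from_subtopology\<close>)+
  \<comment> \<open>A product of two discrete spaces is discrete, so addition in the model fibre is
    continuous.\<close>
  have "continuous_map (prod_topology ?D ?D) ?D (\<lambda>(m, n). m \<oplus>\<^bsub>F b\<^esub> n)"
    by (auto simp flip: prod_topology_discrete_topology)
  then have "continuous_map V ?D (\<lambda>x. c (s x) \<oplus>\<^bsub>F b\<^esub> c (t x))"
    using continuous_map_comp[OF _ continuous_map_pairedI[OF cs]] by fastforce
  moreover have "s x \<oplus>\<^bsub>F (q x)\<^esub> t x = \<phi> (q x, c (s x) \<oplus>\<^bsub>F b\<^esub> c (t x))" if "x \<in> topspace V" for x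
  proof -
    have x: "x \<in> topspace T" "q x \<in> U" using that V by auto
    have e: "s x \<in> topspace E" "t x \<in> topspace E"
      using x s continuous_map_image_subset_topspace by blast+
    have "\<phi> (q x, c (s x) \<oplus>\<^bsub>F b\<^esub> c (t x)) = \<phi> (q x, c (s x)) \<oplus>\<^bsub>F (q x)\<^esub> \<phi> (q x, c (t x))"
      using chart_iso[OF ch x(2)] chart_c[OF ch e(1)] chart_c[OF ch e(2)] pr x by (simp add: module_iso_def)
    then show ?thesis
      using chart_\<phi>c[OF ch e(1)] chart_\<phi>c[OF ch e(2)] pr x by simp
  qed
  ultimately show "\<exists>k. continuous_map V ?D k \<and> (\<forall>x\<in>topspace V. s x \<oplus>\<^bsub>F (q x)\<^esub> t x = \<phi> (q x, k x))"
    by blast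
qed

lemma section_smult:
  assumes r: "r \<in> carrier R" and q: "continuous_map T B q" and s: "continuous_map T E s"
    and pr: "\<And>x. x \<in> topspace T \<Longrightarrow> proj (s x) = q x"
  shows "continuous_map T E (\<lambda>x. r \<odot>\<^bsub>F (q x)\<^esub> s x)"
proof (rule section_local[OF q])
  fix b U \<phi> c V assume ch: "chart R B G b U \<phi> c" and V: "V = subtopology T {x \<in> topspace T. q x \<in> U}"
  have b: "b \<in> topspace B" using chart_mem[OF ch] chart_sub[OF ch] by blast
  interpret Fb: left_module R "F b" using fib_module[OF b] .
  let ?D = "discrete_topology (carrier (F b))"
  have cs: "continuous_map V ?D (\<lambda>x. c (s x))"
    unfolding V by (rule chart_coord[OF ch]; use s pr in \<open>auto intro: continuous_map_from_subtopology\<close>)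
  have "continuous_map ?D ?D (\<lambda>m. r \<odot>\<^bsub>F b\<^esub> m)"
    using r by (auto simp: Fb.smult_closed)
  then have "continuous_map V ?D (\<lambda>x. r \<odot>\<^bsub>F b\<^esub> c (s x))"
    by (rule continuous_map_comp[OF _ cs])
  moreover have "r \<odot>\<^bsub>F (q x)\<^esub> s x = \<phi> (q x, r \<odot>\<^bsub>F b\<^esub> c (s x))" if "x \<in> topspace V" for x
  proof -
    have x: "x \<in> topspace T" "q x \<in> U" using that V by auto
    have e: "s x \<in> topspace E"
      using x s continuous_map_image_subset_topspace by blast
    have "\<phi> (q x, r \<odot>\<^bsub>F b\<^esub> c (s x)) = r \<odot>\<^bsub>F (q x)\<^esub> \<phi> (q x, c (s x))"
      using chart_iso[OF ch x(2)] chart_c[OF ch e] pr x r by (simp add: module_iso_def)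
    then show ?thesis
      using chart_\<phi>c[OF ch e] pr x by simp
  qed
  ultimately show "\<exists>k. continuous_map V ?D k \<and> (\<forall>x\<in>topspace V. r \<odot>\<^bsub>F (q x)\<^esub> s x = \<phi> (q x, k x))"
    by blast
qed

lemma section_zero:
  assumes q: "continuous_map T B q"
  shows "continuous_map T E (\<lambda>x. \<zero>\<^bsub>F (q x)\<^esub>)"
proof (rule section_local[OF q])
  fix b U \<phi> c V assume ch: "chart R B G b U \<phi> c" and V: "V = subtopology T {x \<in> topspace T. q x \<in> U}"
  have b: "b \<in> topspace B" using chart_mem[OF ch] chart_sub[OF ch] by blast
  interpret Fb: left_module R "F b" using fib_module[OF b] .
  let ?D = "discrete_topology (carrier (F b))"
  have "\<zero>\<^bsub>F (q x)\<^esub> = \<phi> (q x, \<zero>\<^bsub>F b\<^esub>)" if "x \<in> topspace V" for x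
  proof -
    have x: "q x \<in> U" "q x \<in> topspace B" using that V chart_sub[OF ch] by auto
    have "(\<lambda>m. \<phi> (q x, m)) \<in> ahom (F b) (F (q x))"
      using chart_iso[OF ch x(1)] chart_closed[OF ch x(1)] by (auto simp: module_iso_def ahom_def)
    then show ?thesis
      using ahom_zero left_module_abelian_group fib_module x b by metis
  qed
  then show "\<exists>k. continuous_map V ?D k \<and> (\<forall>x\<in>topspace V. \<zero>\<^bsub>F (q x)\<^esub> = \<phi> (q x, k x))"
    by (intro exI[of _ "\<lambda>_. \<zero>\<^bsub>F b\<^esub>"]) auto
qed

end

section \<open>Path lifting and the covering homotopy property\<close>

abbreviation unit_interval :: "real topology" where
  "unit_interval \<equiv> top_of_set {0..1}"

text \<open>Connectedness of the interval as an induction principle: a locally constant property is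
  constant. It serves twice, for the agreement of two lifts and for the existence of a lift up to a
  given time.\<close>

lemma unit_interval_induct:
  fixes P :: "real \<Rightarrow> bool"
  assumes loc: "\<And>t. t \<in> {0..1} \<Longrightarrow> \<exists>V. openin unit_interval V \<and> t \<in> V \<and> (\<forall>x\<in>V. \<forall>y\<in>V. P x \<longrightarrow> P y)"
    and "P s" "s \<in> {0..1}" "t \<in> {0..1}"
  shows "P t"
  by (rule connected_induction_simple[of "{0..1}" s t P]) (use assms in auto)

context coeff_bundle
begin

text \<open>In a chart around a point of either path both lifts have locally constant coordinates,
  so agreement and disagreement are both open conditions.\<close>

lemma lift_unique:
  assumes f: "continuous_map unit_interval E f" and g: "continuous_map unit_interval E g"
    and pr: "\<And>t. t \<in> {0..1} \<Longrightarrow> proj (f t) = proj (g t)"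
    and s: "s \<in> {0..1}" "f s = g s" and t: "t \<in> {0..1}"
  shows "f t = g t"
proof (rule unit_interval_induct[where P = "\<lambda>t. f t = g t", OF _ s(2,1) t])
  fix t :: real assume t: "t \<in> {0..1}"
  have fE: "f a \<in> topspace E" and gE: "g a \<in> topspace E" if "a \<in> {0..1}" for a
    using that continuous_map_image_subset_topspace[OF f] continuous_map_image_subset_topspace[OF g] by auto
  obtain U \<phi> c where ch: "chart R B G (proj (f t)) U \<phi> c"
    using ex_chart proj_in fE t by blast
  let ?N = "{a \<in> {0..1}. proj (f a) \<in> U}"
  have "continuous_map unit_interval B (\<lambda>a. proj (f a))"
    using continuous_map_compose[OF f proj_cont] by (simp add: o_def)
  then have N: "openin unit_interval ?N"
    using openin_continuous_map_preimage[OF _ chart_open[OF ch]] by fastforce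
  let ?D = "discrete_topology (carrier (F (proj (f t))))"
  have cf: "continuous_map (subtopology unit_interval ?N) ?D (\<lambda>a. c (f a))"
    and cg: "continuous_map (subtopology unit_interval ?N) ?D (\<lambda>a. c (g a))"
    by (rule chart_coord[OF ch]; use f g pr in \<open>auto intro: continuous_map_from_subtopology\<close>)+
  have tN: "t \<in> ?N" using t chart_mem[OF ch] by auto
  note o1 = openin_discrete_level[OF cf N tN] and o2 = openin_discrete_level[OF cg N tN]
  let ?V = "{a \<in> ?N. c (f a) = c (f t)} \<inter> {a \<in> ?N. c (g a) = c (g t)}"
  have eq: "f a = \<phi> (proj (f a), c (f t))" "g a = \<phi> (proj (f a), c (g t))" if "a \<in> ?V" for a
    using that chart_\<phi>c[OF ch, of "f a"] chart_\<phi>c[OF ch, of "g a"] fE[of a] gE[of a] pr[of a] by auto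
  have "f y = g y" if "x \<in> ?V" "y \<in> ?V" "f x = g x" for x y
  proof -
    have "c (f t) = c (g t)"
      using that(1,3) by auto
    then show ?thesis using eq[OF that(2)] by simp
  qed
  then show "\<exists>V. openin unit_interval V \<and> t \<in> V \<and> (\<forall>x\<in>V. \<forall>y\<in>V. f x = g x \<longrightarrow> f y = g y)"
    using openin_Int[OF o1 o2] tN by blast
qed

text \<open>One step of homotopy lifting: a lift over \<open>N\<close> up to time \<open>a\<close>
  is prolonged to time \<open>b'\<close> inside a single chart, after shrinking \<open>N\<close> to
  a set \<open>N'\<close> over which the homotopy stays in that chart. All domains are taken as
  subspaces of the one space \<open>W\<close>, which makes restricting and gluing easy.\<close>

lemma lift_extend:
  fixes T :: "'t topology" and K :: "'t \<times> real \<Rightarrow> 'a"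
  defines "W \<equiv> prod_topology T euclideanreal"
  assumes K: "continuous_map (subtopology W (topspace T \<times> {0..1})) B K"
    and ch: "chart R B G b U \<phi> c"
    and N: "openin T N" "N' \<subseteq> N" "openin T N'" and ab: "0 \<le> a" "a \<le> b'" "b' \<le> 1"
    and KU: "\<And>s t. \<lbrakk>s \<in> N'; t \<in> {a..b'}\<rbrakk> \<Longrightarrow> K (s, t) \<in> U"
    and f: "continuous_map (subtopology W (N \<times> {0..a})) E f"
    and pr: "\<And>s t. \<lbrakk>s \<in> N; t \<in> {0..a}\<rbrakk> \<Longrightarrow> proj (f (s, t)) = K (s, t)"
  shows "\<exists>f'. continuous_map (subtopology W (N' \<times> {0..b'})) E f' \<and>
    (\<forall>s\<in>N'. f' (s, 0) = f (s, 0)) \<and> (\<forall>s\<in>N'. \<forall>t\<in>{0..b'}. proj (f' (s, t)) = K (s, t))"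
proof -
  have NT: "N \<subseteq> topspace T" "N' \<subseteq> topspace T"
    using N openin_subset by blast+
  have ts: "topspace W = topspace T \<times> UNIV"
    by (simp add: W_def)
  have fE: "f (s, t) \<in> topspace E" if "s \<in> N" "t \<in> {0..a}" for s t
  proof -
    have "(s, t) \<in> topspace (subtopology W (N \<times> {0..a}))"
      using that NT by (auto simp: ts)
    then show ?thesis
      using continuous_map_image_subset_topspace[OF f] by blast
  qed
  \<comment> \<open>From time \<open>a\<close> on, the fibre coordinate is frozen at its value at
    time \<open>a\<close>.\<close>
  define g where "g = (\<lambda>x. \<phi> (K x, c (f (fst x, a))))"
  define f' where "f' = (\<lambda>x. if snd x \<le> a then f x else g x)"
  have prg: "proj (g (s, t)) = K (s, t)" if "s \<in> N'" "t \<in> {a..b'}" for s t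
  proof -
    have "s \<in> N" "a \<in> {0..a}" "a \<in> {a..b'}" using that N ab by auto
    then have "c (f (s, a)) \<in> carrier (F b)"
      using that pr[of s a] fE[of s a] KU[of s a] by (intro chart_c[OF ch]) simp_all
    then show ?thesis
      unfolding g_def using chart_proj[OF ch KU[OF that]] by simp
  qed
  have cont: "continuous_map (subtopology W (N' \<times> {0..b'})) E f'"
    unfolding f'_def
  proof (rule continuous_map_cases_le)
    show "continuous_map (subtopology W (N' \<times> {0..b'})) euclideanreal snd"
      unfolding W_def by (intro continuous_map_from_subtopology continuous_map_snd)
    show "continuous_map (subtopology W (N' \<times> {0..b'})) euclideanreal (\<lambda>x. a)"
      by simp
    have "continuous_map (subtopology W ((N' \<times> {0..b'}) \<inter> {x \<in> topspace (subtopology W (N' \<times> {0..b'})). snd x \<le> a})) E f"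
      by (rule continuous_map_from_subtopology_mono[OF f]) (use N in auto)
    then show "continuous_map (subtopology (subtopology W (N' \<times> {0..b'}))
        {x \<in> topspace (subtopology W (N' \<times> {0..b'})). snd x \<le> a}) E f"
      by (simp add: subtopology_subtopology)
    let ?A = "(N' \<times> {0..b'}) \<inter> {x \<in> topspace (subtopology W (N' \<times> {0..b'})). a \<le> snd x}"
    have A: "s \<in> N'" "t \<in> {a..b'}" if "(s, t) \<in> ?A" for s t
      using that by auto
    have 1: "continuous_map (subtopology W ?A) B K"
      by (rule continuous_map_from_subtopology_mono[OF K]) (use NT ab in auto)
    have "continuous_map (subtopology W ?A) (subtopology W (N \<times> {0..a})) (\<lambda>x. (fst x, a))"
      unfolding continuous_map_in_subtopology
    proof
      show "continuous_map (subtopology W ?A) W (\<lambda>x. (fst x, a))"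
        unfolding W_def
        by (intro continuous_map_pairedI continuous_map_from_subtopology continuous_map_fst) simp
      show "(\<lambda>x. (fst x, a)) \<in> topspace (subtopology W ?A) \<rightarrow> N \<times> {0..a}"
        using N ab by (auto simp: ts)
    qed
    from continuous_map_compose[OF this f]
    have "continuous_map (subtopology W ?A) E (\<lambda>x. f (fst x, a))"
      by (simp add: o_def)
    then have 2: "continuous_map (subtopology W ?A) (discrete_topology (carrier (F b))) (\<lambda>x. c (f (fst x, a)))"
    proof (rule chart_coord[OF ch])
      fix x assume "x \<in> topspace (subtopology W ?A)"
      then have "fst x \<in> N'" by (auto simp: ts)
      then show "proj (f (fst x, a)) \<in> U"
        using pr[of "fst x" a] KU[of "fst x" a] N ab by auto
    qed
    have "continuous_map (subtopology W ?A) E g"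
      unfolding g_def
      by (rule chart_section[OF ch 1 2]) (use KU in \<open>auto simp: ts\<close>)
    then show "continuous_map (subtopology (subtopology W (N' \<times> {0..b'}))
        {x \<in> topspace (subtopology W (N' \<times> {0..b'})). a \<le> snd x}) E g"
      by (simp add: subtopology_subtopology)
    fix x assume x: "x \<in> topspace (subtopology W (N' \<times> {0..b'}))" "snd x = a"
    then obtain s where s: "x = (s, a)" "s \<in> N'" by (cases x) (auto simp: ts)
    then show "f x = g x"
      using chart_\<phi>c[OF ch fE[of s a]] pr[of s a] KU[of s a] N ab by (auto simp: g_def)
  qed
  moreover have "proj (f' (s, t)) = K (s, t)" if "s \<in> N'" "t \<in> {0..b'}" for s t
    using that pr[of s t] prg[of s t] N by (auto simp: f'_def)
  ultimately show ?thesis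
    by (intro exI[of _ f']) (use ab in \<open>auto simp: f'_def\<close>)
qed

text \<open>Around a fixed parameter, the times up to which a lift exists on some neighbourhood are
  propagated by connectedness of the interval, the neighbourhood shrinking at each step. The
  resulting local lifts agree where they overlap because path lifting is unique over each parameter.
  Later \<open>T\<close> is the total space of a coefficient system.\<close>

lemma lift_homotopy:
  fixes T :: "'t topology" and K :: "'t \<times> real \<Rightarrow> 'a"
  assumes K: "continuous_map (prod_topology T unit_interval) B K"
    and h: "continuous_map T E h" and hK: "\<And>s. s \<in> topspace T \<Longrightarrow> proj (h s) = K (s, 0)"
  obtains f where "continuous_map (prod_topology T unit_interval) E f"
    "\<And>s. s \<in> topspace T \<Longrightarrow> f (s, 0) = h s"
    "\<And>s t. \<lbrakk>s \<in> topspace T; t \<in> {0..1}\<rbrakk> \<Longrightarrow> proj (f (s, t)) = K (s, t)"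
proof -
  define W where "W = prod_topology T euclideanreal"
  have PW: "prod_topology (subtopology T N) (top_of_set A) = subtopology W (N \<times> A)" for N and A :: "real set"
    by (simp add: W_def subtopology_Times)
  have PT: "prod_topology T unit_interval = subtopology W (topspace T \<times> {0..1})"
    using PW[of "topspace T"] by simp
  have KW: "continuous_map (subtopology W (topspace T \<times> {0..1})) B K"
    using K PT by simp
  define good where "good s0 t \<longleftrightarrow> (\<exists>N f. openin T N \<and> s0 \<in> N \<and> continuous_map (subtopology W (N \<times> {0..t})) E f \<and>
    (\<forall>s\<in>N. f (s, 0) = h s) \<and> (\<forall>s\<in>N. \<forall>t'\<in>{0..t}. proj (f (s, t')) = K (s, t')))" for s0 and t :: real
  have ts: "topspace W = topspace T \<times> UNIV"
    by (simp add: W_def)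
  have good1: "good s0 1" if s0: "s0 \<in> topspace T" for s0
  proof (rule unit_interval_induct[where P = "good s0" and s = 0])
    have "continuous_map (subtopology W (topspace T \<times> {0..0})) E (h \<circ> fst)"
      unfolding W_def by (intro continuous_map_from_subtopology continuous_map_compose[OF continuous_map_fst h])
    then show "good s0 0"
      unfolding good_def using s0 hK
      by (intro exI[of _ "topspace T"] exI[of _ "h \<circ> fst"]) auto
  next
    fix t :: real assume t: "t \<in> {0..1}"
    have "K (s0, t) \<in> topspace B"
      using continuous_map_image_subset_topspace[OF K] t s0 by fastforce
    then obtain U \<phi> c where ch: "chart R B G (K (s0, t)) U \<phi> c"
      using ex_chart by blast
    have "openin (prod_topology T unit_interval) {x \<in> topspace (prod_topology T unit_interval). K x \<in> U}"
      using openin_continuous_map_preimage[OF K chart_open[OF ch]] .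
    moreover have "(s0, t) \<in> {x \<in> topspace (prod_topology T unit_interval). K x \<in> U}"
      using s0 t chart_mem[OF ch] by simp
    ultimately have "\<exists>N J. openin T N \<and> openin unit_interval J \<and> s0 \<in> N \<and> t \<in> J \<and>
        N \<times> J \<subseteq> {x \<in> topspace (prod_topology T unit_interval). K x \<in> U}"
      by (rule openin_prod_topology_alt[THEN iffD1, rule_format])
    then obtain N1 J1 where NJ: "openin T N1" "openin unit_interval J1" "s0 \<in> N1" "t \<in> J1"
      "N1 \<times> J1 \<subseteq> {x \<in> topspace (prod_topology T unit_interval). K x \<in> U}"
      by blast
    \<comment> \<open>\<open>J1\<close> is cut down to an interval, so that it contains all times
      between any two of its points.\<close>
    obtain e where e: "e > 0" "ball t e \<inter> {0..1} \<subseteq> J1"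
      using NJ(2,4) unfolding openin_contains_ball by blast
    let ?V = "ball t e \<inter> {0..1}"
    have "good s0 y" if x: "x \<in> ?V" and y: "y \<in> ?V" and gx: "good s0 x" for x y
    proof -
      obtain N f where Nf: "openin T N" "s0 \<in> N" "continuous_map (subtopology W (N \<times> {0..x})) E f"
        "\<forall>s\<in>N. f (s, 0) = h s" "\<forall>s\<in>N. \<forall>t'\<in>{0..x}. proj (f (s, t')) = K (s, t')"
        using gx unfolding good_def by blast
      show ?thesis
      proof (cases "y \<le> x")
        case True
        have "continuous_map (subtopology W (N \<times> {0..y})) E f"
          by (rule continuous_map_from_subtopology_mono[OF Nf(3)]) (use True in auto)
        then show ?thesis
          unfolding good_def using Nf True by (intro exI[of _ N] exI[of _ f]) auto
      next
        case False
        have "{x..y} \<subseteq> ?V"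
          using x y by (auto simp: dist_real_def)
        then have KU: "K (s, t') \<in> U" if "s \<in> N \<inter> N1" "t' \<in> {x..y}" for s t'
          using that NJ(5) e(2) by blast
        obtain f' where "continuous_map (subtopology W ((N \<inter> N1) \<times> {0..y})) E f'"
          "\<forall>s\<in>N \<inter> N1. f' (s, 0) = f (s, 0)" "\<forall>s\<in>N \<inter> N1. \<forall>t\<in>{0..y}. proj (f' (s, t)) = K (s, t)"
          using lift_extend[OF KW[unfolded W_def] ch Nf(1) _ openin_Int[OF Nf(1) NJ(1)] _ _ _ KU Nf(3)[unfolded W_def], of y]
            Nf(5) x y False unfolding W_def[symmetric] by auto
        then show ?thesis
          unfolding good_def using Nf NJ by (intro exI[of _ "N \<inter> N1"] exI[of _ f']) auto
      qed
    qed
    moreover have "openin unit_interval ?V"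
      by (metis Int_commute open_ball openin_open_Int)
    moreover have "t \<in> ?V" using t e by simp
    ultimately show "\<exists>V. openin unit_interval V \<and> t \<in> V \<and> (\<forall>x\<in>V. \<forall>y\<in>V. good s0 x \<longrightarrow> good s0 y)"
      by (intro exI[of _ ?V]) blast
  qed auto
  then obtain N f where N: "\<And>s. s \<in> topspace T \<Longrightarrow> openin T (N s) \<and> s \<in> N s \<and>
      continuous_map (subtopology W (N s \<times> {0..1})) E (f s) \<and> (\<forall>s'\<in>N s. f s (s', 0) = h s') \<and>
      (\<forall>s'\<in>N s. \<forall>t'\<in>{0..1}. proj (f s (s', t')) = K (s', t'))"
    unfolding good_def by metis
  have NT: "N s \<subseteq> topspace T" if "s \<in> topspace T" for s
    using N[OF that] openin_subset by blast
  have path: "continuous_map unit_interval E (\<lambda>t. f s (s', t))" if "s \<in> topspace T" "s' \<in> N s" for s s'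
  proof -
    have "continuous_map unit_interval (subtopology W (N s \<times> {0..1})) (\<lambda>t. (s', t))"
      unfolding PW[symmetric] using that NT[OF that(1)]
      by (intro continuous_map_pairedI) auto
    then show ?thesis
      using continuous_map_comp N[OF that(1)] by blast
  qed
  \<comment> \<open>Over the single parameter \<open>s'\<close> both sides are lifts of the path
    \<open>t \<mapsto> K (s', t)\<close> that start at \<open>h s'\<close>.\<close>
  have agree: "f s (s', t) = f s' (s', t)" if "s \<in> topspace T" "s' \<in> N s" "t \<in> {0..1}" for s s' t
  proof -
    have s': "s' \<in> topspace T" "s' \<in> N s'"
      using NT N that by blast+
    show ?thesis
    proof (rule lift_unique[OF path[OF that(1,2)] path[OF s'], of 0])
      show "proj (f s (s', t)) = proj (f s' (s', t))" if "t \<in> {0..1}" for t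
        using N \<open>s \<in> topspace T\<close> \<open>s' \<in> N s\<close> s' that by metis
      show "f s (s', 0) = f s' (s', 0)"
        using N that s' by metis
    qed (use that in auto)
  qed
  \<comment> \<open>Each point uses the lift that belongs to its own parameter. By
    \<open>agree\<close> this is one and the same local lift near a given point, which gives
    continuity.\<close>
  show thesis
  proof (rule that[of "\<lambda>x. f (fst x) x"])
    show "continuous_map (prod_topology T unit_interval) E (\<lambda>x. f (fst x) x)"
    proof (rule continuous_map_local)
      fix x assume x: "x \<in> topspace (prod_topology T unit_interval)"
      then have s: "fst x \<in> topspace T" by auto
      let ?V = "N (fst x) \<times> {0..1::real}"
      have "subtopology (prod_topology T unit_interval) ?V = subtopology W ?V"
        unfolding PT subtopology_subtopology using NT[OF s]
        by (metis Int_commute Sigma_mono inf.absorb_iff2 order_refl)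
      then have "continuous_map (subtopology (prod_topology T unit_interval) ?V) E (f (fst x))"
        using N[OF s] by simp
      then have "continuous_map (subtopology (prod_topology T unit_interval) ?V) E (\<lambda>x. f (fst x) x)"
      proof (rule continuous_map_eq)
        fix y assume "y \<in> topspace (subtopology (prod_topology T unit_interval) ?V)"
        then have "fst y \<in> N (fst x)" "snd y \<in> {0..1}" by auto
        then show "f (fst x) y = f (fst y) y"
          using agree[OF s, of "fst y" "snd y"] by simp
      qed
      moreover have "openin (prod_topology T unit_interval) ?V"
        using N[OF s] by (simp add: openin_prod_Times_iff)
      ultimately show "\<exists>V. openin (prod_topology T unit_interval) V \<and> x \<in> V \<and>
          continuous_map (subtopology (prod_topology T unit_interval) V) E (\<lambda>x. f (fst x) x)"
        using x N[OF s] by (intro exI[of _ ?V]) (auto simp: mem_Times_iff)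
    qed
  qed (use N in auto)
qed

end

text \<open>The paths \<open>f (u + v, t)\<close> and \<open>f (u, t) + f (v, t)\<close> lift the
  same path and meet at time \<open>s\<close>, so they coincide by uniqueness; likewise for scalar
  multiples. Linearity at one time thus spreads to all times.\<close>

lemma lifted_homotopy_linear:
  assumes G': "local_system R B' G'" and G: "local_system R B G"
    and f: "continuous_map (prod_topology (cs_total G') unit_interval) (cs_total G) f"
    and K: "continuous_map unit_interval B (\<lambda>t. K (y, t))"
    and pr: "\<And>u t. \<lbrakk>u \<in> carrier (cs_fiber G' y); t \<in> {0..1}\<rbrakk> \<Longrightarrow> cs_proj G (f (u, t)) = K (y, t)"
    and y: "y \<in> topspace B'" and s: "s \<in> {0..1}" and t: "t \<in> {0..1}"
    and lin: "(\<lambda>u. f (u, s)) \<in> mhom R (cs_fiber G' y) (cs_fiber G (K (y, s)))"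
  shows "(\<lambda>u. f (u, t)) \<in> mhom R (cs_fiber G' y) (cs_fiber G (K (y, t)))"
proof -
  interpret G': coeff_bundle R B' G' using G' by unfold_locales
  interpret G: coeff_bundle R B G using G by unfold_locales
  interpret Fy: left_module R "G'.F y" using G'.fib_module[OF y] .
  have KB: "K (y, t) \<in> topspace B" if "t \<in> {0..1}" for t
    using continuous_map_image_subset_topspace[OF K] that by auto
  have tot: "u \<in> topspace G'.E" if "u \<in> carrier (G'.F y)" for u
    using that G'.fib_carrier[OF y] by auto
  have path: "continuous_map unit_interval G.E (\<lambda>t. f (u, t))" if "u \<in> carrier (G'.F y)" for u
  proof -
    have "continuous_map unit_interval (prod_topology G'.E unit_interval) (\<lambda>t. (u, t))"
      using tot[OF that] by (intro continuous_map_pairedI) auto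
    then show ?thesis
      by (rule continuous_map_comp[OF f])
  qed
  have mem: "f (u, t) \<in> carrier (G.F (K (y, t)))" if "u \<in> carrier (G'.F y)" "t \<in> {0..1}" for u t
  proof -
    have "f (u, t) \<in> topspace G.E"
      using continuous_map_image_subset_topspace[OF path[OF that(1)]] that(2) by auto
    then show ?thesis
      using G.in_fib[of "f (u, t)"] pr[OF that] by simp
  qed
  have fadd: "f (u \<oplus>\<^bsub>G'.F y\<^esub> v, t) = f (u, t) \<oplus>\<^bsub>G.F (K (y, t))\<^esub> f (v, t)"
    if u: "u \<in> carrier (G'.F y)" and v: "v \<in> carrier (G'.F y)" for u v
  proof (rule G.lift_unique[OF path G.section_add[OF K path[OF u] path[OF v]] _ s _ t])
    fix t :: real assume t: "t \<in> {0..1}"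
    interpret Ft: left_module R "G.F (K (y, t))" using G.fib_module[OF KB[OF t]] .
    have "f (u, t) \<oplus>\<^bsub>G.F (K (y, t))\<^esub> f (v, t) \<in> carrier (G.F (K (y, t)))"
      using mem u v t by blast
    then show "cs_proj G (f (u \<oplus>\<^bsub>G'.F y\<^esub> v, t)) = cs_proj G (f (u, t) \<oplus>\<^bsub>G.F (K (y, t))\<^esub> f (v, t))"
      using pr u v t G.fib_carrier[OF KB[OF t]] by simp
  qed (use u v pr ahom_add[OF mhom_ahom[OF lin]] in auto)
  have fsm: "f (r \<odot>\<^bsub>G'.F y\<^esub> u, t) = r \<odot>\<^bsub>G.F (K (y, t))\<^esub> f (u, t)"
    if u: "u \<in> carrier (G'.F y)" and r: "r \<in> carrier R" for u r
  proof (rule G.lift_unique[OF path G.section_smult[OF r K path[OF u]] _ s _ t])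
    fix t :: real assume t: "t \<in> {0..1}"
    interpret Ft: left_module R "G.F (K (y, t))" using G.fib_module[OF KB[OF t]] .
    have "r \<odot>\<^bsub>G.F (K (y, t))\<^esub> f (u, t) \<in> carrier (G.F (K (y, t)))"
      using mem u r t Ft.smult_closed by blast
    then show "cs_proj G (f (r \<odot>\<^bsub>G'.F y\<^esub> u, t)) = cs_proj G (r \<odot>\<^bsub>G.F (K (y, t))\<^esub> f (u, t))"
      using pr u r t Fy.smult_closed G.fib_carrier[OF KB[OF t]] by simp
  qed (use u r pr Fy.smult_closed mhom_smult[OF lin] in auto)
  show ?thesis
    using mem[OF _ t] fadd fsm by (auto simp: mhom_def ahom_def)
qed

section \<open>The pullback of a local system\<close>

lemma pullback_simps [simp]:
  "cs_total (pullback_system B' g G) = subtopology (prod_topology B' (cs_total G)) {(y, e). g y = cs_proj G e}"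
  "cs_proj (pullback_system B' g G) = fst"
  "carrier (cs_fiber (pullback_system B' g G) y) = {y} \<times> carrier (cs_fiber G (g y))"
  "\<zero>\<^bsub>cs_fiber (pullback_system B' g G) y\<^esub> = (y, \<zero>\<^bsub>cs_fiber G (g y)\<^esub>)"
  "u \<oplus>\<^bsub>cs_fiber (pullback_system B' g G) y\<^esub> v = (y, snd u \<oplus>\<^bsub>cs_fiber G (g y)\<^esub> snd v)"
  "r \<odot>\<^bsub>cs_fiber (pullback_system B' g G) y\<^esub> u = (y, r \<odot>\<^bsub>cs_fiber G (g y)\<^esub> snd u)"
  by (simp_all add: pullback_system_def Let_def)

lemma local_system_pullback:
  assumes G: "local_system R B G" and g: "continuous_map B' B g"
  shows "local_system R B' (pullback_system B' g G)"
proof -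
  interpret coeff_bundle R B G using G by unfold_locales
  let ?G' = "pullback_system B' g G"
  let ?E' = "cs_total ?G'"
  have gB: "g y \<in> topspace B" if "y \<in> topspace B'" for y
    using continuous_map_image_subset_topspace[OF g] that by auto
  have mod: "left_module R (cs_fiber ?G' y)" if y: "y \<in> topspace B'" for y
  proof -
    interpret Fy: left_module R "F (g y)" using fib_module[OF gB[OF y]] .
    show ?thesis
      by (rule left_moduleI[OF ring])
        (auto simp: Fy.smult_closed Fy.smult_l_distr Fy.smult_r_distr Fy.smult_assoc Fy.smult_one
          Fy.zero_smult Fy.M.a_ac)
  qed
  have triv: "\<exists>U \<phi>. openin B' U \<and> y \<in> U \<and>
        homeomorphic_map
          (prod_topology (subtopology B' U) (discrete_topology (carrier (cs_fiber ?G' y))))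
          (subtopology ?E' {e \<in> topspace ?E'. cs_proj ?G' e \<in> U}) \<phi> \<and>
        (\<forall>x \<in> U. (\<lambda>m. \<phi> (x, m)) \<in> module_iso R (cs_fiber ?G' y) (cs_fiber ?G' x))"
    if y: "y \<in> topspace B'" for y
  proof -
    obtain U \<phi> c where ch: "chart R B G (g y) U \<phi> c"
      using ex_chart gB[OF y] by blast
    let ?U = "{x \<in> topspace B'. g x \<in> U}"
    \<comment> \<open>The chart of \<open>G\<close> at \<open>g y\<close>, pulled back. Elements of
      the model fibre carry the tag \<open>y\<close>, which \<open>?\<phi>\<close> replaces by the
      base point and \<open>?\<psi>\<close> restores.\<close>
    let ?\<phi> = "\<lambda>z. (fst z, \<phi> (g (fst z), snd (snd z)))"
    let ?\<psi> = "\<lambda>e. (fst e, (y, c (snd e)))"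
    let ?D = "discrete_topology (carrier (cs_fiber ?G' y))"
    let ?S = "prod_topology (subtopology B' ?U) ?D"
    let ?E'U = "subtopology ?E' {e \<in> topspace ?E'. cs_proj ?G' e \<in> ?U}"
    have o: "openin B' ?U"
      using openin_continuous_map_preimage[OF g chart_open[OF ch]] .
    have tS: "topspace ?S = ?U \<times> ({y} \<times> carrier (F (g y)))"
      by auto
    have tE: "topspace ?E'U = {(x, e). x \<in> ?U \<and> e \<in> topspace E \<and> g x = proj e}"
      by auto
    have c1: "continuous_map ?S B' fst"
      using continuous_map_fst[of "subtopology B' ?U" ?D] continuous_map_into_fulltopology by blast
    have c2: "continuous_map ?S (discrete_topology (carrier (F (g y)))) (\<lambda>z. snd (snd z))"
    proof -
      have "continuous_map ?D (discrete_topology (carrier (F (g y)))) snd"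
        by auto
      then show ?thesis
        by (rule continuous_map_comp[OF _ continuous_map_snd])
    qed
    have c3: "continuous_map ?S E (\<lambda>z. \<phi> (g (fst z), snd (snd z)))"
    proof (rule chart_section[OF ch _ c2])
      show "continuous_map ?S B (\<lambda>z. g (fst z))"
        using continuous_map_compose[OF c1 g] by (simp add: o_def)
    qed (use tS in auto)
    have pr: "proj (\<phi> (g x, m)) = g x" if "x \<in> ?U" "m \<in> carrier (F (g y))" for x m
      using chart_proj[OF ch] that by auto
    have cont\<phi>: "continuous_map ?S ?E'U ?\<phi>"
    proof -
      have "continuous_map ?S (prod_topology B' E) ?\<phi>"
        using c1 c3 by (rule continuous_map_pairedI)
      moreover have "?\<phi> z \<in> topspace ?E'U" if "z \<in> topspace ?S" for z
      proof -
        have "\<phi> (g (fst z), snd (snd z)) \<in> topspace E"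
          using continuous_map_image_subset_topspace[OF c3] that by blast
        then show ?thesis
          using pr[of "fst z" "snd (snd z)"] that tE tS by auto
      qed
      ultimately show ?thesis
        by (auto simp: continuous_map_in_subtopology)
    qed
    have d1: "continuous_map ?E'U B' fst" and d2: "continuous_map ?E'U E snd"
      by (auto intro!: continuous_map_from_subtopology continuous_map_fst continuous_map_snd)
    have d3: "continuous_map ?E'U (discrete_topology (carrier (F (g y)))) (\<lambda>e. c (snd e))"
    proof (rule chart_coord[OF ch d2])
      show "proj (snd x) \<in> U" if "x \<in> topspace ?E'U" for x
        using that tE by auto
    qed
    have cont\<psi>: "continuous_map ?E'U ?S ?\<psi>"
    proof (rule continuous_map_pairedI)
      show "continuous_map ?E'U (subtopology B' ?U) fst"
        unfolding continuous_map_in_subtopology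
      proof
        show "fst \<in> topspace ?E'U \<rightarrow> ?U"
          unfolding tE by auto
      qed (rule d1)
      have "continuous_map (discrete_topology (carrier (F (g y)))) ?D (\<lambda>m. (y, m))"
        by auto
      from continuous_map_compose[OF d3 this]
      show "continuous_map ?E'U ?D (\<lambda>e. (y, c (snd e)))"
        by (simp add: o_def)
    qed
    have "homeomorphic_maps ?S ?E'U ?\<phi> ?\<psi>"
      unfolding homeomorphic_maps_def
    proof (intro conjI ballI cont\<phi> cont\<psi>)
      show "?\<psi> (?\<phi> z) = z" if "z \<in> topspace ?S" for z
        using that chart_c\<phi>[OF ch] unfolding tS by auto
      show "?\<phi> (?\<psi> e) = e" if "e \<in> topspace ?E'U" for e
        using that chart_\<phi>c[OF ch] unfolding tE by auto
    qed
    then have "homeomorphic_map ?S ?E'U ?\<phi>"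
      using homeomorphic_map_maps by blast
    moreover have "(\<lambda>m. ?\<phi> (x, m)) \<in> module_iso R (cs_fiber ?G' y) (cs_fiber ?G' x)" if "x \<in> ?U" for x
    proof -
      have "(\<lambda>m. \<phi> (g x, m)) \<in> module_iso R (F (g y)) (F (g x))"
        using chart_iso[OF ch] that by auto
      then have bij: "bij_betw (\<lambda>m. \<phi> (g x, m)) (carrier (F (g y))) (carrier (F (g x)))"
        and lin: "\<And>m n. \<lbrakk>m \<in> carrier (F (g y)); n \<in> carrier (F (g y))\<rbrakk> \<Longrightarrow>
          \<phi> (g x, m \<oplus>\<^bsub>F (g y)\<^esub> n) = \<phi> (g x, m) \<oplus>\<^bsub>F (g x)\<^esub> \<phi> (g x, n)"
        "\<And>r m. \<lbrakk>r \<in> carrier R; m \<in> carrier (F (g y))\<rbrakk> \<Longrightarrow>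
          \<phi> (g x, r \<odot>\<^bsub>F (g y)\<^esub> m) = r \<odot>\<^bsub>F (g x)\<^esub> \<phi> (g x, m)"
        by (simp_all add: module_iso_def)
      have "bij_betw (\<lambda>m. ?\<phi> (x, m)) ({y} \<times> carrier (F (g y))) ({x} \<times> carrier (F (g x)))"
      proof (rule bij_betwI')
        show "?\<phi> (x, m) = ?\<phi> (x, n) \<longleftrightarrow> m = n"
          if "m \<in> {y} \<times> carrier (F (g y))" "n \<in> {y} \<times> carrier (F (g y))" for m n
          using that bij_betw_imp_inj_on[OF bij] by (auto simp: inj_on_def)
        show "?\<phi> (x, m) \<in> {x} \<times> carrier (F (g x))" if "m \<in> {y} \<times> carrier (F (g y))" for m
          using that bij_betw_imp_surj_on[OF bij] by auto
        show "\<exists>m\<in>{y} \<times> carrier (F (g y)). n = ?\<phi> (x, m)" if n: "n \<in> {x} \<times> carrier (F (g x))" for n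
        proof -
          obtain m where "m \<in> carrier (F (g y))" "snd n = \<phi> (g x, m)"
            using n bij_betw_imp_surj_on[OF bij] by (metis SigmaE imageE snd_conv)
          then show ?thesis
            using n by (intro bexI[of _ "(y, m)"]) auto
        qed
      qed
      then show ?thesis
        using lin by (auto simp: module_iso_def)
    qed
    ultimately show ?thesis
      using o y chart_mem[OF ch] by (intro exI[of _ ?U] exI[of _ ?\<phi>]) auto
  qed
  show ?thesis
    unfolding local_system_def
  proof (intro conjI ballI)
    show "continuous_map ?E' B' (cs_proj ?G')"
      by (auto intro!: continuous_map_from_subtopology continuous_map_fst)
    show "carrier (cs_fiber ?G' y) = {e \<in> topspace ?E'. cs_proj ?G' e = y}" if "y \<in> topspace B'" for y
      unfolding pullback_simps fib_carrier[OF gB[OF that]] using that by auto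
  qed (use ring mod triv in auto)
qed

section \<open>The prism over an ordered simplex\<close>

lemma (in abelian_group) neg_zero [simp]: "\<ominus> \<zero> = \<zero>"
  using l_neg[of \<zero>] by simp

text \<open>The prism operator and the boundary on ordered simplices (lists of vertices) in dual form:
  the arguments are functions on lists with values in an abelian group, and \<open>list_boundary M \<phi> l\<close>
  is the value of \<open>\<phi>\<close> on the boundary of \<open>l\<close>, likewise \<open>prism M t \<phi> l\<close> for the prism between \<open>l\<close> and
  its image under the vertex map \<open>t\<close>. Both are defined by the recursion that cones off the first
  vertex; the complex is augmented, with the empty list in degree \<open>-1\<close>.\<close>

fun list_boundary :: "('r, 'm, 'x) module_scheme \<Rightarrow> ('v list \<Rightarrow> 'm) \<Rightarrow> 'v list \<Rightarrow> 'm" where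
  "list_boundary M \<phi> [] = \<zero>\<^bsub>M\<^esub>"
| "list_boundary M \<phi> (v # l) = \<phi> l \<ominus>\<^bsub>M\<^esub> list_boundary M (\<lambda>k. \<phi> (v # k)) l"

fun prism :: "('r, 'm, 'x) module_scheme \<Rightarrow> ('v \<Rightarrow> 'v) \<Rightarrow> ('v list \<Rightarrow> 'm) \<Rightarrow> 'v list \<Rightarrow> 'm" where
  "prism M t \<phi> [] = \<zero>\<^bsub>M\<^esub>"
| "prism M t \<phi> (v # l) = \<phi> (v # t v # map t l) \<ominus>\<^bsub>M\<^esub> prism M t (\<lambda>k. \<phi> (v # k)) l"

definition on_lists :: "'v set \<Rightarrow> nat \<Rightarrow> 'v list set" where
  "on_lists W n = {l. set l \<subseteq> W \<and> length l = n}"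

lemma on_lists_simps [simp]:
  "[] \<in> on_lists W n \<longleftrightarrow> n = 0"
  "v # l \<in> on_lists W n \<longleftrightarrow> v \<in> W \<and> (\<exists>m. n = Suc m \<and> l \<in> on_lists W m)"
  by (auto simp: on_lists_def)

lemma map_on_lists: "\<lbrakk>l \<in> on_lists W n; \<And>v. v \<in> W \<Longrightarrow> t v \<in> W'\<rbrakk> \<Longrightarrow> map t l \<in> on_lists W' n"
  by (auto simp: on_lists_def)

lemma prism_cong:
  assumes "l \<in> on_lists W n" "\<And>v. v \<in> W \<Longrightarrow> t v \<in> W"
    "\<And>k. k \<in> on_lists W (Suc n) \<Longrightarrow> \<phi> k = \<psi> k"
  shows "prism M t \<phi> l = prism M t \<psi> l"
  using assms(1,3)
proof (induction l arbitrary: \<phi> \<psi> n)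
  case (Cons v l)
  then obtain m where m: "n = Suc m" "v \<in> W" "l \<in> on_lists W m" by auto
  have "prism M t (\<lambda>k. \<phi> (v # k)) l = prism M t (\<lambda>k. \<psi> (v # k)) l"
    using m Cons.prems by (intro Cons.IH[of m]) auto
  moreover have "v # t v # map t l \<in> on_lists W (Suc n)"
    using m assms(2) by (auto intro: map_on_lists)
  ultimately show ?case using Cons.prems(2) by simp
qed simp

lemma list_boundary_map: "list_boundary M \<phi> (map s l) = list_boundary M (\<lambda>k. \<phi> (map s k)) l"
  by (induction l arbitrary: \<phi>) auto

text \<open>Intended for a renumbering \<open>s\<close> of the base vertices, which commutes with
  raising a vertex to the top.\<close>

lemma prism_map:
  assumes "\<And>v. v \<in> set l \<Longrightarrow> t (s v) = s (t v)"
  shows "prism M t \<phi> (map s l) = prism M t (\<lambda>k. \<phi> (map s k)) l"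
  using assms
proof (induction l arbitrary: \<phi>)
  case (Cons v l)
  then have "map t (map s l) = map s (map t l)" by simp
  then show ?case using Cons by (simp del: map_map)
qed simp

lemma list_boundary_mem:
  assumes "left_module R M" "submod R M V"
    and "l \<in> on_lists W (Suc n)" "\<And>k. k \<in> on_lists W n \<Longrightarrow> \<phi> k \<in> V"
  shows "list_boundary M \<phi> l \<in> V"
  using assms(3,4)
proof (induction l arbitrary: \<phi> n)
  case (Cons v l)
  interpret left_module R M by fact
  have "list_boundary M (\<lambda>k. \<phi> (v # k)) l \<in> V"
  proof (cases n)
    case (Suc m)
    then show ?thesis using Cons.prems by (intro Cons.IH[of m]) auto
  qed (use Cons.prems submodD(2)[OF assms(2)] in \<open>auto simp: on_lists_def\<close>)
  then show ?case
    using Cons.prems submodD(3)[OF assms(2)] submod_neg[OF assms(1,2)] by (simp add: M.minus_eq)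
qed (simp add: submodD[OF assms(2)])

text \<open>A cell \<open>k\<close> of the prism over \<open>l\<close> has at most one vertex more than \<open>l\<close> above any set of
  vertices; this is what makes the prism operator respect allowability.\<close>

definition prism_cell :: "('i \<times> 's) set \<Rightarrow> ('i \<times> 's) list \<Rightarrow> ('i \<times> 's) list \<Rightarrow> bool" where
  "prism_cell W l k \<longleftrightarrow> k \<in> on_lists W (Suc (length l)) \<and>
     (\<forall>S. length (filter (\<lambda>v. fst v \<in> S) k) \<le> Suc (length (filter (\<lambda>v. fst v \<in> S) l)))"

text \<open>The recursion respects the count. Prefixing \<open>v\<close> to a cell over
  \<open>l\<close> adds the same amount on both sides, and in the new cell
  \<open>v # t v # map t l\<close> the vertices lie over those of \<open>v # l\<close>, with only
  \<open>v\<close> doubled.\<close>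

lemma prism_mem:
  assumes "left_module R M" "submod R M V"
    and t: "\<And>v. v \<in> W \<Longrightarrow> t v \<in> W" "\<And>v. fst (t v) = fst v"
    and "set l \<subseteq> W" "\<And>k. prism_cell W l k \<Longrightarrow> \<phi> k \<in> V"
  shows "prism M t \<phi> l \<in> V"
  using assms(5,6)
proof (induction l arbitrary: \<phi>)
  case (Cons v l)
  interpret left_module R M by fact
  have "prism_cell W (v # l) (v # k)" if "prism_cell W l k" for k
    using that Cons.prems(1) by (auto simp: prism_cell_def)
  then have 1: "prism M t (\<lambda>k. \<phi> (v # k)) l \<in> V"
    using Cons by auto
  have "length (filter (\<lambda>v. fst v \<in> S) (map t l)) = length (filter (\<lambda>v. fst v \<in> S) l)" for S
    by (simp add: filter_map o_def t(2))
  moreover have "map t l \<in> on_lists W (length l)"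
    by (rule map_on_lists[of _ W]) (use Cons.prems t in \<open>auto simp: on_lists_def\<close>)
  ultimately have "prism_cell W (v # l) (v # t v # map t l)"
    using Cons.prems(1) t by (auto simp: prism_cell_def)
  then have "\<phi> (v # t v # map t l) \<in> V"
    using Cons.prems(2) by blast
  then show ?case
    using 1 submodD(3)[OF assms(2)] submod_neg[OF assms(1,2)] submodD(1)[OF assms(2)]
    by (simp add: M.minus_eq)
qed (simp add: submodD[OF assms(2)])

lemma prism_closed:
  assumes "left_module R M" and t: "\<And>v. v \<in> W \<Longrightarrow> t v \<in> W" "\<And>v. fst (t v) = fst v"
    and l: "l \<in> on_lists W n" and \<phi>: "\<And>k. k \<in> on_lists W (Suc n) \<Longrightarrow> \<phi> k \<in> carrier M"
  shows "prism M t \<phi> l \<in> carrier M"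
  by (rule prism_mem[OF assms(1) submod_carrier[OF assms(1)] t])
    (use l \<phi> in \<open>auto simp: prism_cell_def on_lists_def\<close>)

text \<open>Pulls an operator on chains inside the prism; it is applied to the boundary.\<close>

lemma prism_ahom:
  assumes M: "left_module R M" and N: "left_module R N" and h: "h \<in> ahom M N"
    and t: "\<And>v. v \<in> W \<Longrightarrow> t v \<in> W" "\<And>v. fst (t v) = fst v"
    and "l \<in> on_lists W n" "\<And>k. k \<in> on_lists W (Suc n) \<Longrightarrow> \<phi> k \<in> carrier M"
  shows "h (prism M t \<phi> l) = prism N t (\<lambda>k. h (\<phi> k)) l"
  using assms(6,7)
proof (induction l arbitrary: \<phi> n)
  case Nil
  then show ?case
    using ahom_zero[OF left_module_abelian_group[OF M] left_module_abelian_group[OF N] h] by simp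
next
  case (Cons v l)
  interpret M: left_module R M by fact
  interpret N: left_module R N by fact
  obtain m where m: "n = Suc m" "v \<in> W" "l \<in> on_lists W m" using Cons.prems by auto
  have \<phi>v: "\<phi> (v # k) \<in> carrier M" if "k \<in> on_lists W (Suc m)" for k
    using that m Cons.prems by auto
  have p: "prism M t (\<lambda>k. \<phi> (v # k)) l \<in> carrier M"
    by (rule prism_closed[OF M t m(3)]) (use \<phi>v in auto)
  have "v # t v # map t l \<in> on_lists W (Suc n)"
    using m t by (auto intro: map_on_lists)
  then have q: "\<phi> (v # t v # map t l) \<in> carrier M" using Cons.prems by blast
  have "h (prism M t (\<lambda>k. \<phi> (v # k)) l) = prism N t (\<lambda>k. h (\<phi> (v # k))) l"
    by (rule Cons.IH[OF m(3)]) (use \<phi>v in auto)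
  then show ?case
    using p q ahom_add[OF h] ahom_neg[OF M.M.abelian_group_axioms N.M.abelian_group_axioms h]
    by (simp add: M.M.minus_eq N.M.minus_eq)
qed

lemma prism_mhom:
  assumes N: "left_module R N" and t: "\<And>v. v \<in> W \<Longrightarrow> t v \<in> W" "\<And>v. fst (t v) = fst v"
    and "l \<in> on_lists W n" "\<And>k. k \<in> on_lists W (Suc n) \<Longrightarrow> (\<lambda>x. \<phi> x k) \<in> mhom R M N"
  shows "(\<lambda>x. prism N t (\<phi> x) l) \<in> mhom R M N"
  using assms(4,5)
proof (induction l arbitrary: \<phi> n)
  case Nil
  interpret N: left_module R N by fact
  show ?case
    using ahom_zero[OF N.M.abelian_group_axioms N.M.abelian_group_axioms N.smult_ahom]
    by (auto simp: mhom_def ahom_def)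
next
  case (Cons v l)
  interpret N: left_module R N by fact
  obtain m where m: "n = Suc m" "v \<in> W" "l \<in> on_lists W m" using Cons.prems by auto
  have 1: "(\<lambda>x. prism N t (\<lambda>k. \<phi> x (v # k)) l) \<in> mhom R M N"
    by (rule Cons.IH[OF m(3)]) (use m Cons.prems in auto)
  have "v # t v # map t l \<in> on_lists W (Suc n)"
    using m t by (auto intro: map_on_lists)
  then have 2: "(\<lambda>x. \<phi> x (v # t v # map t l)) \<in> mhom R M N" using Cons.prems by blast
  have 3: "(\<lambda>x. \<ominus>\<^bsub>N\<^esub> prism N t (\<lambda>k. \<phi> x (v # k)) l) \<in> mhom R M N"
    by (rule mhom_neg_fun[OF N 1])
  have "(\<lambda>x. \<phi> x (v # t v # map t l) \<oplus>\<^bsub>N\<^esub> (\<ominus>\<^bsub>N\<^esub> prism N t (\<lambda>k. \<phi> x (v # k)) l)) \<in> mhom R M N"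
    using ahom_add_fun[OF N.M.abelian_group_axioms mhom_ahom[OF 2] mhom_ahom[OF 3]]
      mhom_smult[OF 2] mhom_smult[OF 3] ahom_closed[OF mhom_ahom[OF 2]] ahom_closed[OF mhom_ahom[OF 3]]
    by (simp add: mhom_def N.smult_r_distr)
  then show ?case by (simp add: N.M.minus_eq)
qed

lemma (in abelian_group) minus_diff_add:
  assumes "a \<in> carrier G" "b \<in> carrier G" "c \<in> carrier G" "d \<in> carrier G"
  shows "(a \<ominus> b) \<ominus> (c \<ominus> d) = (a \<ominus> c) \<ominus> (b \<ominus> d)"
  using assms by (simp add: minus_eq minus_add a_ac)

lemma prism_diff:
  assumes M: "left_module R M" and t: "\<And>v. v \<in> W \<Longrightarrow> t v \<in> W" "\<And>v. fst (t v) = fst v"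
    and "l \<in> on_lists W n" "\<And>k. k \<in> on_lists W (Suc n) \<Longrightarrow> \<phi> k \<in> carrier M \<and> \<psi> k \<in> carrier M"
  shows "prism M t (\<lambda>k. \<phi> k \<ominus>\<^bsub>M\<^esub> \<psi> k) l = prism M t \<phi> l \<ominus>\<^bsub>M\<^esub> prism M t \<psi> l"
  using assms(4,5)
proof (induction l arbitrary: \<phi> \<psi> n)
  case Nil
  interpret left_module R M by fact
  show ?case by (simp add: M.minus_eq)
next
  case (Cons v l)
  interpret left_module R M by fact
  obtain m where m: "n = Suc m" "v \<in> W" "l \<in> on_lists W m" using Cons.prems by auto
  have v: "\<phi> (v # k) \<in> carrier M \<and> \<psi> (v # k) \<in> carrier M" if "k \<in> on_lists W (Suc m)" for k
    using that m Cons.prems by auto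
  have "v # t v # map t l \<in> on_lists W (Suc n)"
    using m t by (auto intro: map_on_lists)
  then have q: "\<phi> (v # t v # map t l) \<in> carrier M" "\<psi> (v # t v # map t l) \<in> carrier M"
    using Cons.prems by blast+
  have p: "prism M t (\<lambda>k. \<phi> (v # k)) l \<in> carrier M" "prism M t (\<lambda>k. \<psi> (v # k)) l \<in> carrier M"
    by (rule prism_closed[OF M t m(3)]; use v in simp)+
  have "prism M t (\<lambda>k. \<phi> (v # k) \<ominus>\<^bsub>M\<^esub> \<psi> (v # k)) l
      = prism M t (\<lambda>k. \<phi> (v # k)) l \<ominus>\<^bsub>M\<^esub> prism M t (\<lambda>k. \<psi> (v # k)) l"
    by (rule Cons.IH[OF m(3)]) (use v in auto)
  then show ?case
    using p q by (simp add: M.minus_diff_add)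
qed

lemma list_boundary_diff:
  assumes M: "left_module R M"
    and "l \<in> on_lists W (Suc n)" "\<And>k. k \<in> on_lists W n \<Longrightarrow> \<phi> k \<in> carrier M \<and> \<psi> k \<in> carrier M"
  shows "list_boundary M (\<lambda>k. \<phi> k \<ominus>\<^bsub>M\<^esub> \<psi> k) l = list_boundary M \<phi> l \<ominus>\<^bsub>M\<^esub> list_boundary M \<psi> l"
  using assms(2,3)
proof (induction l arbitrary: \<phi> \<psi> n)
  case (Cons v l)
  interpret left_module R M by fact
  have l: "l \<in> on_lists W n" "v \<in> W" using Cons.prems by auto
  show ?case
  proof (cases n)
    case 0
    then have "l = []" using l by (simp add: on_lists_def)
    then show ?thesis using Cons.prems 0 by (simp add: M.minus_eq)
  next
    case (Suc m)
    have v: "\<phi> (v # k) \<in> carrier M \<and> \<psi> (v # k) \<in> carrier M" if "k \<in> on_lists W m" for k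
      using that l Suc Cons.prems by auto
    have p: "list_boundary M (\<lambda>k. \<phi> (v # k)) l \<in> carrier M" "list_boundary M (\<lambda>k. \<psi> (v # k)) l \<in> carrier M"
      by (rule list_boundary_mem[OF M submod_carrier[OF M] l(1)[unfolded Suc]]; use v in simp)+
    have "list_boundary M (\<lambda>k. \<phi> (v # k) \<ominus>\<^bsub>M\<^esub> \<psi> (v # k)) l
        = list_boundary M (\<lambda>k. \<phi> (v # k)) l \<ominus>\<^bsub>M\<^esub> list_boundary M (\<lambda>k. \<psi> (v # k)) l"
      by (rule Cons.IH[OF l(1)[unfolded Suc]]) (use v in auto)
    then show ?thesis
      using p Cons.prems(2)[OF l(1)] by (simp add: M.minus_diff_add)
  qed
qed simp

text \<open>The cancellation in the induction for \<open>prism_identity\<close>: \<open>x\<close>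
  and \<open>p\<close> each occur with both signs, and \<open>qr\<close> is the inductive
  hypothesis.\<close>

lemma (in abelian_group) prism_step:
  assumes "a \<in> carrier G" "b \<in> carrier G" "x \<in> carrier G" "p \<in> carrier G" "q \<in> carrier G"
    "r \<in> carrier G" "e \<in> carrier G" and qr: "q \<oplus> r = b \<ominus> e"
  shows "((a \<ominus> (b \<ominus> x)) \<ominus> (p \<ominus> q)) \<oplus> (p \<ominus> (x \<ominus> r)) = a \<ominus> e"
proof -
  have "((a \<ominus> (b \<ominus> x)) \<ominus> (p \<ominus> q)) \<oplus> (p \<ominus> (x \<ominus> r))
      = (a \<ominus> b) \<oplus> ((x \<oplus> \<ominus> x) \<oplus> ((p \<oplus> \<ominus> p) \<oplus> (q \<oplus> r)))"
    using assms(1-7) by (simp only: minus_eq minus_add minus_minus a_ac a_closed a_inv_closed)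
  also have "\<dots> = (a \<ominus> b) \<oplus> (b \<ominus> e)"
    using assms(1-7) by (simp add: r_neg qr)
  also have "\<dots> = a \<oplus> ((\<ominus> b \<oplus> b) \<ominus> e)"
    using assms(1-7) by (simp only: minus_eq a_assoc a_closed a_inv_closed)
  also have "\<dots> = a \<ominus> e"
    using assms(1-7) by (simp add: l_neg minus_eq)
  finally show ?thesis .
qed

text \<open>The identity "boundary of prism plus prism of boundary is top minus bottom". In the dual
  form compositions are reversed: the first summand is \<open>\<phi>\<close> on the boundary of the
  prism, the second is \<open>\<phi>\<close> on the prism of the boundary. The augmentation makes
  the empty list a valid base case.\<close>

lemma prism_identity:
  assumes M: "left_module R M" and t: "\<And>v. v \<in> W \<Longrightarrow> t v \<in> W" "\<And>v. fst (t v) = fst v"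
    and "l \<in> on_lists W n" "\<And>k. k \<in> on_lists W n \<Longrightarrow> \<phi> k \<in> carrier M"
  shows "prism M t (list_boundary M \<phi>) l \<oplus>\<^bsub>M\<^esub> list_boundary M (prism M t \<phi>) l = \<phi> (map t l) \<ominus>\<^bsub>M\<^esub> \<phi> l"
  using assms(4,5)
proof (induction l arbitrary: \<phi> n)
  case Nil
  interpret left_module R M by fact
  show ?case using Nil by (simp add: M.minus_eq M.r_neg)
next
  case (Cons v l)
  interpret left_module R M by fact
  obtain m where m: "n = Suc m" "v \<in> W" "l \<in> on_lists W m" using Cons.prems by auto
  have C: "submod R M (carrier M)" by (rule submod_carrier[OF M])
  have tl: "map t l \<in> on_lists W m" by (rule map_on_lists[OF m(3)]) (use t in auto)
  have \<phi>n: "\<phi> k \<in> carrier M" if "k \<in> on_lists W (Suc m)" for k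
    using that Cons.prems m by auto
  have \<phi>v: "\<phi> (v # k) \<in> carrier M" if "k \<in> on_lists W m" for k
    using that m \<phi>n by auto
  have lbdv: "list_boundary M (\<lambda>k. \<phi> (v # k)) k \<in> carrier M" if "k \<in> on_lists W (Suc m)" for k
    by (rule list_boundary_mem[OF M C that]) (use \<phi>v in auto)
  \<comment> \<open>For the cell \<open>v # t v # map t l\<close>, the face without \<open>v\<close>
    gives \<open>?a\<close>, the one without \<open>t v\<close> gives \<open>?b\<close>, and the
    faces without a later vertex give \<open>?x\<close>. The cones with apex \<open>v\<close> over
    the cells of the prism of \<open>l\<close> give \<open>?p\<close> when the apex is dropped and
    \<open>?q\<close> otherwise. The prisms over faces of \<open>l\<close>, coned from
    \<open>v\<close>, give \<open>?r\<close>.\<close>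
  let ?a = "\<phi> (t v # map t l)"
  let ?b = "\<phi> (v # map t l)"
  let ?x = "list_boundary M (\<lambda>k. \<phi> (v # t v # k)) (map t l)"
  let ?p = "prism M t \<phi> l"
  let ?q = "prism M t (list_boundary M (\<lambda>k. \<phi> (v # k))) l"
  let ?r = "list_boundary M (prism M t (\<lambda>k. \<phi> (v # k))) l"
  let ?e = "\<phi> (v # l)"
  have x: "?x \<in> carrier M"
  proof (cases m)
    case (Suc j)
    show ?thesis
      by (rule list_boundary_mem[OF M C tl[unfolded Suc]]) (use Suc \<phi>n m t in auto)
  qed (use tl in \<open>auto simp: on_lists_def\<close>)
  have p: "?p \<in> carrier M" by (rule prism_closed[OF M t m(3)]) (use \<phi>n in auto)
  have q: "?q \<in> carrier M" by (rule prism_closed[OF M t m(3)]) (use lbdv in auto)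
  have prv: "prism M t (\<lambda>k. \<phi> (v # k)) k \<in> carrier M" if "k \<in> on_lists W j" "m = Suc j" for k j
    by (rule prism_closed[OF M t that(1)]) (use \<phi>v that in auto)
  have r: "?r \<in> carrier M"
  proof (cases m)
    case (Suc j)
    show ?thesis
      by (rule list_boundary_mem[OF M C m(3)[unfolded Suc]]) (use prv Suc in auto)
  qed (use m in \<open>auto simp: on_lists_def\<close>)
  have 1: "prism M t (\<lambda>k. list_boundary M \<phi> (v # k)) l = ?p \<ominus>\<^bsub>M\<^esub> ?q"
    unfolding list_boundary.simps by (rule prism_diff[OF M t m(3)]) (use \<phi>n lbdv in auto)
  have 2: "list_boundary M (\<lambda>k. prism M t \<phi> (v # k)) l = ?x \<ominus>\<^bsub>M\<^esub> ?r"
  proof (cases m)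
    case 0
    then show ?thesis using m by (simp add: on_lists_def M.minus_eq)
  next
    case (Suc j)
    have "\<phi> (v # t v # map t k) \<in> carrier M" if "k \<in> on_lists W j" for k
      using map_on_lists[OF that, of t W] t m Suc by (intro \<phi>n) auto
    then show ?thesis
      unfolding prism.simps list_boundary_map by (intro list_boundary_diff[OF M m(3)[unfolded Suc]]) (use prv Suc in auto)
  qed
  have IH: "?q \<oplus>\<^bsub>M\<^esub> ?r = ?b \<ominus>\<^bsub>M\<^esub> ?e"
    by (rule Cons.IH[OF m(3)]) (rule \<phi>v)
  have "prism M t (list_boundary M \<phi>) (v # l) \<oplus>\<^bsub>M\<^esub> list_boundary M (prism M t \<phi>) (v # l)
      = ((?a \<ominus>\<^bsub>M\<^esub> (?b \<ominus>\<^bsub>M\<^esub> ?x)) \<ominus>\<^bsub>M\<^esub> (?p \<ominus>\<^bsub>M\<^esub> ?q)) \<oplus>\<^bsub>M\<^esub> (?p \<ominus>\<^bsub>M\<^esub> (?x \<ominus>\<^bsub>M\<^esub> ?r))"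
    using 1 2 by simp
  also have "\<dots> = ?a \<ominus>\<^bsub>M\<^esub> ?e"
    by (rule M.prism_step[OF _ _ x p q r _ IH]) (use \<phi>n m tl t in auto)
  finally show ?case by simp
qed

definition alternate :: "('r, 'm, 'x) module_scheme \<Rightarrow> nat \<Rightarrow> 'm \<Rightarrow> 'm" where
  "alternate M k x = (if even k then x else \<ominus>\<^bsub>M\<^esub> x)"

definition del :: "nat \<Rightarrow> 'v list \<Rightarrow> 'v list" where
  "del k l = take k l @ drop (Suc k) l"

lemma del_simps [simp]: "del 0 (v # l) = l" "del (Suc k) (v # l) = v # del k l"
  by (simp_all add: del_def)

lemma del_on_lists: "\<lbrakk>l \<in> on_lists W (Suc n); k \<le> n\<rbrakk> \<Longrightarrow> del k l \<in> on_lists W n"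
  by (auto simp: on_lists_def del_def dest: in_set_takeD in_set_dropD)

lemma nth_del: "k < length l \<Longrightarrow> m < length l - 1 \<Longrightarrow> del k l ! m = l ! (if m < k then m else Suc m)"
  by (auto simp: del_def nth_append)

lemma alternate_mhom: "left_module R M \<Longrightarrow> h \<in> mhom R N M \<Longrightarrow> (\<lambda>x. alternate M k (h x)) \<in> mhom R N M"
  using mhom_neg_fun by (cases "even k") (auto simp: alternate_def)

lemma alternate_closed: "left_module R M \<Longrightarrow> x \<in> carrier M \<Longrightarrow> alternate M k x \<in> carrier M"
  by (simp add: alternate_def abelian_group.a_inv_closed left_module_abelian_group)

lemma ahom_alternate:
  "\<lbrakk>left_module R M; left_module R N; h \<in> ahom M N; x \<in> carrier M\<rbrakk> \<Longrightarrow>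
    h (alternate M k x) = alternate N k (h x)"
  using ahom_neg[of M N h x] by (simp add: alternate_def left_module_abelian_group)

text \<open>Converts the cone recursion into the alternating sum of \<open>coeff_boundary\<close>:
  behind the first vertex every position shifts by one, which accounts for the minus sign of the
  recursion.\<close>

lemma list_boundary_sum:
  assumes M: "left_module R M" and "l \<in> on_lists W (Suc n)" "\<And>k. k \<in> on_lists W n \<Longrightarrow> \<phi> k \<in> carrier M"
  shows "list_boundary M \<phi> l = (\<Oplus>\<^bsub>M\<^esub>k\<in>{..n}. alternate M k (\<phi> (del k l)))"
  using assms(2,3)
proof (induction l arbitrary: \<phi> n)
  case (Cons v l)
  interpret left_module R M by fact
  have l: "l \<in> on_lists W n" "v \<in> W" using Cons.prems by auto
  have cl: "alternate M k (\<phi> (del k (v # l))) \<in> carrier M" if "k \<le> n" for k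
    using del_on_lists[OF Cons.prems(1) that] Cons.prems(2) alternate_closed[OF M] by blast
  show ?case
  proof (cases n)
    case 0
    then have "l = []" using l by (simp add: on_lists_def)
    then show ?thesis using Cons.prems 0 by (simp add: M.minus_eq alternate_def)
  next
    case (Suc m)
    have \<phi>v: "\<phi> (v # del k l) \<in> carrier M" if "k \<le> m" for k
      using del_on_lists[of l W m k] Cons.prems(2) l Suc that by auto
    have "(\<Oplus>\<^bsub>M\<^esub>k\<in>{..n}. alternate M k (\<phi> (del k (v # l))))
        = (\<Oplus>\<^bsub>M\<^esub>k\<in>insert 0 (Suc ` {..m}). alternate M k (\<phi> (del k (v # l))))"
      by (simp add: Suc atMost_Suc_eq_insert_0)
    also have "\<dots> = \<phi> l \<oplus>\<^bsub>M\<^esub> (\<Oplus>\<^bsub>M\<^esub>k\<in>Suc ` {..m}. alternate M k (\<phi> (del k (v # l))))"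
      using cl Suc Cons.prems(2)[OF l(1)] by (subst M.finsum_insert) (auto simp: alternate_def)
    also have "(\<Oplus>\<^bsub>M\<^esub>k\<in>Suc ` {..m}. alternate M k (\<phi> (del k (v # l))))
        = (\<Oplus>\<^bsub>M\<^esub>k\<in>{..m}. alternate M (Suc k) (\<phi> (v # del k l)))"
      using cl Suc by (subst M.finsum_reindex) auto
    also have "\<dots> = (\<Oplus>\<^bsub>M\<^esub>k\<in>{..m}. \<ominus>\<^bsub>M\<^esub> alternate M k (\<phi> (v # del k l)))"
      by (rule M.finsum_cong') (use \<phi>v in \<open>auto simp: alternate_def\<close>)
    also have "\<dots> = \<ominus>\<^bsub>M\<^esub> (\<Oplus>\<^bsub>M\<^esub>k\<in>{..m}. alternate M k (\<phi> (v # del k l)))"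
    proof -
      have "(\<lambda>x. \<ominus>\<^bsub>M\<^esub> x) \<in> ahom M M"
        by (rule ahomI) (auto simp: M.minus_add)
      then show ?thesis
        using ahom_finsum[OF M.abelian_group_axioms M.abelian_group_axioms,
            of "\<lambda>x. \<ominus>\<^bsub>M\<^esub> x" "{..m}" "\<lambda>k. alternate M k (\<phi> (v # del k l))"] \<phi>v alternate_closed[OF M]
        by simp
    qed
    also have "(\<Oplus>\<^bsub>M\<^esub>k\<in>{..m}. alternate M k (\<phi> (v # del k l))) = list_boundary M (\<lambda>k. \<phi> (v # k)) l"
      using Cons.IH[of m "\<lambda>k. \<phi> (v # k)"] l Suc Cons.prems(2) by simp
    finally show ?thesis by (simp add: M.minus_eq)
  qed
qed simp

section \<open>Affine simplices in a prism\<close>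

text \<open>The vertex \<open>(i, s)\<close> stands for the point of the prism over the \<open>i\<close>-th vertex at height \<open>s\<close>.\<close>

definition aff :: "(nat \<times> real) list \<Rightarrow> (nat \<Rightarrow> real) \<Rightarrow> (nat \<Rightarrow> real) \<times> real" where
  "aff L x = (\<lambda>i. \<Sum>m<length L. x m * (if fst (L ! m) = i then 1 else 0),
              \<Sum>m<length L. x m * snd (L ! m))"

definition prism_vertices :: "nat \<Rightarrow> (nat \<times> real) set" where
  "prism_vertices d = {..d} \<times> {0, 1}"

definition bottom :: "nat \<Rightarrow> (nat \<times> real) list" where
  "bottom d = map (\<lambda>i. (i, 0)) [0..<Suc d]"

definition lift_top :: "nat \<times> real \<Rightarrow> nat \<times> real" where
  "lift_top v = (fst v, 1)"

text \<open>The vertex map of the inclusion of the \<open>k\<close>-th facet, extended over the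
  prism without changing heights.\<close>

definition skip :: "nat \<Rightarrow> nat \<times> real \<Rightarrow> nat \<times> real" where
  "skip k v = (if fst v < k then fst v else Suc (fst v), snd v)"

abbreviation simplex_top :: "nat \<Rightarrow> (nat \<Rightarrow> real) topology" where
  "simplex_top d \<equiv> subtopology (powertop_real UNIV) (standard_simplex d)"

lemma lift_top_simps [simp]: "fst (lift_top v) = fst v" "snd (lift_top v) = 1"
  by (simp_all add: lift_top_def)

lemma lift_top_vertices: "v \<in> prism_vertices d \<Longrightarrow> lift_top v \<in> prism_vertices d"
  by (auto simp: prism_vertices_def lift_top_def)

lemma bottom_on_lists: "bottom d \<in> on_lists (prism_vertices d) (Suc d)"
  by (auto simp: bottom_def on_lists_def prism_vertices_def)

text \<open>Joins two views of a facet, as the image of a smaller simplex and as a list with one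
  vertex deleted. The first occurs in the prism of a face, the second in
  \<open>list_boundary\<close>.\<close>

lemma bottom_del:
  assumes "k \<le> Suc d"
  shows "map (skip k) (bottom d) = del k (bottom (Suc d))"
proof (rule nth_equalityI)
  show "length (map (skip k) (bottom d)) = length (del k (bottom (Suc d)))"
    using assms by (simp add: bottom_def del_def)
next
  fix m assume "m < length (map (skip k) (bottom d))"
  then have m: "m < Suc d" by (simp add: bottom_def)
  have b: "bottom e ! i = (i, 0)" if "i < Suc e" for e i
    using that by (simp add: bottom_def del: upt_Suc)
  have "del k (bottom (Suc d)) ! m = bottom (Suc d) ! (if m < k then m else Suc m)"
    using m assms by (intro nth_del) (auto simp: bottom_def)
  moreover have "map (skip k) (bottom d) ! m = skip k (bottom d ! m)"
    using m by (intro nth_map) (simp add: bottom_def del: upt_Suc)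
  ultimately show "map (skip k) (bottom d) ! m = del k (bottom (Suc d)) ! m"
    using m b[of m d] b[of m "Suc d"] b[of "Suc m" "Suc d"] by (simp add: skip_def)
qed

lemma simplex_eqD: "x \<in> standard_simplex q \<Longrightarrow> (\<Sum>m<Suc q. x m) = 1"
  by (simp add: standard_simplex_def lessThan_Suc_atMost)

lemma simplex_nonneg: "x \<in> standard_simplex q \<Longrightarrow> 0 \<le> x m"
  by (simp add: standard_simplex_def)

lemma aff_simplex:
  assumes L: "L \<in> on_lists (prism_vertices d) (Suc q)" and x: "x \<in> standard_simplex q"
  shows "fst (aff L x) \<in> standard_simplex d" "snd (aff L x) \<in> {0..1}"
proof -
  have len: "length L = Suc q" using L by (simp add: on_lists_def)
  have v: "fst (L ! m) \<le> d" "snd (L ! m) \<in> {0, 1}" if "m < Suc q" for m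
  proof -
    have "L ! m \<in> prism_vertices d"
      using L that by (auto simp: on_lists_def)
    then show "fst (L ! m) \<le> d" "snd (L ! m) \<in> {0, 1}"
      by (auto simp: prism_vertices_def)
  qed
  \<comment> \<open>Barycentric coordinates and height are both weighted sums of zeros and
    ones.\<close>
  have s1: "(\<Sum>m<Suc q. x m * c m) \<in> {0..1}" if "\<And>m. m < Suc q \<Longrightarrow> c m \<in> {0, 1}" for c
  proof -
    have "(\<Sum>m<Suc q. x m * c m) \<le> (\<Sum>m<Suc q. x m)"
      by (rule sum_mono) (use that simplex_nonneg[OF x] in \<open>fastforce simp: mult_left_le\<close>)
    moreover have "0 \<le> (\<Sum>m<Suc q. x m * c m)"
      by (rule sum_nonneg) (use that simplex_nonneg[OF x] in fastforce)
    ultimately show ?thesis using simplex_eqD[OF x] by simp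
  qed
  show "snd (aff L x) \<in> {0..1}"
    unfolding aff_def snd_conv len by (rule s1) (rule v(2))
  have "(\<Sum>i\<le>d. \<Sum>m<Suc q. x m * (if fst (L ! m) = i then 1 else 0))
      = (\<Sum>m<Suc q. \<Sum>i\<le>d. x m * (if fst (L ! m) = i then 1 else 0))"
    by (rule sum.swap)
  also have "\<dots> = (\<Sum>m<Suc q. x m)"
  proof (rule sum.cong[OF refl])
    fix m assume m: "m \<in> {..<Suc q}"
    have "(\<Sum>i\<le>d. x m * (if fst (L ! m) = i then 1 else 0)) = (\<Sum>i\<le>d. if fst (L ! m) = i then x m else 0)"
      by (rule sum.cong) auto
    then show "(\<Sum>i\<le>d. x m * (if fst (L ! m) = i then 1 else 0)) = x m"
      using v[of m] m by simp
  qed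
  finally have "(\<Sum>i\<le>d. fst (aff L x) i) = 1"
    using simplex_eqD[OF x] by (simp add: aff_def len del: sum.lessThan_Suc)
  moreover have "fst (aff L x) i \<in> {0..1}" for i
    unfolding aff_def fst_conv len by (rule s1) auto
  moreover have "fst (aff L x) i = 0" if "i > d" for i
    unfolding aff_def fst_conv len
    by (rule sum.neutral) (use v that in \<open>fastforce split: if_splits\<close>)
  ultimately show "fst (aff L x) \<in> standard_simplex d"
    by (simp add: standard_simplex_def)
qed

lemma aff_cont:
  assumes L: "L \<in> on_lists (prism_vertices d) (Suc q)"
  shows "continuous_map (simplex_top q) (prod_topology (simplex_top d) unit_interval) (aff L)"
proof -
  have c: "continuous_map (simplex_top q) euclideanreal (\<lambda>x. \<Sum>m<length L. x m * a m)" for a :: "nat \<Rightarrow> real"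
    by (intro continuous_map_sum continuous_map_real_mult continuous_map_from_subtopology
        continuous_map_product_projection) auto
  have 1: "continuous_map (simplex_top q) (simplex_top d) (\<lambda>x. fst (aff L x))"
    unfolding continuous_map_in_subtopology
  proof
    show "continuous_map (simplex_top q) (powertop_real UNIV) (\<lambda>x. fst (aff L x))"
      unfolding continuous_map_componentwise aff_def fst_conv using c by auto
  qed (use aff_simplex[OF L] in auto)
  have 2: "continuous_map (simplex_top q) unit_interval (\<lambda>x. snd (aff L x))"
    unfolding continuous_map_in_subtopology
  proof
    show "continuous_map (simplex_top q) euclideanreal (\<lambda>x. snd (aff L x))"
      unfolding aff_def snd_conv by (rule c)
  qed (use aff_simplex[OF L] in auto)
  show ?thesis
    using continuous_map_pairedI[OF 1 2] by simp
qed

text \<open>\<open>simplical_face k\<close> inserts a zero weight at position \<open>k\<close> and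
  shifts the later ones, so the \<open>k\<close>-th term drops out.\<close>

lemma simplical_face_sum:
  fixes c :: "nat \<Rightarrow> real"
  assumes "k \<le> n"
  shows "(\<Sum>m<Suc n. simplical_face k x m * c m) = (\<Sum>m<n. x m * c (if m < k then m else Suc m))"
proof -
  have "(\<Sum>m<Suc n. simplical_face k x m * c m) = (\<Sum>m\<in>{..<Suc n} - {k}. simplical_face k x m * c m)"
    by (rule sum.mono_neutral_right) (auto simp: simplical_face_def)
  also have "\<dots> = (\<Sum>m<n. x m * c (if m < k then m else Suc m))"
    by (rule sum.reindex_bij_witness[of _ "\<lambda>m. if m < k then m else Suc m" "\<lambda>m. if m < k then m else m - 1"])
      (use assms in \<open>auto simp: simplical_face_def\<close>)
  finally show ?thesis .
qed

lemma aff_face: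
  assumes "length L = Suc n" "k \<le> n"
  shows "aff L (simplical_face k x) = aff (del k L) x"
proof -
  have len: "length (del k L) = n" using assms by (simp add: del_def)
  have "del k L ! m = L ! (if m < k then m else Suc m)" if "m < n" for m
    using that assms by (intro nth_del) auto
  then show ?thesis
    unfolding aff_def assms(1) len simplical_face_sum[OF assms(2)] by simp
qed

text \<open>Complements \<open>aff_face\<close>: deleting a vertex of the list is a face of the
  cell, whereas renumbering by \<open>skip k\<close> moves the cell into the prism over a facet of
  the simplex below.\<close>

lemma aff_skip: "aff (map (skip k) L) x = (simplical_face k (fst (aff L x)), snd (aff L x))"
proof -
  have "(\<Sum>m<length L. x m * (if fst (map (skip k) L ! m) = i then 1 else 0)) = simplical_face k (fst (aff L x)) i" for i
  proof -
    consider "i < k" | "i = k" | "i > k" by linarith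
    then show ?thesis
    proof cases
      case 1
      then show ?thesis
        unfolding simplical_face_def aff_def by (auto simp: skip_def intro!: sum.cong)
    next
      case 2
      then show ?thesis
        unfolding simplical_face_def aff_def by (auto simp: skip_def intro!: sum.neutral)
    next
      case 3
      then show ?thesis
        unfolding simplical_face_def aff_def by (auto simp: skip_def intro!: sum.cong)
    qed
  qed
  moreover have "(\<Sum>m<length L. x m * snd (map (skip k) L ! m)) = snd (aff L x)"
    by (simp add: aff_def skip_def)
  ultimately show ?thesis
    by (simp add: aff_def[of "map (skip k) L"])
qed

lemma aff_bottom:
  assumes x: "x \<in> standard_simplex d"
  shows "aff (bottom d) x = (x, 0)" "aff (map lift_top (bottom d)) x = (x, 1)"
proof -
  have len: "length (bottom d) = Suc d" by (simp add: bottom_def)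
  have b: "bottom d ! i = (i, 0)" if "i < Suc d" for i
    using that by (simp add: bottom_def del: upt_Suc)
  have 1: "(\<Sum>m<Suc d. x m * (if m = i then 1 else 0)) = x i" for i
  proof -
    have "(\<Sum>m<Suc d. x m * (if m = i then 1 else 0)) = (\<Sum>m<Suc d. if m = i then x m else 0)"
      by (rule sum.cong) auto
    then show ?thesis
      using x by (auto simp: standard_simplex_def simp del: sum.lessThan_Suc)
  qed
  have "(\<Sum>m<Suc d. x m * (if fst (bottom d ! m) = i then 1 else 0)) = x i" for i
  proof -
    have "(\<Sum>m<Suc d. x m * (if fst (bottom d ! m) = i then 1 else 0))
        = (\<Sum>m<Suc d. x m * (if m = i then 1 else 0))"
      by (rule sum.cong[OF refl]) (simp add: b)
    then show ?thesis using 1[of i] by (rule trans)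
  qed
  moreover have "(\<Sum>m<Suc d. x m * snd (bottom d ! m)) = 0"
    by (rule sum.neutral) (simp add: b)
  ultimately show "aff (bottom d) x = (x, 0)"
    unfolding aff_def len by (simp only:)
  have "(\<Sum>m<Suc d. x m * (if fst (map lift_top (bottom d) ! m) = i then 1 else 0)) = x i" for i
  proof -
    have "(\<Sum>m<Suc d. x m * (if fst (map lift_top (bottom d) ! m) = i then 1 else 0))
        = (\<Sum>m<Suc d. x m * (if m = i then 1 else 0))"
      by (rule sum.cong[OF refl]) (simp add: b len)
    then show ?thesis using 1[of i] by (rule trans)
  qed
  moreover have "(\<Sum>m<Suc d. x m * snd (map lift_top (bottom d) ! m)) = (\<Sum>m<Suc d. x m)"
    by (rule sum.cong[OF refl]) (simp add: len)
  ultimately show "aff (map lift_top (bottom d)) x = (x, 1)"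
    unfolding aff_def length_map len simplex_eqD[OF x] by (simp only:)
qed

text \<open>Let \<open>S\<close> span a face that contains the shadow of \<open>x\<close>. A base
  coordinate outside \<open>S\<close> is a vanishing sum of nonnegative weights, so every vertex of
  \<open>L\<close> with positive weight lies above \<open>S\<close>. The count in
  \<open>prism_cell\<close> leaves at most \<open>card S + 1\<close> such vertices, which raises the
  dimension by at most one.\<close>

lemma prism_cell_skeleton:
  assumes L: "prism_cell (prism_vertices d) (bottom d) L" and x: "x \<in> standard_simplex (Suc d)"
    and y: "fst (aff L x) \<in> simplex_skeleton d j"
  shows "x \<in> simplex_skeleton (Suc d) (j + 1)"
proof -
  have len: "length L = Suc (Suc d)" "L \<in> on_lists (prism_vertices d) (Suc (Suc d))"
    using L bottom_on_lists[of d] by (auto simp: prism_cell_def on_lists_def)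
  obtain S where S: "S \<subseteq> {..d}" "int (card S) - 1 \<le> j" "\<And>m. m \<notin> S \<Longrightarrow> fst (aff L x) m = 0"
    using y by (auto simp: simplex_skeleton_def)
  let ?S' = "{m. m < Suc (Suc d) \<and> fst (L ! m) \<in> S}"
  have "card ?S' = length (filter (\<lambda>v. fst v \<in> S) L)"
    by (simp add: length_filter_conv_card len)
  also have "\<dots> \<le> Suc (length (filter (\<lambda>v. fst v \<in> S) (bottom d)))"
    using L by (simp add: prism_cell_def)
  \<comment> \<open>The bottom has exactly one vertex over each index.\<close>
  also have "length (filter (\<lambda>v. fst v \<in> S) (bottom d)) = card S"
  proof -
    have "length (filter (\<lambda>v. fst v \<in> S) (bottom d)) = length (filter (\<lambda>i. i \<in> S) [0..<Suc d])"
      by (simp add: bottom_def filter_map o_def del: upt_Suc)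
    also have "\<dots> = card (set (filter (\<lambda>i. i \<in> S) [0..<Suc d]))"
      by (rule distinct_card[symmetric]) (simp del: upt_Suc)
    also have "set (filter (\<lambda>i. i \<in> S) [0..<Suc d]) = S"
      using S(1) by (auto simp: less_Suc_eq_le simp del: upt_Suc)
    finally show ?thesis .
  qed
  finally have "int (card ?S') - 1 \<le> j + 1"
    using S(2) by simp
  moreover have "x m = 0" if "m \<notin> ?S'" for m
  proof (cases "m < Suc (Suc d)")
    case True
    let ?i = "fst (L ! m)"
    have "?i \<notin> S" using that True by blast
    then have "(\<Sum>m<Suc (Suc d). x m * (if fst (L ! m) = ?i then 1 else 0)) = 0"
      using S(3) by (simp add: aff_def len del: sum.lessThan_Suc)
    then have "x m * (if fst (L ! m) = ?i then 1 else 0) = 0"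
      using sum_nonneg_eq_0_iff[of "{..<Suc (Suc d)}" "\<lambda>m. x m * (if fst (L ! m) = ?i then 1 else 0)"]
        simplex_nonneg[OF x] True by (auto simp del: sum.lessThan_Suc)
    then show ?thesis by simp
  next
    case False
    then show ?thesis using x by (simp add: standard_simplex_def)
  qed
  moreover have "?S' \<subseteq> {..Suc d}" by auto
  ultimately show ?thesis
    unfolding simplex_skeleton_def using x by blast
qed

section \<open>Filtered spaces\<close>

lemma skel_mono:
  assumes "filtered_space X" "i \<le> j"
  shows "skel X i \<subseteq> skel X j"
  using assms(2)
proof (induction j rule: int_ge_induct)
  case (step j)
  have "skel X (j + 1 - 1) \<subseteq> skel X (j + 1)"
    using assms(1) unfolding filtered_space_def by blast
  then show ?case using step by simp
qed simp

lemma stratum_sub: "filtered_space X \<Longrightarrow> stratum X i \<subseteq> topspace (fspace X)"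
  unfolding stratum_def filtered_space_def using closedin_subset by blast

lemma stratum_unique:
  assumes "filtered_space X" "x \<in> stratum X i" "x \<in> stratum X j"
  shows "i = j"
proof -
  have "i \<le> j" if "x \<in> stratum X i" "x \<in> stratum X j" for i j
  proof (rule ccontr)
    assume "\<not> i \<le> j"
    then have "skel X j \<subseteq> skel X (i - 1)" by (intro skel_mono assms(1)) simp
    then show False using that by (auto simp: stratum_def)
  qed
  then show ?thesis using assms by (meson antisym)
qed

text \<open>The least skeleton that contains \<open>x\<close> determines the stratum. It exists
  because the skeleton of index \<open>sdim X\<close> is everything, and index 0 is the last case
  since the skeleton of index -1 is empty.\<close>

lemma ex_stratum:
  assumes X: "filtered_space X" and x: "x \<in> topspace (fspace X)"
  obtains i where "x \<in> stratum X i"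
proof -
  let ?P = "\<lambda>k. x \<in> skel X (int k)"
  have "?P (sdim X)" using X x by (simp add: filtered_space_def)
  then have least: "?P (LEAST k. ?P k)"
    by (rule LeastI)
  let ?k = "LEAST k. ?P k"
  have "x \<notin> skel X (int ?k - 1)"
  proof (cases "?k = 0")
    case True
    then show ?thesis using X by (simp add: filtered_space_def)
  next
    case False
    then have "int ?k - 1 = int (?k - 1)" "?k - 1 < ?k" by auto
    then show ?thesis using not_less_Least[of "?k - 1" ?P] by auto
  qed
  then show thesis using least that by (auto simp: stratum_def)
qed

lemma topspace_top_part:
  "topspace (top_part X) = topspace (fspace X) - skel X (int (sdim X) - 2)"
  by (auto simp: top_part_def)

text \<open>Whether a point carries coefficients depends only on the index of its stratum. Maps that
  keep the index therefore restrict to the top parts and reflect them.\<close>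

lemma stratum_top_part:
  assumes X: "filtered_space X" and x: "x \<in> stratum X i"
  shows "x \<in> topspace (top_part X) \<longleftrightarrow> int (sdim X) - 2 < i"
proof (cases "int (sdim X) - 2 < i")
  case True
  then have "skel X (int (sdim X) - 2) \<subseteq> skel X (i - 1)" by (intro skel_mono X) simp
  then show ?thesis using True x stratum_sub[OF X] by (auto simp: topspace_top_part stratum_def)
next
  case False
  then have "skel X i \<subseteq> skel X (int (sdim X) - 2)" by (intro skel_mono X) simp
  then show ?thesis using False x by (auto simp: topspace_top_part stratum_def)
qed

lemma continuous_map_simplical_face:
  assumes "k \<le> Suc d"
  shows "continuous_map (simplex_top d) (simplex_top (Suc d)) (simplical_face k)"
  unfolding continuous_map_in_subtopology
proof
  show "continuous_map (simplex_top d) (powertop_real UNIV) (simplical_face k)"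
    unfolding continuous_map_componentwise
  proof (intro conjI ballI)
    fix i
    have "continuous_map (powertop_real UNIV) euclideanreal (\<lambda>x. simplical_face k x i)"
      unfolding simplical_face_def by (auto intro: continuous_map_product_projection)
    then show "continuous_map (simplex_top d) euclideanreal (\<lambda>x. simplical_face k x i)"
      by (rule continuous_map_from_subtopology)
  qed auto
qed (use assms simplical_face_in_standard_simplex[of "Suc d" k] in auto)

section \<open>Coefficients\<close>

lemma mhom_cong:
  assumes "h \<in> mhom R M N" "left_module R M" "\<And>x. x \<in> carrier M \<Longrightarrow> k x = h x"
  shows "k \<in> mhom R M N"
proof -
  interpret M: left_module R M by fact
  show ?thesis
    using assms(1,3) M.smult_closed by (auto simp: mhom_def ahom_def Pi_iff)
qed

text \<open>The right-hand side has the shape of the definitions of \<open>coeff_boundary\<close> and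
  \<open>coeff_chain_map\<close>.\<close>

lemma (in module_family) direct_lift_push:
  assumes L': "module_family R S' L'" and K: "finite K"
    and \<pi>: "\<And>k i. \<lbrakk>k \<in> K; i \<in> S\<rbrakk> \<Longrightarrow> \<pi> k i \<in> S'"
    and \<mu>: "\<And>k i. \<lbrakk>k \<in> K; i \<in> S\<rbrakk> \<Longrightarrow> \<mu> k i \<in> mhom R (L i) (L' (\<pi> k i))"
    and c: "c \<in> carrier (direct_sum S L)"
  shows "direct_lift S L (direct_sum S' L') (\<lambda>i m. \<Oplus>\<^bsub>direct_sum S' L'\<^esub>k\<in>K. direct_single S' L' (\<pi> k i) (\<mu> k i m)) c
    = (\<lambda>\<tau>\<in>S'. finsum (L' \<tau>) (\<lambda>(i, k). \<mu> k i (c i)) {(i, k). i \<in> direct_support S L c \<and> k \<in> K \<and> \<pi> k i = \<tau>})"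
proof
  interpret T: module_family R S' L' by fact
  interpret D: left_module R "direct_sum S' L'" by (rule T.left_module_direct_sum)
  have fin: "finite (direct_support S L c)" and sub: "direct_support S L c \<subseteq> S"
    using c by (auto simp: direct_sum_simps direct_support_def)
  have \<mu>c: "\<mu> k i (c i) \<in> carrier (L' (\<pi> k i))" if "k \<in> K" "i \<in> direct_support S L c" for k i
    using ahom_closed[OF mhom_ahom[OF \<mu>[OF that(1)]], of i "c i"] c that sub by (auto simp: direct_sum_simps)
  have sc: "direct_single S' L' (\<pi> k i) (\<mu> k i (c i)) \<in> carrier (direct_sum S' L')" if "k \<in> K" "i \<in> direct_support S L c" for k i
    using T.direct_single_closed[OF \<pi> \<mu>c] that sub by blast
  have sc': "(\<Oplus>\<^bsub>direct_sum S' L'\<^esub>k\<in>K. direct_single S' L' (\<pi> k i) (\<mu> k i (c i))) \<in> carrier (direct_sum S' L')"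
    if "i \<in> direct_support S L c" for i
    using sc that by (intro D.M.finsum_closed) auto
  fix \<tau>
  let ?A = "{(i, k). i \<in> direct_support S L c \<and> k \<in> K \<and> \<pi> k i = \<tau>}"
  show "direct_lift S L (direct_sum S' L') (\<lambda>i m. \<Oplus>\<^bsub>direct_sum S' L'\<^esub>k\<in>K. direct_single S' L' (\<pi> k i) (\<mu> k i m)) c \<tau>
    = (\<lambda>\<tau>\<in>S'. finsum (L' \<tau>) (\<lambda>(i, k). \<mu> k i (c i)) {(i, k). i \<in> direct_support S L c \<and> k \<in> K \<and> \<pi> k i = \<tau>}) \<tau>"
  proof (cases "\<tau> \<in> S'")
    case True
    interpret L\<tau>: left_module R "L' \<tau>" using T.family[OF True] .
    note ev = ahom_finsum[OF D.M.abelian_group_axioms L\<tau>.M.abelian_group_axioms T.eval_ahom[OF True]]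
    have s\<tau>: "direct_single S' L' (\<pi> k i) (\<mu> k i (c i)) \<tau> = (if \<pi> k i = \<tau> then \<mu> k i (c i) else \<zero>\<^bsub>L' \<tau>\<^esub>)" for k i
      using True by (auto simp: direct_single_def)
    have cl: "(if \<pi> k i = \<tau> then \<mu> k i (c i) else \<zero>\<^bsub>L' \<tau>\<^esub>) \<in> carrier (L' \<tau>)"
      if "k \<in> K" "i \<in> direct_support S L c" for k i
      using \<mu>c[OF that] by auto
    have inner: "(\<Oplus>\<^bsub>direct_sum S' L'\<^esub>k\<in>K. direct_single S' L' (\<pi> k i) (\<mu> k i (c i))) \<tau>
        = (\<Oplus>\<^bsub>L' \<tau>\<^esub>k\<in>K. if \<pi> k i = \<tau> then \<mu> k i (c i) else \<zero>\<^bsub>L' \<tau>\<^esub>)" if "i \<in> direct_support S L c" for i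
      unfolding s\<tau>[symmetric] by (rule ev) (use sc that in auto)
    have "direct_lift S L (direct_sum S' L') (\<lambda>i m. \<Oplus>\<^bsub>direct_sum S' L'\<^esub>k\<in>K. direct_single S' L' (\<pi> k i) (\<mu> k i m)) c \<tau>
        = (\<Oplus>\<^bsub>L' \<tau>\<^esub>i\<in>direct_support S L c. (\<Oplus>\<^bsub>direct_sum S' L'\<^esub>k\<in>K. direct_single S' L' (\<pi> k i) (\<mu> k i (c i))) \<tau>)"
      unfolding direct_lift_def by (rule ev) (use sc' in auto)
    also have "\<dots> = (\<Oplus>\<^bsub>L' \<tau>\<^esub>i\<in>direct_support S L c. \<Oplus>\<^bsub>L' \<tau>\<^esub>k\<in>K. if \<pi> k i = \<tau> then \<mu> k i (c i) else \<zero>\<^bsub>L' \<tau>\<^esub>)"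
      by (rule L\<tau>.M.finsum_cong') (use inner cl in \<open>auto intro!: L\<tau>.M.finsum_closed\<close>)
    also have "\<dots> = finsum (L' \<tau>) (\<lambda>(i, k). if \<pi> k i = \<tau> then \<mu> k i (c i) else \<zero>\<^bsub>L' \<tau>\<^esub>) (direct_support S L c \<times> K)"
      by (rule L\<tau>.M.finsum_Sigma) (use fin K cl in auto)
    also have "\<dots> = finsum (L' \<tau>) (\<lambda>(i, k). \<mu> k i (c i)) ?A"
    proof (rule L\<tau>.M.add.finprod_mono_neutral_cong_right)
      show "(\<lambda>(i, k). if \<pi> k i = \<tau> then \<mu> k i (c i) else \<zero>\<^bsub>L' \<tau>\<^esub>) \<in> direct_support S L c \<times> K \<rightarrow> carrier (L' \<tau>)"
        using cl by auto
    qed (use fin K in \<open>auto split: if_splits\<close>)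
    finally show ?thesis using True by simp
  next
    case False
    have "direct_lift S L (direct_sum S' L') (\<lambda>i m. \<Oplus>\<^bsub>direct_sum S' L'\<^esub>k\<in>K. direct_single S' L' (\<pi> k i) (\<mu> k i m)) c \<in> carrier (direct_sum S' L')"
      unfolding direct_lift_def using sc' by (intro D.M.finsum_closed) auto
    then show ?thesis using False by (auto simp: direct_sum_simps PiE_iff extensional_def)
  qed
qed

lemma lift_module_simps:
  "carrier (lift_module X G d \<sigma>) = {l \<in> extensional (lift_domain X d \<sigma>).
        continuous_map (subtopology (powertop_real UNIV) (lift_domain X d \<sigma>)) (cs_total G) l \<and>
        (\<forall>x \<in> lift_domain X d \<sigma>. cs_proj G (l x) = \<sigma> x)}"
  "\<zero>\<^bsub>lift_module X G d \<sigma>\<^esub> = (\<lambda>x \<in> lift_domain X d \<sigma>. \<zero>\<^bsub>cs_fiber G (\<sigma> x)\<^esub>)"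
  "l \<oplus>\<^bsub>lift_module X G d \<sigma>\<^esub> l' = (\<lambda>x \<in> lift_domain X d \<sigma>. l x \<oplus>\<^bsub>cs_fiber G (\<sigma> x)\<^esub> l' x)"
  "r \<odot>\<^bsub>lift_module X G d \<sigma>\<^esub> l = (\<lambda>x \<in> lift_domain X d \<sigma>. r \<odot>\<^bsub>cs_fiber G (\<sigma> x)\<^esub> l x)"
  by (simp_all add: lift_module_def Let_def)

lemma lift_domainD: "x \<in> lift_domain X d \<sigma> \<Longrightarrow> x \<in> standard_simplex d" "x \<in> lift_domain X d \<sigma> \<Longrightarrow> \<sigma> x \<in> topspace (top_part X)"
  by (auto simp: lift_domain_def)

definition simplex_chain ::
    "'a filtered \<Rightarrow> ('r, 'a, 'e) coeff_system \<Rightarrow> nat \<Rightarrow> ((nat \<Rightarrow> real) \<Rightarrow> 'a) \<Rightarrow> ((nat \<Rightarrow> real) \<Rightarrow> 'e)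
     \<Rightarrow> ('a, 'e) coeff_chain" where
  "simplex_chain X G d = direct_single (singular_simplex_set d (fspace X)) (lift_module X G d)"

lemma chain_module_eq: "coeff_chain_module X G d = direct_sum (singular_simplex_set d (fspace X)) (lift_module X G d)"
  by (simp add: coeff_chain_module_def direct_sum_def coeff_support_def direct_support_def Let_def)

lemma support_eq: "coeff_support X G d c = direct_support (singular_simplex_set d (fspace X)) (lift_module X G d) c"
  by (simp add: coeff_support_def direct_support_def)

locale coeff_space =
  fixes R :: "('r, 'k) ring_scheme" and X :: "'a filtered" and G :: "('r, 'a, 'e) coeff_system"
  assumes filtered: "filtered_space X" and local_sys: "local_system R (top_part X) G"
begin

sublocale coeff_bundle R "top_part X" G
  by unfold_locales (rule local_sys)

abbreviation LM where "LM \<equiv> lift_module X G"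
abbreviation CM where "CM \<equiv> coeff_chain_module X G"

lemma simplex_top_part:
  assumes "singular_simplex d (fspace X) \<sigma>"
  shows "continuous_map (subtopology (powertop_real UNIV) (lift_domain X d \<sigma>)) (top_part X) \<sigma>"
proof -
  have "continuous_map (subtopology (powertop_real UNIV) (lift_domain X d \<sigma>)) (fspace X) \<sigma>"
    by (rule continuous_map_from_subtopology_mono[of _ "standard_simplex d"])
      (use assms in \<open>auto simp: singular_simplex_def lift_domain_def\<close>)
  then show ?thesis
    unfolding top_part_def continuous_map_in_subtopology
    using lift_domainD(2) by (fastforce simp: topspace_top_part)
qed

lemma lift_in_fib:
  assumes "l \<in> carrier (LM d \<sigma>)" "x \<in> lift_domain X d \<sigma>"
  shows "l x \<in> carrier (F (\<sigma> x))"
proof -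
  have "continuous_map (subtopology (powertop_real UNIV) (lift_domain X d \<sigma>)) E l"
    using assms by (simp add: lift_module_simps)
  then have "l x \<in> topspace E"
    using continuous_map_image_subset_topspace assms(2) by fastforce
  then show ?thesis
    using in_fib[of "l x"] assms by (simp add: lift_module_simps)
qed

text \<open>The axioms hold pointwise in the fibres. The local system enters through continuity:
  \<open>section_add\<close>, \<open>section_smult\<close> and \<open>section_zero\<close> show that
  pointwise operations lead to lifts again.\<close>

lemma lift_left_module:
  assumes \<sigma>: "singular_simplex d (fspace X) \<sigma>"
  shows "left_module R (LM d \<sigma>)"
proof -
  let ?D = "lift_domain X d \<sigma>"
  let ?T = "subtopology (powertop_real UNIV) ?D"
  have tT: "topspace ?T = ?D" by simp
  note q = simplex_top_part[OF \<sigma>]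
  have m: "left_module R (F (\<sigma> x))" if "x \<in> ?D" for x
    using fib_module[OF lift_domainD(2)[OF that]] .
  note ag = abelian_group.axioms(1)[OF left_module_abelian_group[OF m]]
  have pr: "proj u = \<sigma> x" if "u \<in> carrier (F (\<sigma> x))" "x \<in> ?D" for u x
    using that fib_carrier[OF lift_domainD(2)] by blast
  note lf = lift_in_fib[of _ d \<sigma>]
  have carr: "(\<lambda>x\<in>?D. s x) \<in> carrier (LM d \<sigma>)" if "continuous_map ?T E s" "\<And>x. x \<in> ?D \<Longrightarrow> s x \<in> carrier (F (\<sigma> x))" for s
  proof -
    have "continuous_map ?T E (\<lambda>x\<in>?D. s x)"
      by (rule continuous_map_eq[OF that(1)]) simp
    then show ?thesis
      using pr that(2) by (auto simp: lift_module_simps)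
  qed
  have lm: "continuous_map ?T E l" "\<And>x. x \<in> ?D \<Longrightarrow> proj (l x) = \<sigma> x" if "l \<in> carrier (LM d \<sigma>)" for l
    using that by (auto simp: lift_module_simps)
  show ?thesis
  proof (rule left_moduleI[OF ring])
    show "\<zero>\<^bsub>LM d \<sigma>\<^esub> \<in> carrier (LM d \<sigma>)"
      unfolding lift_module_simps(2)
      by (rule carr[OF section_zero[OF q]]) (rule abelian_monoid.zero_closed[OF ag])
    show "l \<oplus>\<^bsub>LM d \<sigma>\<^esub> l' \<in> carrier (LM d \<sigma>)"
      if "l \<in> carrier (LM d \<sigma>)" "l' \<in> carrier (LM d \<sigma>)" for l l'
      unfolding lift_module_simps(3)
      by (rule carr[OF section_add[OF q]])
        (use lm[OF that(1)] lm[OF that(2)] lf[OF that(1)] lf[OF that(2)] in \<open>auto intro!: abelian_monoid.a_closed[OF ag]\<close>)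
    show "r \<odot>\<^bsub>LM d \<sigma>\<^esub> l \<in> carrier (LM d \<sigma>)"
      if "r \<in> carrier R" "l \<in> carrier (LM d \<sigma>)" for r l
      unfolding lift_module_simps(4)
      by (rule carr[OF section_smult[OF that(1) q]])
        (use that lm[OF that(2)] lf[OF that(2)] in \<open>auto intro!: left_module.smult_closed[OF m]\<close>)
    show "x \<oplus>\<^bsub>LM d \<sigma>\<^esub> y \<oplus>\<^bsub>LM d \<sigma>\<^esub> z = x \<oplus>\<^bsub>LM d \<sigma>\<^esub> (y \<oplus>\<^bsub>LM d \<sigma>\<^esub> z)"
      if "x \<in> carrier (LM d \<sigma>)" "y \<in> carrier (LM d \<sigma>)" "z \<in> carrier (LM d \<sigma>)" for x y z
      unfolding lift_module_simps(3)
      by (rule restrict_ext) (simp add: abelian_monoid.a_assoc[OF ag] lf that)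
    show "x \<oplus>\<^bsub>LM d \<sigma>\<^esub> y = y \<oplus>\<^bsub>LM d \<sigma>\<^esub> x"
      if "x \<in> carrier (LM d \<sigma>)" "y \<in> carrier (LM d \<sigma>)" for x y
      unfolding lift_module_simps(3)
      by (rule restrict_ext) (simp add: abelian_monoid.a_comm[OF ag] lf that)
    show "\<zero>\<^bsub>LM d \<sigma>\<^esub> \<oplus>\<^bsub>LM d \<sigma>\<^esub> x = x" if "x \<in> carrier (LM d \<sigma>)" for x
    proof
      fix y show "(\<zero>\<^bsub>LM d \<sigma>\<^esub> \<oplus>\<^bsub>LM d \<sigma>\<^esub> x) y = x y"
        using that abelian_monoid.l_zero[OF ag[of y] lf[OF that, of y]]
        by (cases "y \<in> ?D") (auto simp: lift_module_simps extensional_def)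
    qed
    show "(a \<oplus>\<^bsub>R\<^esub> b) \<odot>\<^bsub>LM d \<sigma>\<^esub> x = a \<odot>\<^bsub>LM d \<sigma>\<^esub> x \<oplus>\<^bsub>LM d \<sigma>\<^esub> b \<odot>\<^bsub>LM d \<sigma>\<^esub> x"
      if "a \<in> carrier R" "b \<in> carrier R" "x \<in> carrier (LM d \<sigma>)" for a b x
      unfolding lift_module_simps(3,4)
      by (rule restrict_ext) (simp add: left_module.smult_l_distr[OF m] lf that)
    show "a \<odot>\<^bsub>LM d \<sigma>\<^esub> (x \<oplus>\<^bsub>LM d \<sigma>\<^esub> y) = a \<odot>\<^bsub>LM d \<sigma>\<^esub> x \<oplus>\<^bsub>LM d \<sigma>\<^esub> a \<odot>\<^bsub>LM d \<sigma>\<^esub> y"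
      if "a \<in> carrier R" "x \<in> carrier (LM d \<sigma>)" "y \<in> carrier (LM d \<sigma>)" for a x y
      unfolding lift_module_simps(3,4)
      by (rule restrict_ext) (simp add: left_module.smult_r_distr[OF m] lf that)
    show "(a \<otimes>\<^bsub>R\<^esub> b) \<odot>\<^bsub>LM d \<sigma>\<^esub> x = a \<odot>\<^bsub>LM d \<sigma>\<^esub> (b \<odot>\<^bsub>LM d \<sigma>\<^esub> x)"
      if "a \<in> carrier R" "b \<in> carrier R" "x \<in> carrier (LM d \<sigma>)" for a b x
      unfolding lift_module_simps(4)
      by (rule restrict_ext) (simp add: left_module.smult_assoc[OF m] lf that)
    show "\<one>\<^bsub>R\<^esub> \<odot>\<^bsub>LM d \<sigma>\<^esub> x = x" if "x \<in> carrier (LM d \<sigma>)" for x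
    proof
      fix y show "(\<one>\<^bsub>R\<^esub> \<odot>\<^bsub>LM d \<sigma>\<^esub> x) y = x y"
        using that left_module.smult_one[OF m[of y] lf[OF that, of y]]
        by (cases "y \<in> ?D") (auto simp: lift_module_simps extensional_def)
    qed
    show "\<zero>\<^bsub>R\<^esub> \<odot>\<^bsub>LM d \<sigma>\<^esub> x = \<zero>\<^bsub>LM d \<sigma>\<^esub>" if "x \<in> carrier (LM d \<sigma>)" for x
      unfolding lift_module_simps(2,4)
      by (rule restrict_ext) (simp add: left_module.zero_smult[OF m] lf that)
  qed
qed

lemma lift_family: "module_family R (singular_simplex_set d (fspace X)) (LM d)"
  by (rule module_family.intro) (use ring lift_left_module in auto)

lemma chain_left_module: "left_module R (CM d)"
  unfolding chain_module_eq by (rule module_family.left_module_direct_sum[OF lift_family])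

lemma simplex_chain_mhom: "singular_simplex d (fspace X) \<sigma> \<Longrightarrow> simplex_chain X G d \<sigma> \<in> mhom R (LM d \<sigma>) (CM d)"
  unfolding chain_module_eq simplex_chain_def by (rule module_family.direct_single_mhom[OF lift_family]) simp

lemma simplex_chain_closed:
  "\<lbrakk>singular_simplex d (fspace X) \<sigma>; l \<in> carrier (LM d \<sigma>)\<rbrakk> \<Longrightarrow> simplex_chain X G d \<sigma> l \<in> carrier (CM d)"
  using ahom_closed[OF mhom_ahom[OF simplex_chain_mhom]] .

lemma chain_ext:
  assumes "abelian_group N" "h \<in> ahom (CM d) N" "k \<in> ahom (CM d) N"
    and "\<And>\<sigma> l. \<lbrakk>singular_simplex d (fspace X) \<sigma>; l \<in> carrier (LM d \<sigma>)\<rbrakk> \<Longrightarrow>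
      h (simplex_chain X G d \<sigma> l) = k (simplex_chain X G d \<sigma> l)"
    and "c \<in> carrier (CM d)"
  shows "h c = k c"
  using module_family.direct_sum_ext[OF lift_family assms(1), of h d k c] assms
  unfolding chain_module_eq simplex_chain_def by simp

definition chain_lift where
  "chain_lift d = direct_lift (singular_simplex_set d (fspace X)) (LM d)"

lemma chain_lift_mhom:
  assumes "left_module R N" "\<And>\<sigma>. singular_simplex d (fspace X) \<sigma> \<Longrightarrow> \<theta> \<sigma> \<in> mhom R (LM d \<sigma>) N"
  shows "chain_lift d N \<theta> \<in> mhom R (CM d) N"
  unfolding chain_module_eq chain_lift_def
  by (rule module_family.direct_lift_mhom[OF lift_family assms(1)]) (simp add: assms(2))

lemma chain_lift_simplex_chain:
  assumes "left_module R N" "\<And>\<sigma>. singular_simplex d (fspace X) \<sigma> \<Longrightarrow> \<theta> \<sigma> \<in> mhom R (LM d \<sigma>) N"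
    "singular_simplex d (fspace X) \<sigma>" "l \<in> carrier (LM d \<sigma>)"
  shows "chain_lift d N \<theta> (simplex_chain X G d \<sigma> l) = \<theta> \<sigma> l"
  unfolding simplex_chain_def chain_lift_def
  by (rule module_family.direct_lift_direct_single[OF lift_family left_module_abelian_group[OF assms(1)]])
    (use assms(3,4) mhom_ahom[OF assms(2)] in auto)

text \<open>Only simplices in the support of \<open>c\<close> are tested, which is the form that
  carries allowability from a chain to its image.\<close>

lemma chain_lift_mem:
  assumes "left_module R N" "submod R N V" "c \<in> carrier (CM d)"
    "\<And>\<sigma> l. \<lbrakk>\<sigma> \<in> coeff_support X G d c; singular_simplex d (fspace X) \<sigma>; l \<in> carrier (LM d \<sigma>)\<rbrakk> \<Longrightarrow> \<theta> \<sigma> l \<in> V"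
  shows "chain_lift d N \<theta> c \<in> V"
  unfolding chain_lift_def direct_lift_def
  by (rule submod_finsum[OF assms(1,2)])
    (use assms(3,4) in \<open>auto simp: chain_module_eq direct_sum_simps support_eq direct_support_def\<close>)

end

text \<open>Faces, images under maps and the pieces of a prism are all obtained from \<open>\<sigma>\<close> by a
  reparametrization \<open>a\<close> into \<open>\<Delta> \<times> I\<close> followed by a homotopy \<open>K\<close>, covered by \<open>H\<close> on coefficients.\<close>

definition cell ::
    "nat \<Rightarrow> ('b \<times> real \<Rightarrow> 'a) \<Rightarrow> ((nat \<Rightarrow> real) \<Rightarrow> (nat \<Rightarrow> real) \<times> real) \<Rightarrow> ((nat \<Rightarrow> real) \<Rightarrow> 'b)
     \<Rightarrow> (nat \<Rightarrow> real) \<Rightarrow> 'a" where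
  "cell q K a \<sigma> = (\<lambda>x \<in> standard_simplex q. K (\<sigma> (fst (a x)), snd (a x)))"

definition cell_lift ::
    "'a filtered \<Rightarrow> nat \<Rightarrow> ('b \<times> real \<Rightarrow> 'a) \<Rightarrow> ('d \<times> real \<Rightarrow> 'e)
     \<Rightarrow> ((nat \<Rightarrow> real) \<Rightarrow> (nat \<Rightarrow> real) \<times> real) \<Rightarrow> ((nat \<Rightarrow> real) \<Rightarrow> 'b) \<Rightarrow> ((nat \<Rightarrow> real) \<Rightarrow> 'd)
     \<Rightarrow> (nat \<Rightarrow> real) \<Rightarrow> 'e" where
  "cell_lift X q K H a \<sigma> l = (\<lambda>x \<in> lift_domain X q (cell q K a \<sigma>). H (l (fst (a x)), snd (a x)))"

text \<open>Strata are matched by index at every time, so that a simplex and its images along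
  \<open>K\<close> carry coefficients over corresponding points. On the coefficients
  \<open>H\<close> is linear on each fibre, which makes the induced maps of lifts linear.\<close>

locale coeff_homotopy = Y: coeff_space R Y G' + X: coeff_space R X G
  for R :: "('r, 'k) ring_scheme" and Y :: "'b filtered" and G' :: "('r, 'b, 'd) coeff_system"
    and X :: "'a filtered" and G :: "('r, 'a, 'e) coeff_system" +
  fixes K :: "'b \<times> real \<Rightarrow> 'a" and H :: "'d \<times> real \<Rightarrow> 'e"
  assumes dims: "sdim X = sdim Y"
    and K_cont: "continuous_map (prod_topology (fspace Y) unit_interval) (fspace X) K"
    and K_stratum: "\<lbrakk>y \<in> stratum Y i; t \<in> {0..1}\<rbrakk> \<Longrightarrow> K (y, t) \<in> stratum X i"
    and H_cont: "continuous_map (prod_topology (cs_total G') unit_interval) (cs_total G) H"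
    and H_lin: "\<lbrakk>y \<in> topspace (top_part Y); t \<in> {0..1}\<rbrakk> \<Longrightarrow>
      (\<lambda>u. H (u, t)) \<in> mhom R (cs_fiber G' y) (cs_fiber G (K (y, t)))"
begin

text \<open>Preserving strata implies reflecting them: the strata cover \<open>Y\<close>, and those
  of \<open>X\<close> are disjoint.\<close>

lemma K_stratum_iff:
  assumes "y \<in> topspace (fspace Y)" "t \<in> {0..1}"
  shows "K (y, t) \<in> stratum X i \<longleftrightarrow> y \<in> stratum Y i"
proof -
  obtain j where "y \<in> stratum Y j" using ex_stratum[OF Y.filtered assms(1)] .
  then show ?thesis
    using K_stratum[OF _ assms(2)] stratum_unique[OF X.filtered] by metis
qed

lemma K_top_iff:
  assumes "y \<in> topspace (fspace Y)" "t \<in> {0..1}"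
  shows "K (y, t) \<in> topspace (top_part X) \<longleftrightarrow> y \<in> topspace (top_part Y)"
proof -
  obtain j where j: "y \<in> stratum Y j" using ex_stratum[OF Y.filtered assms(1)] .
  show ?thesis
    using stratum_top_part[OF Y.filtered j] stratum_top_part[OF X.filtered K_stratum[OF j assms(2)]]
      dims by simp
qed

context
  fixes q d a \<sigma>
  assumes a: "continuous_map (simplex_top q) (prod_topology (simplex_top d) unit_interval) a"
    and \<sigma>: "singular_simplex d (fspace Y) \<sigma>"
begin

lemma a_in: "x \<in> standard_simplex q \<Longrightarrow> fst (a x) \<in> standard_simplex d"
  "x \<in> standard_simplex q \<Longrightarrow> snd (a x) \<in> {0..1}"
proof -
  have "a ` standard_simplex q \<subseteq> standard_simplex d \<times> {0..1}"
    using continuous_map_image_subset_topspace[OF a] by simp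
  then show "x \<in> standard_simplex q \<Longrightarrow> fst (a x) \<in> standard_simplex d"
    "x \<in> standard_simplex q \<Longrightarrow> snd (a x) \<in> {0..1}"
    by (auto simp: image_subset_iff mem_Times_iff)
qed

lemma \<sigma>_in: "x \<in> standard_simplex d \<Longrightarrow> \<sigma> x \<in> topspace (fspace Y)"
proof -
  have "continuous_map (simplex_top d) (fspace Y) \<sigma>" using \<sigma> by (simp add: singular_simplex_def)
  then show "x \<in> standard_simplex d \<Longrightarrow> \<sigma> x \<in> topspace (fspace Y)"
    using continuous_map_image_subset_topspace by fastforce
qed

lemma cell_simplex: "singular_simplex q (fspace X) (cell q K a \<sigma>)"
  unfolding singular_simplex_def
proof
  have s: "continuous_map (simplex_top d) (fspace Y) \<sigma>" using \<sigma> by (simp add: singular_simplex_def)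
  have f: "continuous_map (simplex_top q) (simplex_top d) (\<lambda>x. fst (a x))"
    and g: "continuous_map (simplex_top q) unit_interval (\<lambda>x. snd (a x))"
    using a by (auto simp: continuous_map_pairwise o_def)
  have "continuous_map (simplex_top q) (fspace X) (\<lambda>x. K (\<sigma> (fst (a x)), snd (a x)))"
    by (rule continuous_map_comp[OF K_cont continuous_map_pairedI[OF continuous_map_comp[OF s f] g]])
  then show "continuous_map (simplex_top q) (fspace X) (cell q K a \<sigma>)"
    by (rule continuous_map_eq) (simp add: cell_def)
qed (simp add: cell_def)

text \<open>Because the top part is reflected, the new lift is required precisely at the points
  where the given lift has a value to be transported.\<close>

lemma cell_domain: "lift_domain X q (cell q K a \<sigma>) = {x \<in> standard_simplex q. fst (a x) \<in> lift_domain Y d \<sigma>}"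
  using K_top_iff[OF \<sigma>_in] a_in by (auto simp: lift_domain_def cell_def)

lemma cell_lift_mhom: "cell_lift X q K H a \<sigma> \<in> mhom R (Y.LM d \<sigma>) (X.LM q (cell q K a \<sigma>))"
proof -
  let ?D = "lift_domain Y d \<sigma>" and ?D' = "lift_domain X q (cell q K a \<sigma>)"
  have dom: "x \<in> standard_simplex q" "fst (a x) \<in> ?D" "\<sigma> (fst (a x)) \<in> topspace (top_part Y)" "snd (a x) \<in> {0..1}"
    if "x \<in> ?D'" for x
    using that a_in lift_domainD by (auto simp: cell_domain)
  have cv: "cell q K a \<sigma> x = K (\<sigma> (fst (a x)), snd (a x))" if "x \<in> ?D'" for x
    using dom(1)[OF that] by (simp add: cell_def)
  have mem: "H (l (fst (a x)), snd (a x)) \<in> carrier (X.F (cell q K a \<sigma> x))"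
    if "l \<in> carrier (Y.LM d \<sigma>)" "x \<in> ?D'" for l x
    unfolding cv[OF that(2)]
    using ahom_closed[OF mhom_ahom[OF H_lin[OF dom(3,4)]] Y.lift_in_fib[OF that(1) dom(2)]] that(2) by blast
  have top: "cell q K a \<sigma> x \<in> topspace (top_part X)" if "x \<in> ?D'" for x
    using lift_domainD(2)[OF that] .
  have "cell_lift X q K H a \<sigma> l \<in> carrier (X.LM q (cell q K a \<sigma>))" if l: "l \<in> carrier (Y.LM d \<sigma>)" for l
  proof -
    let ?T = "subtopology (powertop_real UNIV) ?D'"
    have lc: "continuous_map (subtopology (powertop_real UNIV) ?D) Y.E l"
      using l by (simp add: lift_module_simps)
    have f: "continuous_map (simplex_top q) (powertop_real UNIV) (\<lambda>x. fst (a x))"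
      and g: "continuous_map (simplex_top q) unit_interval (\<lambda>x. snd (a x))"
      using a by (auto simp: continuous_map_pairwise o_def continuous_map_in_subtopology)
    have sub: "?D' \<subseteq> standard_simplex q" using dom(1) by blast
    have f': "continuous_map ?T (subtopology (powertop_real UNIV) ?D) (\<lambda>x. fst (a x))"
      unfolding continuous_map_in_subtopology
      using continuous_map_from_subtopology_mono[OF f sub] dom(2) by auto
    have g': "continuous_map ?T unit_interval (\<lambda>x. snd (a x))"
      by (rule continuous_map_from_subtopology_mono[OF g sub])
    have "continuous_map ?T X.E (\<lambda>x. H (l (fst (a x)), snd (a x)))"
      by (rule continuous_map_comp[OF H_cont continuous_map_pairedI[OF continuous_map_comp[OF lc f'] g']])
    then have "continuous_map ?T X.E (cell_lift X q K H a \<sigma> l)"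
      by (rule continuous_map_eq) (simp add: cell_lift_def)
    moreover have "X.proj (H (l (fst (a x)), snd (a x))) = cell q K a \<sigma> x" if "x \<in> ?D'" for x
      using mem[OF l that] X.fib_carrier[OF top[OF that]] by simp
    ultimately show ?thesis
      by (auto simp: lift_module_simps cell_lift_def)
  qed
  moreover have "cell_lift X q K H a \<sigma> (l \<oplus>\<^bsub>Y.LM d \<sigma>\<^esub> l')
      = cell_lift X q K H a \<sigma> l \<oplus>\<^bsub>X.LM q (cell q K a \<sigma>)\<^esub> cell_lift X q K H a \<sigma> l'"
    if "l \<in> carrier (Y.LM d \<sigma>)" "l' \<in> carrier (Y.LM d \<sigma>)" for l l'
    unfolding cell_lift_def lift_module_simps(3)
  proof (rule restrict_ext)
    fix x assume x: "x \<in> ?D'"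
    show "H ((\<lambda>x\<in>?D. l x \<oplus>\<^bsub>Y.F (\<sigma> x)\<^esub> l' x) (fst (a x)), snd (a x))
        = (\<lambda>x\<in>?D'. H (l (fst (a x)), snd (a x))) x \<oplus>\<^bsub>X.F (cell q K a \<sigma> x)\<^esub> (\<lambda>x\<in>?D'. H (l' (fst (a x)), snd (a x))) x"
      using ahom_add[OF mhom_ahom[OF H_lin[OF dom(3,4)]] Y.lift_in_fib[OF that(1) dom(2)] Y.lift_in_fib[OF that(2) dom(2)]] x
        dom(2)[OF x] by (simp add: cv)
  qed
  moreover have "cell_lift X q K H a \<sigma> (r \<odot>\<^bsub>Y.LM d \<sigma>\<^esub> l)
      = r \<odot>\<^bsub>X.LM q (cell q K a \<sigma>)\<^esub> cell_lift X q K H a \<sigma> l"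
    if "r \<in> carrier R" "l \<in> carrier (Y.LM d \<sigma>)" for r l
    unfolding cell_lift_def lift_module_simps(4)
  proof (rule restrict_ext)
    fix x assume x: "x \<in> ?D'"
    show "H ((\<lambda>x\<in>?D. r \<odot>\<^bsub>Y.F (\<sigma> x)\<^esub> l x) (fst (a x)), snd (a x))
        = r \<odot>\<^bsub>X.F (cell q K a \<sigma> x)\<^esub> (\<lambda>x\<in>?D'. H (l (fst (a x)), snd (a x))) x"
      using mhom_smult[OF H_lin[OF dom(3,4)] that(1) Y.lift_in_fib[OF that(2) dom(2)]] x
        dom(2)[OF x] by (simp add: cv)
  qed
  ultimately show ?thesis
    unfolding mhom_def ahom_def by auto
qed

end


end

section \<open>The boundary\<close>

context coeff_space
begin

text \<open>Turns the facets of a simplex into instances of \<open>cell\<close>, at constant height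
  0, so that restricting a lift to a facet inherits linearity from
  \<open>cell_lift_mhom\<close>.\<close>

lemma constant_homotopy: "coeff_homotopy R X G X G fst fst"
proof (intro coeff_homotopy.intro coeff_homotopy_axioms.intro coeff_space_axioms)
  show "continuous_map (prod_topology (fspace X) unit_interval) (fspace X) fst"
    "continuous_map (prod_topology E unit_interval) E fst"
    by (rule continuous_map_fst)+
  show "(\<lambda>u. fst (u, t)) \<in> mhom R (F y) (F (fst (y, t)))" for y and t :: real
    by (simp add: mhom_def ahom_def)
qed auto

definition face_lift ::
    "nat \<Rightarrow> nat \<Rightarrow> ((nat \<Rightarrow> real) \<Rightarrow> 'a) \<Rightarrow> ((nat \<Rightarrow> real) \<Rightarrow> 'e) \<Rightarrow> (nat \<Rightarrow> real) \<Rightarrow> 'e" where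
  "face_lift d k \<sigma> l = restrict (l \<circ> simplical_face k) (lift_domain X d (singular_face (Suc d) k \<sigma>))"

lemma face_point: "k \<le> Suc d \<Longrightarrow>
    continuous_map (simplex_top d) (prod_topology (simplex_top (Suc d)) unit_interval) (\<lambda>x. (simplical_face k x, 0))"
  by (intro continuous_map_pairedI continuous_map_simplical_face) simp_all

lemma face_cell: "cell d fst (\<lambda>x. (simplical_face k x, 0)) \<sigma> = singular_face (Suc d) k \<sigma>"
  by (simp add: cell_def singular_face_def o_def)

lemma face_simplex: "\<lbrakk>singular_simplex (Suc d) (fspace X) \<sigma>; k \<le> Suc d\<rbrakk> \<Longrightarrow>
    singular_simplex d (fspace X) (singular_face (Suc d) k \<sigma>)"
  using singular_simplex_singular_face[of "Suc d" "fspace X" \<sigma> k] by simp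

lemma face_lift_mhom:
  assumes "singular_simplex (Suc d) (fspace X) \<sigma>" "k \<le> Suc d"
  shows "face_lift d k \<sigma> \<in> mhom R (LM (Suc d) \<sigma>) (LM d (singular_face (Suc d) k \<sigma>))"
proof -
  have "cell_lift X d fst fst (\<lambda>x. (simplical_face k x, 0)) \<sigma> = face_lift d k \<sigma>"
    by (auto simp: cell_lift_def face_lift_def face_cell fun_eq_iff)
  then show ?thesis
    using coeff_homotopy.cell_lift_mhom[OF constant_homotopy face_point[OF assms(2)] assms(1)]
    by (simp add: face_cell)
qed

lemma face_domain:
  assumes "singular_simplex (Suc d) (fspace X) \<sigma>" "k \<le> Suc d"
  shows "lift_domain X d (singular_face (Suc d) k \<sigma>)
    = {x \<in> standard_simplex d. simplical_face k x \<in> lift_domain X (Suc d) \<sigma>}"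
  using coeff_homotopy.cell_domain[OF constant_homotopy face_point[OF assms(2)] assms(1)]
  by (simp add: face_cell)

lemma simplex_chain_alternate:
  assumes "singular_simplex d (fspace X) \<sigma>" "l \<in> carrier (LM d \<sigma>)"
  shows "simplex_chain X G d \<sigma> (alternate (LM d \<sigma>) k l) = alternate (CM d) k (simplex_chain X G d \<sigma> l)"
  by (rule ahom_alternate[OF lift_left_module chain_left_module mhom_ahom[OF simplex_chain_mhom]])
    (use assms in auto)

definition faces where
  "faces d \<sigma> l = (\<Oplus>\<^bsub>CM d\<^esub>k\<in>{..Suc d}. alternate (CM d) k
     (simplex_chain X G d (singular_face (Suc d) k \<sigma>) (face_lift d k \<sigma> l)))"

lemma faces_mhom:
  assumes "singular_simplex (Suc d) (fspace X) \<sigma>"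
  shows "faces d \<sigma> \<in> mhom R (LM (Suc d) \<sigma>) (CM d)"
  unfolding faces_def
  by (rule mhom_finsum_fun[OF chain_left_module], rule alternate_mhom[OF chain_left_module],
      rule mhom_comp[OF face_lift_mhom simplex_chain_mhom[OF face_simplex]]) (use assms in auto)

text \<open>\<open>coeff_boundary\<close> collects contributions by the face they land on,
  \<open>chain_lift\<close> sums them by the simplex they come from. Reordering a finite double sum,
  done in \<open>direct_lift_push\<close>, identifies the two; the second form is visibly linear and
  easy to evaluate on one simplex.\<close>

lemma boundary_eq:
  assumes c: "c \<in> carrier (CM (Suc d))"
  shows "coeff_boundary X G (Suc d) c = chain_lift (Suc d) (CM d) (faces d) c"
proof -
  let ?S = "singular_simplex_set (Suc d) (fspace X)" and ?S' = "singular_simplex_set d (fspace X)"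
  let ?\<pi> = "\<lambda>k \<sigma>. singular_face (Suc d) k \<sigma>"
  let ?\<mu> = "\<lambda>k \<sigma> l. alternate (LM d (?\<pi> k \<sigma>)) k (face_lift d k \<sigma> l)"
  \<comment> \<open>The summand as it stands in \<open>coeff_boundary\<close>, over a fixed
    \<open>\<tau>\<close>. It coincides with \<open>?\<mu>\<close> on the pairs whose
    \<open>k\<close>-th face is \<open>\<tau>\<close>.\<close>
  let ?r = "\<lambda>\<tau> \<sigma> k. if even k then restrict (c \<sigma> \<circ> simplical_face k) (lift_domain X d \<tau>)
      else \<ominus>\<^bsub>LM d \<tau>\<^esub> restrict (c \<sigma> \<circ> simplical_face k) (lift_domain X d \<tau>)"
  have \<mu>: "?\<mu> k \<sigma> \<in> mhom R (LM (Suc d) \<sigma>) (LM d (?\<pi> k \<sigma>))" if "k \<in> {..Suc d}" "\<sigma> \<in> ?S" for k \<sigma>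
    by (rule alternate_mhom[OF lift_left_module[OF face_simplex] face_lift_mhom]) (use that in auto)
  have cS: "c \<sigma> \<in> carrier (LM (Suc d) \<sigma>)" if "\<sigma> \<in> ?S" for \<sigma>
    using c that by (auto simp: chain_module_eq direct_sum_simps)
  have "chain_lift (Suc d) (CM d) (faces d) c
      = direct_lift ?S (LM (Suc d)) (direct_sum ?S' (LM d)) (\<lambda>\<sigma> l. \<Oplus>\<^bsub>direct_sum ?S' (LM d)\<^esub>k\<in>{..Suc d}. direct_single ?S' (LM d) (?\<pi> k \<sigma>) (?\<mu> k \<sigma> l)) c"
    unfolding chain_lift_def direct_lift_def chain_module_eq[symmetric] faces_def
  proof (rule abelian_monoid.finsum_cong')
    show "abelian_monoid (CM d)"
      using left_module_abelian_group[OF chain_left_module] by (rule abelian_group.axioms)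
    fix \<sigma> assume "\<sigma> \<in> direct_support ?S (LM (Suc d)) c"
    then have \<sigma>: "\<sigma> \<in> ?S" by (simp add: direct_support_def)
    interpret C: left_module R "CM d" by (rule chain_left_module)
    have fl: "face_lift d k \<sigma> (c \<sigma>) \<in> carrier (LM d (?\<pi> k \<sigma>))" if "k \<le> Suc d" for k
      using ahom_closed[OF mhom_ahom[OF face_lift_mhom] cS[OF \<sigma>]] \<sigma> that by blast
    show "(\<Oplus>\<^bsub>CM d\<^esub>k\<in>{..Suc d}. alternate (CM d) k (simplex_chain X G d (?\<pi> k \<sigma>) (face_lift d k \<sigma> (c \<sigma>))))
      = (\<Oplus>\<^bsub>CM d\<^esub>k\<in>{..Suc d}. direct_single ?S' (LM d) (?\<pi> k \<sigma>) (?\<mu> k \<sigma> (c \<sigma>)))"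
    proof (rule C.M.finsum_cong'[OF refl])
      show "(\<lambda>k. direct_single ?S' (LM d) (?\<pi> k \<sigma>) (?\<mu> k \<sigma> (c \<sigma>))) \<in> {..Suc d} \<rightarrow> carrier (CM d)"
        unfolding simplex_chain_def[symmetric] using \<sigma> fl
        by (auto intro!: simplex_chain_closed face_simplex alternate_closed[OF lift_left_module])
      show "alternate (CM d) k (simplex_chain X G d (?\<pi> k \<sigma>) (face_lift d k \<sigma> (c \<sigma>)))
        = direct_single ?S' (LM d) (?\<pi> k \<sigma>) (?\<mu> k \<sigma> (c \<sigma>))" if "k \<in> {..Suc d}" for k
        unfolding simplex_chain_def[symmetric]
        by (rule simplex_chain_alternate[symmetric]) (use \<sigma> fl that face_simplex in auto)
    qed
  next
    show "(\<lambda>\<sigma>. \<Oplus>\<^bsub>CM d\<^esub>k\<in>{..Suc d}. direct_single ?S' (LM d) (?\<pi> k \<sigma>) (?\<mu> k \<sigma> (c \<sigma>)))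
        \<in> direct_support ?S (LM (Suc d)) c \<rightarrow> carrier (CM d)"
    proof
      fix \<sigma> assume "\<sigma> \<in> direct_support ?S (LM (Suc d)) c"
      then have \<sigma>: "\<sigma> \<in> ?S" by (simp add: direct_support_def)
      interpret C: left_module R "CM d" by (rule chain_left_module)
      show "(\<Oplus>\<^bsub>CM d\<^esub>k\<in>{..Suc d}. direct_single ?S' (LM d) (?\<pi> k \<sigma>) (?\<mu> k \<sigma> (c \<sigma>))) \<in> carrier (CM d)"
        unfolding simplex_chain_def[symmetric]
      proof (rule C.M.finsum_closed, rule, rule simplex_chain_closed)
        fix k assume k: "k \<in> {..Suc d}"
        show "singular_simplex d (fspace X) (?\<pi> k \<sigma>)" using \<sigma> k face_simplex by auto
        show "?\<mu> k \<sigma> (c \<sigma>) \<in> carrier (LM d (?\<pi> k \<sigma>))"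
          using ahom_closed[OF mhom_ahom[OF \<mu>[OF k \<sigma>]] cS[OF \<sigma>]] .
      qed
    qed
  qed simp
  also have "\<dots> = (\<lambda>\<tau>\<in>?S'. finsum (LM d \<tau>) (\<lambda>(\<sigma>, k). ?\<mu> k \<sigma> (c \<sigma>))
      {(\<sigma>, k). \<sigma> \<in> direct_support ?S (LM (Suc d)) c \<and> k \<in> {..Suc d} \<and> ?\<pi> k \<sigma> = \<tau>})"
    by (rule module_family.direct_lift_push[OF lift_family lift_family])
      (use \<mu> face_simplex c chain_module_eq[of X G "Suc d"] in auto)
  also have "\<dots> = (\<lambda>\<tau>\<in>?S'. finsum (LM d \<tau>) (\<lambda>(\<sigma>, k). ?r \<tau> \<sigma> k)
      {(\<sigma>, k). \<sigma> \<in> direct_support ?S (LM (Suc d)) c \<and> k \<in> {..Suc d} \<and> ?\<pi> k \<sigma> = \<tau>})"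
  proof (rule restrict_ext)
    fix \<tau> assume \<tau>: "\<tau> \<in> ?S'"
    interpret L: left_module R "LM d \<tau>" using lift_left_module \<tau> by simp
    let ?A = "{(\<sigma>, k). \<sigma> \<in> direct_support ?S (LM (Suc d)) c \<and> k \<in> {..Suc d} \<and> ?\<pi> k \<sigma> = \<tau>}"
    show "finsum (LM d \<tau>) (\<lambda>(\<sigma>, k). ?\<mu> k \<sigma> (c \<sigma>)) ?A
      = finsum (LM d \<tau>) (\<lambda>(\<sigma>, k). ?r \<tau> \<sigma> k) ?A"
    proof (rule L.M.finsum_cong'[OF refl])
      have eq: "?\<mu> k \<sigma> (c \<sigma>) = ?r \<tau> \<sigma> k" if "(\<sigma>, k) \<in> ?A" for \<sigma> k
        using that by (auto simp: face_lift_def alternate_def)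
      then show "(\<lambda>(\<sigma>, k). ?\<mu> k \<sigma> (c \<sigma>)) x = (\<lambda>(\<sigma>, k). ?r \<tau> \<sigma> k) x" if "x \<in> ?A" for x
        using that by (cases x) auto
      show "(\<lambda>(\<sigma>, k). ?r \<tau> \<sigma> k) \<in> ?A \<rightarrow> carrier (LM d \<tau>)"
      proof
        fix x assume x: "x \<in> ?A"
        obtain \<sigma> k where x': "x = (\<sigma>, k)" by (cases x)
        have "\<sigma> \<in> ?S" "k \<in> {..Suc d}" "?\<pi> k \<sigma> = \<tau>"
          using x x' by (auto simp: direct_support_def)
        then have "?\<mu> k \<sigma> (c \<sigma>) \<in> carrier (LM d \<tau>)"
          using ahom_closed[OF mhom_ahom[OF \<mu>] cS] by metis
        then show "(case x of (\<sigma>, k) \<Rightarrow> ?r \<tau> \<sigma> k) \<in> carrier (LM d \<tau>)"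
          using eq[of \<sigma> k] x x' by simp
      qed
    qed
  qed
  also have "\<dots> = coeff_boundary X G (Suc d) c"
    by (simp add: coeff_boundary_def Let_def support_eq)
  finally show ?thesis by simp
qed

lemma boundary_mhom: "coeff_boundary X G d \<in> mhom R (CM d) (CM (d - 1))"
proof (cases d)
  case 0
  interpret C: left_module R "CM 0" by (rule chain_left_module)
  show ?thesis
    using ahom_zero[OF C.M.abelian_group_axioms C.M.abelian_group_axioms C.smult_ahom]
    by (auto simp: 0 mhom_def ahom_def coeff_boundary_def)
next
  case (Suc e)
  have "coeff_boundary X G (Suc e) \<in> mhom R (CM (Suc e)) (CM e)"
    by (rule mhom_cong[OF chain_lift_mhom[OF chain_left_module faces_mhom] chain_left_module])
      (simp_all add: boundary_eq)
  then show ?thesis by (simp add: Suc)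
qed

lemma boundary_simplex_chain:
  assumes "singular_simplex (Suc d) (fspace X) \<sigma>" "l \<in> carrier (LM (Suc d) \<sigma>)"
  shows "coeff_boundary X G (Suc d) (simplex_chain X G (Suc d) \<sigma> l) = faces d \<sigma> l"
  by (simp add: boundary_eq simplex_chain_closed assms chain_lift_simplex_chain[OF chain_left_module faces_mhom])

end

section \<open>The chain map of a bundle map\<close>

locale coeff_map = Y: coeff_space R Y G' + X: coeff_space R X G
  for R :: "('r, 'k) ring_scheme" and Y :: "'b filtered" and G' :: "('r, 'b, 'd) coeff_system"
    and X :: "'a filtered" and G :: "('r, 'a, 'e) coeff_system" +
  fixes g :: "'b \<Rightarrow> 'a" and h :: "'d \<Rightarrow> 'e"
  assumes dims: "sdim X = sdim Y"
    and g_cont: "continuous_map (fspace Y) (fspace X) g"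
    and g_stratum: "y \<in> stratum Y i \<Longrightarrow> g y \<in> stratum X i"
    and h_cont: "continuous_map (cs_total G') (cs_total G) h"
    and h_lin: "y \<in> topspace (top_part Y) \<Longrightarrow> h \<in> mhom R (cs_fiber G' y) (cs_fiber G (g y))"
begin

text \<open>A bundle map is treated as a constant homotopy, so that images of simplices are again
  cells.\<close>

sublocale coeff_homotopy R Y G' X G "\<lambda>z. g (fst z)" "\<lambda>z. h (fst z)"
proof
  show "continuous_map (prod_topology (fspace Y) unit_interval) (fspace X) (\<lambda>z. g (fst z))"
    by (rule continuous_map_comp[OF g_cont continuous_map_fst])
  show "continuous_map (prod_topology Y.E unit_interval) X.E (\<lambda>z. h (fst z))"
    by (rule continuous_map_comp[OF h_cont continuous_map_fst])
qed (use dims g_stratum h_lin in auto)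

definition push_lift where
  "push_lift d \<sigma> l = restrict (h \<circ> l) (lift_domain X d (simplex_map d g \<sigma>))"

lemma simplex_point:
  "continuous_map (simplex_top d) (prod_topology (simplex_top d) unit_interval) (\<lambda>x. (x, 0))"
  by (intro continuous_map_pairedI) auto

lemma push_cell: "cell d (\<lambda>z. g (fst z)) (\<lambda>x. (x, 0)) \<sigma> = simplex_map d g \<sigma>"
  by (simp add: cell_def simplex_map_def o_def)

lemma push_simplex: "singular_simplex d (fspace Y) \<sigma> \<Longrightarrow> singular_simplex d (fspace X) (simplex_map d g \<sigma>)"
  using cell_simplex[OF simplex_point] by (simp add: push_cell)

lemma push_domain: "singular_simplex d (fspace Y) \<sigma> \<Longrightarrow> lift_domain X d (simplex_map d g \<sigma>) = lift_domain Y d \<sigma>"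
  using cell_domain[OF simplex_point, of d \<sigma>] by (auto simp: push_cell lift_domain_def)

lemma push_lift_mhom:
  assumes "singular_simplex d (fspace Y) \<sigma>"
  shows "push_lift d \<sigma> \<in> mhom R (Y.LM d \<sigma>) (X.LM d (simplex_map d g \<sigma>))"
proof -
  have "cell_lift X d (\<lambda>z. g (fst z)) (\<lambda>z. h (fst z)) (\<lambda>x. (x, 0)) \<sigma> = push_lift d \<sigma>"
    by (auto simp: cell_lift_def push_lift_def push_cell fun_eq_iff)
  then show ?thesis
    using cell_lift_mhom[OF simplex_point assms] by (simp add: push_cell)
qed

abbreviation push where
  "push \<equiv> coeff_chain_map Y G' X G g h"

definition push_simplex_chain where
  "push_simplex_chain d \<sigma> l = simplex_chain X G d (simplex_map d g \<sigma>) (push_lift d \<sigma> l)"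

lemma push_simplex_chain_mhom: "singular_simplex d (fspace Y) \<sigma> \<Longrightarrow> push_simplex_chain d \<sigma> \<in> mhom R (Y.LM d \<sigma>) (X.CM d)"
  unfolding push_simplex_chain_def by (rule mhom_comp[OF push_lift_mhom X.simplex_chain_mhom[OF push_simplex]])

lemma push_eq:
  assumes c: "c \<in> carrier (Y.CM d)"
  shows "push d c = Y.chain_lift d (X.CM d) (push_simplex_chain d) c"
proof -
  let ?S = "singular_simplex_set d (fspace Y)" and ?S' = "singular_simplex_set d (fspace X)"
  \<comment> \<open>The index set with one element brings the sum into the shape of
    \<open>direct_lift_push\<close>, which also serves for the boundary.\<close>
  let ?\<pi> = "\<lambda>k::unit. simplex_map d g" and ?\<mu> = "\<lambda>k::unit. push_lift d"
  have cS: "c \<sigma> \<in> carrier (Y.LM d \<sigma>)" if "\<sigma> \<in> ?S" for \<sigma>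
    using c that by (auto simp: chain_module_eq direct_sum_simps)
  interpret C: left_module R "X.CM d" by (rule X.chain_left_module)
  have "Y.chain_lift d (X.CM d) (push_simplex_chain d) c
      = direct_lift ?S (Y.LM d) (direct_sum ?S' (X.LM d)) (\<lambda>\<sigma> l. \<Oplus>\<^bsub>direct_sum ?S' (X.LM d)\<^esub>k\<in>{()}. direct_single ?S' (X.LM d) (?\<pi> k \<sigma>) (?\<mu> k \<sigma> l)) c"
    unfolding Y.chain_lift_def direct_lift_def chain_module_eq[symmetric]
  proof (rule C.M.finsum_cong'[OF refl])
    have cl: "push_simplex_chain d \<sigma> (c \<sigma>) \<in> carrier (X.CM d)" if "\<sigma> \<in> direct_support ?S (Y.LM d) c" for \<sigma>
      using that ahom_closed[OF mhom_ahom[OF push_simplex_chain_mhom] cS] by (auto simp: direct_support_def)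
    then have eq: "push_simplex_chain d \<sigma> (c \<sigma>) = (\<Oplus>\<^bsub>X.CM d\<^esub>k\<in>{()}. direct_single ?S' (X.LM d) (?\<pi> k \<sigma>) (?\<mu> k \<sigma> (c \<sigma>)))"
      if "\<sigma> \<in> direct_support ?S (Y.LM d) c" for \<sigma>
      using that by (simp add: push_simplex_chain_def simplex_chain_def)
    show "push_simplex_chain d \<sigma> (c \<sigma>) = (\<Oplus>\<^bsub>X.CM d\<^esub>k\<in>{()}. direct_single ?S' (X.LM d) (?\<pi> k \<sigma>) (?\<mu> k \<sigma> (c \<sigma>)))"
      if "\<sigma> \<in> direct_support ?S (Y.LM d) c" for \<sigma>
      using eq that .
    show "(\<lambda>\<sigma>. \<Oplus>\<^bsub>X.CM d\<^esub>k\<in>{()}. direct_single ?S' (X.LM d) (?\<pi> k \<sigma>) (?\<mu> k \<sigma> (c \<sigma>)))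
        \<in> direct_support ?S (Y.LM d) c \<rightarrow> carrier (X.CM d)"
    proof
      fix \<sigma> assume \<sigma>: "\<sigma> \<in> direct_support ?S (Y.LM d) c"
      show "(\<Oplus>\<^bsub>X.CM d\<^esub>k\<in>{()}. direct_single ?S' (X.LM d) (?\<pi> k \<sigma>) (?\<mu> k \<sigma> (c \<sigma>))) \<in> carrier (X.CM d)"
        unfolding eq[OF \<sigma>, symmetric] by (rule cl[OF \<sigma>])
    qed
  qed
  also have "\<dots> = (\<lambda>\<tau>\<in>?S'. finsum (X.LM d \<tau>) (\<lambda>(\<sigma>, k). ?\<mu> k \<sigma> (c \<sigma>))
      {(\<sigma>, k). \<sigma> \<in> direct_support ?S (Y.LM d) c \<and> k \<in> {()} \<and> ?\<pi> k \<sigma> = \<tau>})"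
    by (rule module_family.direct_lift_push[OF Y.lift_family X.lift_family])
      (use push_lift_mhom push_simplex c chain_module_eq[of Y G' d] in auto)
  also have "\<dots> = push d c"
    unfolding coeff_chain_map_def support_eq
  proof (rule restrict_ext)
    fix \<tau> assume \<tau>: "\<tau> \<in> ?S'"
    interpret L: left_module R "X.LM d \<tau>" using X.lift_left_module \<tau> by simp
    let ?A = "{\<sigma> \<in> direct_support ?S (Y.LM d) c. simplex_map d g \<sigma> = \<tau>}"
    have cl: "push_lift d \<sigma> (c \<sigma>) \<in> carrier (X.LM d \<tau>)" if "\<sigma> \<in> ?A" for \<sigma>
      using that ahom_closed[OF mhom_ahom[OF push_lift_mhom] cS] by (auto simp: direct_support_def)
    have "{(\<sigma>, k). \<sigma> \<in> direct_support ?S (Y.LM d) c \<and> k \<in> {()} \<and> ?\<pi> k \<sigma> = \<tau>} = (\<lambda>\<sigma>. (\<sigma>, ())) ` ?A"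
      by auto
    then have "finsum (X.LM d \<tau>) (\<lambda>(\<sigma>, k). ?\<mu> k \<sigma> (c \<sigma>)) {(\<sigma>, k). \<sigma> \<in> direct_support ?S (Y.LM d) c \<and> k \<in> {()} \<and> ?\<pi> k \<sigma> = \<tau>}
      = finsum (X.LM d \<tau>) (\<lambda>\<sigma>. push_lift d \<sigma> (c \<sigma>)) ?A"
      using cl by (simp only:) (subst L.M.finsum_reindex, auto simp: inj_on_def)
    also have "\<dots> = (\<Oplus>\<^bsub>X.LM d \<tau>\<^esub>\<sigma>\<in>?A. restrict (h \<circ> c \<sigma>) (lift_domain X d \<tau>))"
      by (rule L.M.finsum_cong'[OF refl]) (use cl in \<open>auto simp: push_lift_def\<close>)
    finally show "finsum (X.LM d \<tau>) (\<lambda>(\<sigma>, k). ?\<mu> k \<sigma> (c \<sigma>)) {(\<sigma>, k). \<sigma> \<in> direct_support ?S (Y.LM d) c \<and> k \<in> {()} \<and> ?\<pi> k \<sigma> = \<tau>}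
      = (\<Oplus>\<^bsub>X.LM d \<tau>\<^esub>\<sigma>\<in>?A. restrict (h \<circ> c \<sigma>) (lift_domain X d \<tau>))" .
  qed
  finally show ?thesis by simp
qed

lemma push_mhom: "push d \<in> mhom R (Y.CM d) (X.CM d)"
  by (rule mhom_cong[OF Y.chain_lift_mhom[OF X.chain_left_module push_simplex_chain_mhom] Y.chain_left_module])
    (simp_all add: push_eq)

lemma push_simplex_chain_eq:
  assumes "singular_simplex d (fspace Y) \<sigma>" "l \<in> carrier (Y.LM d \<sigma>)"
  shows "push d (simplex_chain Y G' d \<sigma> l) = simplex_chain X G d (simplex_map d g \<sigma>) (push_lift d \<sigma> l)"
  using Y.chain_lift_simplex_chain[OF X.chain_left_module push_simplex_chain_mhom assms]
  by (simp add: push_eq Y.simplex_chain_closed assms push_simplex_chain_def)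

text \<open>On one simplex, composing with \<open>g\<close> commutes with restriction to each facet,
  and \<open>h\<close> acts pointwise on lifts; additivity extends this to chains. In degree 0 both
  sides are zero.\<close>

lemma push_boundary:
  assumes c: "c \<in> carrier (Y.CM d)"
  shows "coeff_boundary X G d (push d c) = push (d - 1) (coeff_boundary Y G' d c)"
proof (rule Y.chain_ext[OF _ _ _ _ c])
  show "abelian_group (X.CM (d - 1))"
    by (rule left_module_abelian_group[OF X.chain_left_module])
  show "(\<lambda>c. coeff_boundary X G d (push d c)) \<in> ahom (Y.CM d) (X.CM (d - 1))"
    by (rule ahom_comp[OF mhom_ahom[OF push_mhom] mhom_ahom[OF X.boundary_mhom]])
  show "(\<lambda>c. push (d - 1) (coeff_boundary Y G' d c)) \<in> ahom (Y.CM d) (X.CM (d - 1))"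
    by (rule ahom_comp[OF mhom_ahom[OF Y.boundary_mhom] mhom_ahom[OF push_mhom]])
  fix \<sigma> l assume \<sigma>: "singular_simplex d (fspace Y) \<sigma>" and l: "l \<in> carrier (Y.LM d \<sigma>)"
  show "coeff_boundary X G d (push d (simplex_chain Y G' d \<sigma> l)) = push (d - 1) (coeff_boundary Y G' d (simplex_chain Y G' d \<sigma> l))"
  proof (cases d)
    case 0
    have "push 0 \<zero>\<^bsub>Y.CM 0\<^esub> = \<zero>\<^bsub>X.CM 0\<^esub>"
      by (rule ahom_zero[OF _ _ mhom_ahom[OF push_mhom]])
        (rule left_module_abelian_group[OF Y.chain_left_module] left_module_abelian_group[OF X.chain_left_module])+
    then show ?thesis by (simp add: 0 coeff_boundary_def)
  next
    case (Suc e)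
    note \<sigma>' = \<sigma>[unfolded Suc] and l' = l[unfolded Suc]
    interpret CX: left_module R "X.CM e" by (rule X.chain_left_module)
    interpret CY: left_module R "Y.CM e" by (rule Y.chain_left_module)
    have fc: "Y.face_lift e k \<sigma> l \<in> carrier (Y.LM e (singular_face (Suc e) k \<sigma>))" if "k \<le> Suc e" for k
      using ahom_closed[OF mhom_ahom[OF Y.face_lift_mhom[OF \<sigma>' that]] l'] .
    have face: "singular_face (Suc e) k (simplex_map (Suc e) g \<sigma>) = simplex_map e g (singular_face (Suc e) k \<sigma>)"
      if "k \<le> Suc e" for k
      using singular_face_simplex_map[of "Suc e" k g \<sigma>] that
      by (auto simp: simplex_map_def singular_face_def fun_eq_iff)
    have lift: "X.face_lift e k (simplex_map (Suc e) g \<sigma>) (push_lift (Suc e) \<sigma> l)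
        = push_lift e (singular_face (Suc e) k \<sigma>) (Y.face_lift e k \<sigma> l)" if k: "k \<le> Suc e" for k
    proof -
      have "simplical_face k x \<in> lift_domain X (Suc e) (simplex_map (Suc e) g \<sigma>)"
        "x \<in> lift_domain Y e (singular_face (Suc e) k \<sigma>)"
        if "x \<in> lift_domain X e (singular_face (Suc e) k (simplex_map (Suc e) g \<sigma>))" for x
        using that X.face_domain[OF push_simplex[OF \<sigma>'] k] Y.face_domain[OF \<sigma>' k] push_domain[OF \<sigma>'] by auto
      then show ?thesis
        unfolding X.face_lift_def push_lift_def Y.face_lift_def face[OF k, symmetric]
        by (intro restrict_ext) simp
    qed
    have "coeff_boundary X G (Suc e) (push (Suc e) (simplex_chain Y G' (Suc e) \<sigma> l))
        = (\<Oplus>\<^bsub>X.CM e\<^esub>k\<in>{..Suc e}. alternate (X.CM e) k (simplex_chain X G e (simplex_map e g (singular_face (Suc e) k \<sigma>))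
            (push_lift e (singular_face (Suc e) k \<sigma>) (Y.face_lift e k \<sigma> l))))"
      unfolding push_simplex_chain_eq[OF \<sigma>' l']
        X.boundary_simplex_chain[OF push_simplex[OF \<sigma>'] ahom_closed[OF mhom_ahom[OF push_lift_mhom[OF \<sigma>']] l']] X.faces_def
      by (rule CX.M.finsum_cong'[OF refl])
        (use face lift in \<open>auto intro!: alternate_closed[OF X.chain_left_module] X.simplex_chain_closed push_simplex Y.face_simplex[OF \<sigma>']
          ahom_closed[OF mhom_ahom[OF push_lift_mhom]] fc\<close>)
    also have "\<dots> = (\<Oplus>\<^bsub>X.CM e\<^esub>k\<in>{..Suc e}. push e (alternate (Y.CM e) k (simplex_chain Y G' e (singular_face (Suc e) k \<sigma>) (Y.face_lift e k \<sigma> l))))"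
    proof (rule CX.M.finsum_cong'[OF refl])
      fix k assume k: "k \<in> {..Suc e}"
      have s: "simplex_chain Y G' e (singular_face (Suc e) k \<sigma>) (Y.face_lift e k \<sigma> l) \<in> carrier (Y.CM e)"
        using Y.simplex_chain_closed[OF Y.face_simplex[OF \<sigma>'] fc] k by simp
      show "alternate (X.CM e) k (simplex_chain X G e (simplex_map e g (singular_face (Suc e) k \<sigma>))
            (push_lift e (singular_face (Suc e) k \<sigma>) (Y.face_lift e k \<sigma> l)))
          = push e (alternate (Y.CM e) k (simplex_chain Y G' e (singular_face (Suc e) k \<sigma>) (Y.face_lift e k \<sigma> l)))"
        using ahom_alternate[OF Y.chain_left_module X.chain_left_module mhom_ahom[OF push_mhom] s, of k]
          push_simplex_chain_eq[OF Y.face_simplex[OF \<sigma>'] fc] k by simp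
    qed (use fc \<sigma>' in \<open>auto intro!: ahom_closed[OF mhom_ahom[OF push_mhom]] alternate_closed[OF Y.chain_left_module]
        Y.simplex_chain_closed Y.face_simplex\<close>)
    also have "\<dots> = push e (Y.faces e \<sigma> l)"
      unfolding Y.faces_def
      by (rule ahom_finsum[OF CY.M.abelian_group_axioms CX.M.abelian_group_axioms mhom_ahom[OF push_mhom], symmetric])
        (use fc \<sigma>' in \<open>auto intro!: alternate_closed[OF Y.chain_left_module] Y.simplex_chain_closed Y.face_simplex\<close>)
    finally show ?thesis
      by (simp add: Suc Y.boundary_simplex_chain[OF \<sigma>' l'])
  qed
qed

end

section \<open>The chain homotopy of a bundle homotopy\<close>

context coeff_homotopy
begin

text \<open>The dimension is read off the list, since \<open>prism\<close> and
  \<open>list_boundary\<close> act on functions defined on lists of every length.\<close>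

definition homotopy_cell where "homotopy_cell L = cell (length L - Suc 0) K (aff L)"
definition homotopy_lift where "homotopy_lift L = cell_lift X (length L - Suc 0) K H (aff L)"
lemma homotopy_lift_eq: "homotopy_lift L \<sigma> l = (\<lambda>x \<in> lift_domain X (length L - Suc 0) (homotopy_cell L \<sigma>). H (l (fst (aff L x)), snd (aff L x)))"
  by (simp add: homotopy_lift_def cell_lift_def homotopy_cell_def)

definition homotopy_chain where "homotopy_chain \<sigma> l L = simplex_chain X G (length L - Suc 0) (homotopy_cell L \<sigma>) (homotopy_lift L \<sigma> l)"

context
  fixes d q L \<sigma>
  assumes L: "L \<in> on_lists (prism_vertices d) (Suc q)" and \<sigma>: "singular_simplex d (fspace Y) \<sigma>"
begin

lemma list_length: "length L - Suc 0 = q"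
  using L by (simp add: on_lists_def)

lemma homotopy_cell_simplex: "singular_simplex q (fspace X) (homotopy_cell L \<sigma>)"
  using cell_simplex[OF aff_cont[OF L] \<sigma>] by (simp add: homotopy_cell_def list_length)

lemma homotopy_cell_domain:
  "lift_domain X q (homotopy_cell L \<sigma>) = {x \<in> standard_simplex q. fst (aff L x) \<in> lift_domain Y d \<sigma>}"
  using cell_domain[OF aff_cont[OF L] \<sigma>] by (simp add: homotopy_cell_def list_length)

lemma homotopy_lift_mhom: "homotopy_lift L \<sigma> \<in> mhom R (Y.LM d \<sigma>) (X.LM q (homotopy_cell L \<sigma>))"
  using cell_lift_mhom[OF aff_cont[OF L] \<sigma>] by (simp add: homotopy_cell_def homotopy_lift_def list_length)

lemma homotopy_chain_mhom: "(\<lambda>l. homotopy_chain \<sigma> l L) \<in> mhom R (Y.LM d \<sigma>) (X.CM q)"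
  unfolding homotopy_chain_def list_length by (rule mhom_comp[OF homotopy_lift_mhom X.simplex_chain_mhom[OF homotopy_cell_simplex]])

lemma homotopy_chain_closed: "l \<in> carrier (Y.LM d \<sigma>) \<Longrightarrow> homotopy_chain \<sigma> l L \<in> carrier (X.CM q)"
  using ahom_closed[OF mhom_ahom[OF homotopy_chain_mhom]] .

end

text \<open>By \<open>aff_face\<close> the \<open>k\<close>-th face of the cell of \<open>L\<close>
  is the cell of \<open>L\<close> with its \<open>k\<close>-th vertex deleted. The geometric
  boundary is thereby the combinatorial one.\<close>

lemma homotopy_chain_boundary:
  assumes L: "L \<in> on_lists (prism_vertices d) (Suc (Suc q))" and \<sigma>: "singular_simplex d (fspace Y) \<sigma>"
    and l: "l \<in> carrier (Y.LM d \<sigma>)"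
  shows "coeff_boundary X G (Suc q) (homotopy_chain \<sigma> l L) = list_boundary (X.CM q) (homotopy_chain \<sigma> l) L"
proof -
  interpret C: left_module R "X.CM q" by (rule X.chain_left_module)
  have len: "length L = Suc (Suc q)" using L by (simp add: on_lists_def)
  have dl: "del k L \<in> on_lists (prism_vertices d) (Suc q)" if "k \<le> Suc q" for k
    by (rule del_on_lists[OF L that])
  note dlen = list_length[OF dl \<sigma>]
  have face: "singular_face (Suc q) k (homotopy_cell L \<sigma>) = homotopy_cell (del k L) \<sigma>" if k: "k \<le> Suc q" for k
  proof
    fix x
    show "singular_face (Suc q) k (homotopy_cell L \<sigma>) x = homotopy_cell (del k L) \<sigma> x"
      using aff_face[OF len k, of x] simplical_face_in_standard_simplex[of "Suc q" k x] k
      by (auto simp: singular_face_def homotopy_cell_def cell_def len dlen[OF k])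
  qed
  have lift: "X.face_lift q k (homotopy_cell L \<sigma>) (homotopy_lift L \<sigma> l) = homotopy_lift (del k L) \<sigma> l" if k: "k \<le> Suc q" for k
  proof -
    have "simplical_face k x \<in> lift_domain X (Suc q) (homotopy_cell L \<sigma>)"
      if "x \<in> lift_domain X q (homotopy_cell (del k L) \<sigma>)" for x
      using that X.face_domain[OF homotopy_cell_simplex[OF L \<sigma>] k] by (auto simp: face[OF k])
    then show ?thesis
      unfolding X.face_lift_def homotopy_lift_eq dlen[OF k] list_length[OF L \<sigma>] face[OF k]
      by (intro restrict_ext) (simp add: aff_face[OF len k])
  qed
  have "coeff_boundary X G (Suc q) (homotopy_chain \<sigma> l L) = X.faces q (homotopy_cell L \<sigma>) (homotopy_lift L \<sigma> l)"
    unfolding homotopy_chain_def list_length[OF L \<sigma>]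
    by (rule X.boundary_simplex_chain[OF homotopy_cell_simplex[OF L \<sigma>] ahom_closed[OF mhom_ahom[OF homotopy_lift_mhom[OF L \<sigma>]] l]])
  also have "\<dots> = (\<Oplus>\<^bsub>X.CM q\<^esub>k\<in>{..Suc q}. alternate (X.CM q) k (homotopy_chain \<sigma> l (del k L)))"
    unfolding X.faces_def
  proof (rule C.M.finsum_cong'[OF refl])
    show "(\<lambda>k. alternate (X.CM q) k (homotopy_chain \<sigma> l (del k L))) \<in> {..Suc q} \<rightarrow> carrier (X.CM q)"
      using homotopy_chain_closed[OF dl \<sigma> l] by (auto intro!: alternate_closed[OF X.chain_left_module])
    show "alternate (X.CM q) k (simplex_chain X G q (singular_face (Suc q) k (homotopy_cell L \<sigma>)) (X.face_lift q k (homotopy_cell L \<sigma>) (homotopy_lift L \<sigma> l)))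
        = alternate (X.CM q) k (homotopy_chain \<sigma> l (del k L))" if "k \<in> {..Suc q}" for k
      using that by (simp add: homotopy_chain_def face lift dlen)
  qed
  also have "\<dots> = list_boundary (X.CM q) (homotopy_chain \<sigma> l) L"
    by (rule list_boundary_sum[OF X.chain_left_module L, symmetric]) (rule homotopy_chain_closed[OF _ \<sigma> l])
  finally show ?thesis .
qed

text \<open>A prism cell over a facet of \<open>\<sigma>\<close> is a prism cell over
  \<open>\<sigma>\<close> with renumbered vertices, so the prism of a face can be compared with
  pieces of the prism over \<open>\<sigma>\<close> itself.\<close>

lemma homotopy_chain_face:
  assumes L: "L \<in> on_lists (prism_vertices d) (Suc q)" and \<sigma>: "singular_simplex (Suc d) (fspace Y) \<sigma>"
    and k: "k \<le> Suc d"
  shows "homotopy_chain (singular_face (Suc d) k \<sigma>) (Y.face_lift d k \<sigma> l) L = homotopy_chain \<sigma> l (map (skip k) L)"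
proof -
  let ?f = "singular_face (Suc d) k \<sigma>"
  note f = Y.face_simplex[OF \<sigma> k]
  note len = list_length[OF L f]
  have cell: "homotopy_cell L ?f = homotopy_cell (map (skip k) L) \<sigma>"
    using aff_simplex(1)[OF L] by (auto simp: homotopy_cell_def cell_def len aff_skip singular_face_def fun_eq_iff)
  have "fst (aff L x) \<in> lift_domain Y d ?f" if "x \<in> lift_domain X q (homotopy_cell (map (skip k) L) \<sigma>)" for x
    using that homotopy_cell_domain[OF L f] unfolding cell by auto
  then have "homotopy_lift L ?f (Y.face_lift d k \<sigma> l) = homotopy_lift (map (skip k) L) \<sigma> l"
    unfolding homotopy_lift_eq length_map len cell
    by (intro restrict_ext) (simp add: Y.face_lift_def aff_skip)
  then show ?thesis
    by (simp add: homotopy_chain_def cell)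
qed

definition prism_op where
  "prism_op d = Y.chain_lift d (X.CM (Suc d)) (\<lambda>\<sigma> l. prism (X.CM (Suc d)) lift_top (homotopy_chain \<sigma> l) (bottom d))"

lemma prism_homotopy_chain_mhom:
  assumes "singular_simplex d (fspace Y) \<sigma>"
  shows "(\<lambda>l. prism (X.CM (Suc d)) lift_top (homotopy_chain \<sigma> l) (bottom d)) \<in> mhom R (Y.LM d \<sigma>) (X.CM (Suc d))"
  by (rule prism_mhom[OF X.chain_left_module lift_top_vertices lift_top_simps(1) bottom_on_lists])
    (auto intro: homotopy_chain_mhom[OF _ assms])

lemma prism_op_mhom: "prism_op d \<in> mhom R (Y.CM d) (X.CM (Suc d))"
  unfolding prism_op_def by (rule Y.chain_lift_mhom[OF X.chain_left_module prism_homotopy_chain_mhom])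

lemma prism_op_simplex_chain:
  assumes "singular_simplex d (fspace Y) \<sigma>" "l \<in> carrier (Y.LM d \<sigma>)"
  shows "prism_op d (simplex_chain Y G' d \<sigma> l) = prism (X.CM (Suc d)) lift_top (homotopy_chain \<sigma> l) (bottom d)"
  unfolding prism_op_def by (rule Y.chain_lift_simplex_chain[OF X.chain_left_module prism_homotopy_chain_mhom assms])

lemma at_time:
  assumes t: "t \<in> {0..1}"
  shows "coeff_map R Y G' X G (\<lambda>y. K (y, t)) (\<lambda>u. H (u, t))"
proof (intro coeff_map.intro coeff_map_axioms.intro Y.coeff_space_axioms X.coeff_space_axioms dims)
  show "continuous_map (fspace Y) (fspace X) (\<lambda>y. K (y, t))"
    by (rule continuous_map_comp[OF K_cont]) (use t in \<open>auto intro!: continuous_map_pairedI\<close>)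
  show "continuous_map Y.E X.E (\<lambda>u. H (u, t))"
    by (rule continuous_map_comp[OF H_cont]) (use t in \<open>auto intro!: continuous_map_pairedI\<close>)
qed (use t K_stratum H_lin in auto)

abbreviation end_map where
  "end_map t \<equiv> coeff_chain_map Y G' X G (\<lambda>y. K (y, t)) (\<lambda>u. H (u, t))"

text \<open>Identifies the two terms on the right of \<open>prism_identity\<close>: at the bottom
  list \<open>aff\<close> is \<open>x \<mapsto> (x, 0)\<close>, at the top list
  \<open>x \<mapsto> (x, 1)\<close>.\<close>

lemma end_map_simplex_chain:
  assumes \<sigma>: "singular_simplex d (fspace Y) \<sigma>" and l: "l \<in> carrier (Y.LM d \<sigma>)"
  shows "end_map 0 d (simplex_chain Y G' d \<sigma> l) = homotopy_chain \<sigma> l (bottom d)"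
    "end_map 1 d (simplex_chain Y G' d \<sigma> l) = homotopy_chain \<sigma> l (map lift_top (bottom d))"
proof -
  have len: "length (bottom d) - Suc 0 = d" by (simp add: bottom_def)
  have *: "end_map t d (simplex_chain Y G' d \<sigma> l) = homotopy_chain \<sigma> l L"
    if t: "t \<in> {0..1}" and L: "length L - Suc 0 = d" "\<And>x. x \<in> standard_simplex d \<Longrightarrow> aff L x = (x, t)" for t L
  proof -
    interpret m: coeff_map R Y G' X G "\<lambda>y. K (y, t)" "\<lambda>u. H (u, t)" by (rule at_time[OF t])
    have c: "homotopy_cell L \<sigma> = simplex_map d (\<lambda>y. K (y, t)) \<sigma>"
      by (auto simp: homotopy_cell_def cell_def L simplex_map_def fun_eq_iff)
    have "homotopy_lift L \<sigma> l = m.push_lift d \<sigma> l"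
      unfolding homotopy_lift_eq m.push_lift_def c L(1)
      by (intro restrict_ext) (simp add: L(2) lift_domainD(1))
    then show ?thesis
      using m.push_simplex_chain_eq[OF \<sigma> l] c by (simp add: homotopy_chain_def L)
  qed
  show "end_map 0 d (simplex_chain Y G' d \<sigma> l) = homotopy_chain \<sigma> l (bottom d)"
    by (rule *) (use len aff_bottom in auto)
  show "end_map 1 d (simplex_chain Y G' d \<sigma> l) = homotopy_chain \<sigma> l (map lift_top (bottom d))"
    by (rule *) (use len aff_bottom in auto)
qed

text \<open>The prism of the boundary, with degree 0 set apart: there
  \<open>prism_op (d - 1)\<close> would have values in degree 1 instead of 0.\<close>

definition prism_bd where
  "prism_bd d c = (case d of 0 \<Rightarrow> \<zero>\<^bsub>X.CM 0\<^esub> | Suc e \<Rightarrow> prism_op e (coeff_boundary Y G' d c))"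

lemma prism_bd_ahom: "prism_bd d \<in> ahom (Y.CM d) (X.CM d)"
proof (cases d)
  case 0
  then show ?thesis
    using ahom_zero_fun[OF left_module_abelian_group[OF X.chain_left_module]] by (simp add: prism_bd_def[abs_def])
next
  case (Suc e)
  have "coeff_boundary Y G' (Suc e) \<in> ahom (Y.CM (Suc e)) (Y.CM e)"
    using mhom_ahom[OF Y.boundary_mhom[of "Suc e"]] by simp
  then show ?thesis
    using ahom_comp[OF _ mhom_ahom[OF prism_op_mhom]] by (simp add: Suc prism_bd_def[abs_def])
qed

text \<open>On one simplex this is \<open>prism_identity\<close> for the function
  \<open>homotopy_chain \<sigma> l\<close>. The boundary moves inside the prism by linearity; in
  \<open>prism_bd\<close> each facet is rewritten as a deletion from the list of bottom
  vertices.\<close>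

lemma prism_op_boundary:
  assumes c: "c \<in> carrier (Y.CM d)"
  shows "coeff_boundary X G (Suc d) (prism_op d c) \<oplus>\<^bsub>X.CM d\<^esub> prism_bd d c
    = end_map 1 d c \<ominus>\<^bsub>X.CM d\<^esub> end_map 0 d c"
proof -
  interpret C: left_module R "X.CM d" by (rule X.chain_left_module)
  interpret m0: coeff_map R Y G' X G "\<lambda>y. K (y, 0)" "\<lambda>u. H (u, 0)" by (rule at_time) simp
  interpret m1: coeff_map R Y G' X G "\<lambda>y. K (y, 1)" "\<lambda>u. H (u, 1)" by (rule at_time) simp
  have bd: "coeff_boundary X G (Suc d) \<in> mhom R (X.CM (Suc d)) (X.CM d)"
    using X.boundary_mhom[of "Suc d"] by simp
  show ?thesis
  proof (rule Y.chain_ext[OF C.M.abelian_group_axioms _ _ _ c])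
    show "(\<lambda>c. coeff_boundary X G (Suc d) (prism_op d c) \<oplus>\<^bsub>X.CM d\<^esub> prism_bd d c) \<in> ahom (Y.CM d) (X.CM d)"
      by (intro ahom_add_fun C.M.abelian_group_axioms prism_bd_ahom
          ahom_comp[OF mhom_ahom[OF prism_op_mhom] mhom_ahom[OF bd]])
    show "(\<lambda>c. end_map 1 d c \<ominus>\<^bsub>X.CM d\<^esub> end_map 0 d c) \<in> ahom (Y.CM d) (X.CM d)"
      unfolding C.M.minus_eq
      by (intro ahom_add_fun ahom_neg_fun C.M.abelian_group_axioms mhom_ahom[OF m0.push_mhom] mhom_ahom[OF m1.push_mhom])
    fix \<sigma> l assume \<sigma>: "singular_simplex d (fspace Y) \<sigma>" and l: "l \<in> carrier (Y.LM d \<sigma>)"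
    note bot = bottom_on_lists[of d] and lt = lift_top_vertices[of _ d] lift_top_simps(1)
    have cl: "homotopy_chain \<sigma> l k \<in> carrier (X.CM q)" if "k \<in> on_lists (prism_vertices d) (Suc q)" for k q
      by (rule homotopy_chain_closed[OF that \<sigma> l])
    have "coeff_boundary X G (Suc d) (prism_op d (simplex_chain Y G' d \<sigma> l))
        = prism (X.CM d) lift_top (\<lambda>k. coeff_boundary X G (Suc d) (homotopy_chain \<sigma> l k)) (bottom d)"
      unfolding prism_op_simplex_chain[OF \<sigma> l]
      by (rule prism_ahom[OF X.chain_left_module X.chain_left_module mhom_ahom[OF bd] lt bot]) (auto intro: cl)
    also have "\<dots> = prism (X.CM d) lift_top (list_boundary (X.CM d) (homotopy_chain \<sigma> l)) (bottom d)"
      by (rule prism_cong[OF bot lt(1)]) (auto intro: homotopy_chain_boundary[OF _ \<sigma> l])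
    finally have 1: "coeff_boundary X G (Suc d) (prism_op d (simplex_chain Y G' d \<sigma> l))
        = prism (X.CM d) lift_top (list_boundary (X.CM d) (homotopy_chain \<sigma> l)) (bottom d)" .
    have 2: "prism_bd d (simplex_chain Y G' d \<sigma> l) = list_boundary (X.CM d) (prism (X.CM d) lift_top (homotopy_chain \<sigma> l)) (bottom d)"
    proof (cases d)
      \<comment> \<open>The boundary of the single bottom vertex is the empty list, whose prism is
        zero; this agrees with the default in \<open>prism_bd\<close>.\<close>
      case 0
      interpret C0: left_module R "X.CM 0" by (rule X.chain_left_module)
      show ?thesis
        by (simp add: 0 prism_bd_def bottom_def C0.M.minus_eq)
    next
      case (Suc e)
      note \<sigma>' = \<sigma>[unfolded Suc] and l' = l[unfolded Suc]
      interpret CY: left_module R "Y.CM e" by (rule Y.chain_left_module)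
      interpret CX: left_module R "X.CM (Suc e)" by (rule X.chain_left_module)
      have fc: "Y.face_lift e k \<sigma> l \<in> carrier (Y.LM e (singular_face (Suc e) k \<sigma>))" if "k \<le> Suc e" for k
        using ahom_closed[OF mhom_ahom[OF Y.face_lift_mhom[OF \<sigma>' that]] l'] .
      have sc: "simplex_chain Y G' e (singular_face (Suc e) k \<sigma>) (Y.face_lift e k \<sigma> l) \<in> carrier (Y.CM e)" if "k \<le> Suc e" for k
        by (rule Y.simplex_chain_closed[OF Y.face_simplex[OF \<sigma>' that] fc[OF that]])
      have "prism_bd (Suc e) (simplex_chain Y G' (Suc e) \<sigma> l) = prism_op e (Y.faces e \<sigma> l)"
        by (simp add: prism_bd_def Y.boundary_simplex_chain[OF \<sigma>' l'])
      also have "\<dots> = (\<Oplus>\<^bsub>X.CM (Suc e)\<^esub>k\<in>{..Suc e}. prism_op e (alternate (Y.CM e) k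
            (simplex_chain Y G' e (singular_face (Suc e) k \<sigma>) (Y.face_lift e k \<sigma> l))))"
        unfolding Y.faces_def
        by (rule ahom_finsum[OF CY.M.abelian_group_axioms CX.M.abelian_group_axioms mhom_ahom[OF prism_op_mhom]])
          (use sc in \<open>auto intro: alternate_closed[OF Y.chain_left_module]\<close>)
      also have "\<dots> = (\<Oplus>\<^bsub>X.CM (Suc e)\<^esub>k\<in>{..Suc e}. alternate (X.CM (Suc e)) k
            (prism (X.CM (Suc e)) lift_top (homotopy_chain \<sigma> l) (del k (bottom (Suc e)))))"
      proof (rule CX.M.finsum_cong'[OF refl])
        have dl: "del k (bottom (Suc e)) \<in> on_lists (prism_vertices (Suc e)) (Suc e)" if "k \<le> Suc e" for k
          by (rule del_on_lists[OF bottom_on_lists that])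
        have pc: "prism (X.CM (Suc e)) lift_top (homotopy_chain \<sigma> l) (del k (bottom (Suc e))) \<in> carrier (X.CM (Suc e))"
          if "k \<le> Suc e" for k
          by (rule prism_closed[OF X.chain_left_module lift_top_vertices lift_top_simps(1) dl[OF that]])
            (use cl Suc in auto)
        then show "(\<lambda>k. alternate (X.CM (Suc e)) k (prism (X.CM (Suc e)) lift_top (homotopy_chain \<sigma> l) (del k (bottom (Suc e)))))
            \<in> {..Suc e} \<rightarrow> carrier (X.CM (Suc e))"
          by (auto intro: alternate_closed[OF X.chain_left_module])
        fix k assume "k \<in> {..Suc e}"
        then have k: "k \<le> Suc e" by simp
        have "prism_op e (simplex_chain Y G' e (singular_face (Suc e) k \<sigma>) (Y.face_lift e k \<sigma> l))
            = prism (X.CM (Suc e)) lift_top (homotopy_chain (singular_face (Suc e) k \<sigma>) (Y.face_lift e k \<sigma> l)) (bottom e)"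
          by (rule prism_op_simplex_chain[OF Y.face_simplex[OF \<sigma>' k] fc[OF k]])
        also have "\<dots> = prism (X.CM (Suc e)) lift_top (\<lambda>L. homotopy_chain \<sigma> l (map (skip k) L)) (bottom e)"
          by (rule prism_cong[OF bottom_on_lists lift_top_vertices]) (auto intro: homotopy_chain_face[OF _ \<sigma>' k])
        also have "\<dots> = prism (X.CM (Suc e)) lift_top (homotopy_chain \<sigma> l) (map (skip k) (bottom e))"
          by (rule prism_map[symmetric]) (simp add: skip_def lift_top_def)
        finally show "prism_op e (alternate (Y.CM e) k (simplex_chain Y G' e (singular_face (Suc e) k \<sigma>) (Y.face_lift e k \<sigma> l)))
            = alternate (X.CM (Suc e)) k (prism (X.CM (Suc e)) lift_top (homotopy_chain \<sigma> l) (del k (bottom (Suc e))))"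
          using ahom_alternate[OF Y.chain_left_module X.chain_left_module mhom_ahom[OF prism_op_mhom] sc[OF k], of k]
            bottom_del[OF k] by simp
      qed
      also have "\<dots> = list_boundary (X.CM (Suc e)) (prism (X.CM (Suc e)) lift_top (homotopy_chain \<sigma> l)) (bottom (Suc e))"
        by (rule list_boundary_sum[OF X.chain_left_module bottom_on_lists, symmetric],
            rule prism_closed[OF X.chain_left_module lift_top_vertices lift_top_simps(1)])
          (use cl Suc in auto)
      finally show ?thesis by (simp add: Suc)
    qed
    show "coeff_boundary X G (Suc d) (prism_op d (simplex_chain Y G' d \<sigma> l)) \<oplus>\<^bsub>X.CM d\<^esub> prism_bd d (simplex_chain Y G' d \<sigma> l)
        = end_map 1 d (simplex_chain Y G' d \<sigma> l) \<ominus>\<^bsub>X.CM d\<^esub> end_map 0 d (simplex_chain Y G' d \<sigma> l)"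
      unfolding 1 2 end_map_simplex_chain[OF \<sigma> l]
      by (rule prism_identity[OF X.chain_left_module lt bot]) (auto intro: cl)
  qed
qed

end

section \<open>Intersection chains\<close>

context coeff_space
begin

text \<open>Isolates the condition on the chain itself. \<open>IC\<close> is then this submodule
  intersected with the preimage of its analogue under the boundary.\<close>

definition allowable_chains where
  "allowable_chains p d = {c \<in> carrier (CM d). \<forall>\<sigma> \<in> coeff_support X G d c. allowable p X d \<sigma>}"

lemma allowable_chains_submod: "submod R (CM d) (allowable_chains p d)"
proof -
  interpret C: left_module R "CM d" by (rule chain_left_module)
  have add: "coeff_support X G d (c \<oplus>\<^bsub>CM d\<^esub> c') \<subseteq> coeff_support X G d c \<union> coeff_support X G d c'" for c c'
    unfolding support_eq chain_module_eq by (rule module_family.direct_support_add[OF lift_family])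
  have sm: "coeff_support X G d (r \<odot>\<^bsub>CM d\<^esub> c) \<subseteq> coeff_support X G d c" if "r \<in> carrier R" for r c
    unfolding support_eq chain_module_eq by (rule module_family.direct_support_smult[OF lift_family that])
  have zero: "coeff_support X G d \<zero>\<^bsub>CM d\<^esub> = {}"
    unfolding support_eq chain_module_eq by (rule direct_support_zero)
  show ?thesis
    unfolding submod_def allowable_chains_def
  proof (intro conjI ballI, goal_cases)
    case (3 c c')
    then show ?case using add[of c c'] by auto
  next
    case (4 r c)
    then show ?case using sm[of r c] C.smult_closed by auto
  qed (use zero in auto)
qed

lemma simplex_chain_allowable_chains:
  assumes "allowable p X d \<sigma>" "l \<in> carrier (LM d \<sigma>)"
  shows "simplex_chain X G d \<sigma> l \<in> allowable_chains p d"
proof -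
  have "coeff_support X G d (simplex_chain X G d \<sigma> l) \<subseteq> {\<sigma>}"
    unfolding support_eq simplex_chain_def by (rule module_family.direct_support_direct_single[OF lift_family])
  then show ?thesis
    using assms simplex_chain_closed[of d \<sigma> l] by (auto simp: allowable_chains_def allowable_def)
qed

lemma IC_eq: "IC p X G d = allowable_chains p d \<inter> {c \<in> carrier (CM d). coeff_boundary X G d c \<in> allowable_chains p (d - 1)}"
  using ahom_closed[OF mhom_ahom[OF boundary_mhom[of d]]] by (auto simp: IC_def allowable_chains_def)

lemma IC_submod: "submod R (CM d) (IC p X G d)"
  unfolding IC_eq
  by (intro submod_Int allowable_chains_submod submod_vimage[OF chain_left_module chain_left_module boundary_mhom])

lemma IC_cycles_eq: "IC_cycles p X G d
    = IC p X G d \<inter> {c \<in> carrier (CM d). coeff_boundary X G d c \<in> {\<zero>\<^bsub>CM (d - 1)\<^esub>}}"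
  by (auto simp: IC_cycles_def IC_def)

lemma IC_cycles_submod: "submod R (CM d) (IC_cycles p X G d)"
  unfolding IC_cycles_eq
  by (intro submod_Int IC_submod submod_vimage[OF chain_left_module chain_left_module boundary_mhom]
      submod_zero chain_left_module)

lemma IC_boundaries_submod: "submod R (CM d) (IC_boundaries p X G d)"
proof -
  have "coeff_boundary X G (d + 1) \<in> mhom R (CM (d + 1)) (CM d)"
    using boundary_mhom[of "d + 1"] by simp
  then show ?thesis
    unfolding IC_boundaries_def by (rule submod_image[OF chain_left_module chain_left_module _ IC_submod])
qed

lemma IC_cyclesD: "c \<in> IC_cycles p X G d \<Longrightarrow> c \<in> carrier (CM d)"
  "c \<in> IC_cycles p X G d \<Longrightarrow> c \<in> allowable_chains p d"
  "c \<in> IC_cycles p X G d \<Longrightarrow> coeff_boundary X G d c = \<zero>\<^bsub>CM (d - 1)\<^esub>"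
  by (auto simp: IC_cycles_eq IC_eq)

end

context coeff_map
begin

text \<open>Since \<open>g\<close> reflects strata, the preimage of each stratum in the simplex
  stays the same; equal dimensions of \<open>X\<close> and \<open>Y\<close> make the codimension
  \<open>k\<close> the same as well.\<close>

lemma push_allowable:
  assumes "allowable p Y d \<sigma>"
  shows "allowable p X d (simplex_map d g \<sigma>)"
proof -
  have \<sigma>: "singular_simplex d (fspace Y) \<sigma>" using assms by (simp add: allowable_def)
  have "\<sigma> x \<in> topspace (fspace Y)" if "x \<in> standard_simplex d" for x
    using \<sigma>_in[OF simplex_point \<sigma> that] .
  then have "g (\<sigma> x) \<in> stratum X i \<longleftrightarrow> \<sigma> x \<in> stratum Y i" if "x \<in> standard_simplex d" for x i
    using K_stratum_iff[of "\<sigma> x" 0 i] that by simp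
  then have "{x \<in> standard_simplex d. simplex_map d g \<sigma> x \<in> stratum X i}
      = {x \<in> standard_simplex d. \<sigma> x \<in> stratum Y i}" for i
    by (auto simp: simplex_map_def)
  then show ?thesis
    using assms push_simplex[OF \<sigma>] dims by (simp add: allowable_def)
qed

text \<open>Simplices may coincide in the image and their coefficients may cancel. Arguing in the
  submodule of allowable chains avoids describing the support of the image.\<close>

lemma push_allowable_chains: "c \<in> Y.allowable_chains p d \<Longrightarrow> push d c \<in> X.allowable_chains p d"
proof -
  assume c: "c \<in> Y.allowable_chains p d"
  then have cc: "c \<in> carrier (Y.CM d)" by (simp add: Y.allowable_chains_def)
  show ?thesis
    unfolding push_eq[OF cc]
  proof (rule Y.chain_lift_mem[OF X.chain_left_module X.allowable_chains_submod cc])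
    fix \<sigma> l
    assume "\<sigma> \<in> coeff_support Y G' d c" and \<sigma>: "singular_simplex d (fspace Y) \<sigma>" and l: "l \<in> carrier (Y.LM d \<sigma>)"
    then have "allowable p Y d \<sigma>" using c by (simp add: Y.allowable_chains_def)
    then show "push_simplex_chain d \<sigma> l \<in> X.allowable_chains p d"
      unfolding push_simplex_chain_def
      by (rule X.simplex_chain_allowable_chains[OF push_allowable ahom_closed[OF mhom_ahom[OF push_lift_mhom[OF \<sigma>]] l]])
  qed
qed

lemma push_IC: "c \<in> IC p Y G' d \<Longrightarrow> push d c \<in> IC p X G d"
  using push_allowable_chains push_boundary ahom_closed[OF mhom_ahom[OF push_mhom]]
  by (auto simp: Y.IC_eq X.IC_eq)

lemma push_cycles: "c \<in> IC_cycles p Y G' d \<Longrightarrow> push d c \<in> IC_cycles p X G d"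
proof -
  assume c: "c \<in> IC_cycles p Y G' d"
  have "push (d - 1) \<zero>\<^bsub>Y.CM (d - 1)\<^esub> = \<zero>\<^bsub>X.CM (d - 1)\<^esub>"
    by (rule ahom_zero[OF _ _ mhom_ahom[OF push_mhom]])
      (rule left_module_abelian_group[OF Y.chain_left_module] left_module_abelian_group[OF X.chain_left_module])+
  then show ?thesis
    using c push_IC push_boundary[OF Y.IC_cyclesD(1)[OF c]] Y.IC_cyclesD(3)[OF c]
    by (simp add: IC_cycles_def)
qed

lemma push_boundaries: "c \<in> IC_boundaries p Y G' d \<Longrightarrow> push d c \<in> IC_boundaries p X G d"
proof -
  assume "c \<in> IC_boundaries p Y G' d"
  then obtain b where b: "b \<in> IC p Y G' (d + 1)" "c = coeff_boundary Y G' (d + 1) b"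
    by (auto simp: IC_boundaries_def)
  then have "push d c = coeff_boundary X G (d + 1) (push (d + 1) b)"
    using push_boundary[of b "d + 1"] by (simp add: Y.IC_eq)
  then show ?thesis
    using push_IC[OF b(1)] by (simp add: IC_boundaries_def)
qed

end

context coeff_homotopy
begin

text \<open>A point of the cell lies in the stratum of the point of \<open>\<sigma>\<close> below
  it. The skeleton containing the latter goes up by one dimension, and so does the bound, because
  \<open>d\<close> becomes \<open>Suc d\<close>.\<close>

lemma homotopy_cell_allowable:
  assumes \<sigma>: "allowable p Y d \<sigma>" and L: "prism_cell (prism_vertices d) (bottom d) L"
  shows "allowable p X (Suc d) (homotopy_cell L \<sigma>)"
proof -
  have s: "singular_simplex d (fspace Y) \<sigma>" using \<sigma> by (simp add: allowable_def)
  have L': "L \<in> on_lists (prism_vertices d) (Suc (Suc d))"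
    using L by (simp add: prism_cell_def bottom_def)
  note len = list_length[OF L' s]
  have "{x \<in> standard_simplex (Suc d). homotopy_cell L \<sigma> x \<in> stratum X (int (sdim X) - int k)}
      \<subseteq> simplex_skeleton (Suc d) (int (Suc d) - int k + p k)" for k
  proof
    fix x assume x: "x \<in> {x \<in> standard_simplex (Suc d). homotopy_cell L \<sigma> x \<in> stratum X (int (sdim X) - int k)}"
    then have xs: "x \<in> standard_simplex (Suc d)" by simp
    let ?y = "fst (aff L x)"
    have y: "?y \<in> standard_simplex d" "snd (aff L x) \<in> {0..1}"
      using aff_simplex[OF L' xs] by auto
    have "K (\<sigma> ?y, snd (aff L x)) \<in> stratum X (int (sdim X) - int k)"
      using x xs by (simp add: homotopy_cell_def cell_def len)
    then have "\<sigma> ?y \<in> stratum Y (int (sdim Y) - int k)"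
      using K_stratum_iff[OF \<sigma>_in[OF aff_cont[OF L'] s y(1)] y(2)] dims by simp
    then have "?y \<in> simplex_skeleton d (int d - int k + p k)"
      using \<sigma> y(1) unfolding allowable_def by blast
    from prism_cell_skeleton[OF L xs this]
    show "x \<in> simplex_skeleton (Suc d) (int (Suc d) - int k + p k)"
      by (simp add: algebra_simps)
  qed
  then show ?thesis
    using homotopy_cell_simplex[OF L' s] by (simp add: allowable_def)
qed

lemma prism_op_allowable_chains:
  assumes c: "c \<in> Y.allowable_chains p d"
  shows "prism_op d c \<in> X.allowable_chains p (Suc d)"
proof -
  have cc: "c \<in> carrier (Y.CM d)" using c by (simp add: Y.allowable_chains_def)
  show ?thesis
    unfolding prism_op_def
  proof (rule Y.chain_lift_mem[OF X.chain_left_module X.allowable_chains_submod cc])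
    fix \<sigma> l
    assume "\<sigma> \<in> coeff_support Y G' d c" and \<sigma>: "singular_simplex d (fspace Y) \<sigma>" and l: "l \<in> carrier (Y.LM d \<sigma>)"
    then have al: "allowable p Y d \<sigma>" using c by (simp add: Y.allowable_chains_def)
    show "prism (X.CM (Suc d)) lift_top (homotopy_chain \<sigma> l) (bottom d) \<in> X.allowable_chains p (Suc d)"
    proof (rule prism_mem[OF X.chain_left_module X.allowable_chains_submod lift_top_vertices lift_top_simps(1)])
      show "set (bottom d) \<subseteq> prism_vertices d"
        using bottom_on_lists[of d] by (simp add: on_lists_def)
      fix L assume L: "prism_cell (prism_vertices d) (bottom d) L"
      then have L': "L \<in> on_lists (prism_vertices d) (Suc (Suc d))"
        by (simp add: prism_cell_def bottom_def)
      show "homotopy_chain \<sigma> l L \<in> X.allowable_chains p (Suc d)"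
        unfolding homotopy_chain_def list_length[OF L' \<sigma>]
        by (rule X.simplex_chain_allowable_chains[OF homotopy_cell_allowable[OF al L] ahom_closed[OF mhom_ahom[OF homotopy_lift_mhom[OF L' \<sigma>]] l]])
    qed
  qed
qed

text \<open>For a cycle the term \<open>prism_bd\<close> vanishes, so the boundary of its prism is
  the difference of the ends. This difference is allowable, which is the remaining condition for the
  prism to be an intersection chain.\<close>

lemma homotopy_boundaries:
  assumes c: "c \<in> IC_cycles p Y G' d"
  shows "end_map 1 d c \<ominus>\<^bsub>X.CM d\<^esub> end_map 0 d c \<in> IC_boundaries p X G d"
proof -
  interpret C: left_module R "X.CM d" by (rule X.chain_left_module)
  interpret m0: coeff_map R Y G' X G "\<lambda>y. K (y, 0)" "\<lambda>u. H (u, 0)" by (rule at_time) simp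
  interpret m1: coeff_map R Y G' X G "\<lambda>y. K (y, 1)" "\<lambda>u. H (u, 1)" by (rule at_time) simp
  note cc = Y.IC_cyclesD[OF c]
  have "prism_bd d c = \<zero>\<^bsub>X.CM d\<^esub>"
  proof (cases d)
    case (Suc e)
    have "prism_op e \<zero>\<^bsub>Y.CM e\<^esub> = \<zero>\<^bsub>X.CM (Suc e)\<^esub>"
      by (rule ahom_zero[OF _ _ mhom_ahom[OF prism_op_mhom]])
        (rule left_module_abelian_group[OF Y.chain_left_module] left_module_abelian_group[OF X.chain_left_module])+
    then show ?thesis using cc(3) by (simp add: prism_bd_def Suc)
  qed (simp add: prism_bd_def)
  moreover have b: "prism_op d c \<in> carrier (X.CM (Suc d))"
    using ahom_closed[OF mhom_ahom[OF prism_op_mhom] cc(1)] .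
  moreover have "coeff_boundary X G (Suc d) (prism_op d c) \<in> carrier (X.CM d)"
    using ahom_closed[OF mhom_ahom[OF X.boundary_mhom[of "Suc d"]] b] by simp
  ultimately have eq: "coeff_boundary X G (Suc d) (prism_op d c) = end_map 1 d c \<ominus>\<^bsub>X.CM d\<^esub> end_map 0 d c"
    using prism_op_boundary[OF cc(1)] by simp
  have "end_map 1 d c \<ominus>\<^bsub>X.CM d\<^esub> end_map 0 d c \<in> X.allowable_chains p d"
    unfolding C.M.minus_eq
    using submodD(3)[OF X.allowable_chains_submod m1.push_allowable_chains[OF cc(2)] submod_neg[OF X.chain_left_module X.allowable_chains_submod m0.push_allowable_chains[OF cc(2)]]] .
  then have "prism_op d c \<in> IC p X G (Suc d)"
    using prism_op_allowable_chains[OF cc(2)] b eq by (simp add: X.IC_eq)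
  then show ?thesis
    unfolding IC_boundaries_def eq[symmetric] by simp
qed

end

section \<open>Functoriality\<close>

text \<open>The maps are compared only on the spaces and total spaces, because the ends of the
  homotopies are prescribed only there.\<close>

lemma push_comp:
  assumes "coeff_map R Z G1 Y G2 g1 h1" "coeff_map R Y G2 X G3 g2 h2" "coeff_map R Z G1 X G3 g3 h3"
    and g: "\<And>z. z \<in> topspace (fspace Z) \<Longrightarrow> g2 (g1 z) = g3 z"
    and h: "\<And>u. u \<in> topspace (cs_total G1) \<Longrightarrow> h2 (h1 u) = h3 u"
    and c: "c \<in> carrier (coeff_chain_module Z G1 d)"
  shows "coeff_chain_map Y G2 X G3 g2 h2 d (coeff_chain_map Z G1 Y G2 g1 h1 d c) = coeff_chain_map Z G1 X G3 g3 h3 d c"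
proof -
  interpret m1: coeff_map R Z G1 Y G2 g1 h1 by fact
  interpret m2: coeff_map R Y G2 X G3 g2 h2 by fact
  interpret m3: coeff_map R Z G1 X G3 g3 h3 by fact
  show ?thesis
  proof (rule m1.Y.chain_ext[OF _ _ _ _ c])
    show "abelian_group (m2.X.CM d)"
      by (rule left_module_abelian_group[OF m2.X.chain_left_module])
    show "(\<lambda>c. m2.push d (m1.push d c)) \<in> ahom (m1.Y.CM d) (m2.X.CM d)"
      by (rule ahom_comp[OF mhom_ahom[OF m1.push_mhom] mhom_ahom[OF m2.push_mhom]])
    show "m3.push d \<in> ahom (m1.Y.CM d) (m2.X.CM d)"
      by (rule mhom_ahom[OF m3.push_mhom])
    fix \<sigma> l assume \<sigma>: "singular_simplex d (fspace Z) \<sigma>" and l: "l \<in> carrier (m1.Y.LM d \<sigma>)"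
    have s: "simplex_map d g2 (simplex_map d g1 \<sigma>) = simplex_map d g3 \<sigma>"
      using m1.\<sigma>_in[OF m1.simplex_point \<sigma>] g by (auto simp: simplex_map_def fun_eq_iff)
    have dom: "lift_domain X d (simplex_map d g3 \<sigma>) = lift_domain Z d \<sigma>"
      "lift_domain Y d (simplex_map d g1 \<sigma>) = lift_domain Z d \<sigma>"
      using m3.push_domain[OF \<sigma>] m1.push_domain[OF \<sigma>] by auto
    have "l x \<in> topspace m1.Y.E" if "x \<in> lift_domain Z d \<sigma>" for x
      using m1.Y.lift_in_fib[OF l that] m1.Y.fib_carrier[OF lift_domainD(2)[OF that]] by auto
    then have "m2.push_lift d (simplex_map d g1 \<sigma>) (m1.push_lift d \<sigma> l) = m3.push_lift d \<sigma> l"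
      unfolding m2.push_lift_def m1.push_lift_def m3.push_lift_def s dom
      by (intro restrict_ext) (simp add: h)
    then show "m2.push d (m1.push d (simplex_chain Z G1 d \<sigma> l)) = m3.push d (simplex_chain Z G1 d \<sigma> l)"
      using m1.push_simplex_chain_eq[OF \<sigma> l] m3.push_simplex_chain_eq[OF \<sigma> l] s
        m2.push_simplex_chain_eq[OF m1.push_simplex[OF \<sigma>] ahom_closed[OF mhom_ahom[OF m1.push_lift_mhom[OF \<sigma>]] l]]
      by simp
  qed
qed

lemma push_id:
  assumes "coeff_map R X G X G g h"
    and g: "\<And>x. x \<in> topspace (fspace X) \<Longrightarrow> g x = x"
    and h: "\<And>u. u \<in> topspace (cs_total G) \<Longrightarrow> h u = u"
    and c: "c \<in> carrier (coeff_chain_module X G d)"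
  shows "coeff_chain_map X G X G g h d c = c"
proof -
  interpret m: coeff_map R X G X G g h by fact
  show ?thesis
  proof (rule m.Y.chain_ext[OF _ _ _ _ c])
    show "abelian_group (m.Y.CM d)"
      by (rule left_module_abelian_group[OF m.Y.chain_left_module])
    show "m.push d \<in> ahom (m.Y.CM d) (m.Y.CM d)"
      by (rule mhom_ahom[OF m.push_mhom])
    show "(\<lambda>c. c) \<in> ahom (m.Y.CM d) (m.Y.CM d)"
      by (simp add: ahom_def)
    fix \<sigma> l assume \<sigma>: "singular_simplex d (fspace X) \<sigma>" and l: "l \<in> carrier (m.Y.LM d \<sigma>)"
    have s: "simplex_map d g \<sigma> = \<sigma>"
      by (rule simplex_map_id_gen[OF \<sigma> g])
    have "l x \<in> topspace m.Y.E" if "x \<in> lift_domain X d \<sigma>" for x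
      using m.Y.lift_in_fib[OF l that] m.Y.fib_carrier[OF lift_domainD(2)[OF that]] by auto
    then have "m.push_lift d \<sigma> l = l"
      using l unfolding m.push_lift_def s
      by (auto simp: lift_module_simps extensional_def h fun_eq_iff)
    then show "m.push d (simplex_chain X G d \<sigma> l) = simplex_chain X G d \<sigma> l"
      using m.push_simplex_chain_eq[OF \<sigma> l] s by simp
  qed
qed

section \<open>Stratum-preserving homotopies\<close>

lemma stratum_cylinder: "stratum (cylinder X) i = stratum X i \<times> {0..1}"
  by (auto simp: stratum_def cylinder_def)

text \<open>The segments of a homotopy are connected, so one end of a segment decides its stratum.\<close>

lemma stratum_preserving_segment:
  assumes X: "filtered_space X" and Z: "filtered_space Z" and K: "stratum_preserving (cylinder X) Z K"
    and x: "x \<in> stratum X i" and s: "s \<in> {0..1}" "K (x, s) \<in> stratum Z j" and t: "t \<in> {0..1}"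
  shows "K (x, t) \<in> stratum Z j"
proof -
  let ?W = "subtopology (fspace (cylinder X)) (stratum (cylinder X) i)"
  have xX: "x \<in> topspace (fspace X)" using x stratum_sub[OF X] by blast
  have "connectedin unit_interval {0..1}"
    by (simp add: connectedin_subtopology)
  then have "connectedin (prod_topology (fspace X) unit_interval) ({x} \<times> {0..1})"
    using xX by (simp add: connectedin_Times)
  then have con: "connectedin ?W ({x} \<times> {0..1})"
    unfolding stratum_cylinder connectedin_subtopology using x by (auto simp: cylinder_def)
  let ?C = "connected_component_of_set ?W (x, s)"
  have sub: "{x} \<times> {0..1} \<subseteq> ?C"
    by (rule connected_component_of_maximal[OF con]) (use s in auto)
  have "(x, s) \<in> topspace ?W"
    using con s connectedin_subset_topspace by blast
  then have "?C \<in> connected_components_of ?W"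
    by (simp add: connected_components_of_def)
  then obtain j' where j': "K ` ?C \<subseteq> stratum Z j'"
    using K unfolding stratum_preserving_def by blast
  moreover have "(x, s) \<in> ?C" "(x, t) \<in> ?C"
    using sub s(1) t by blast+
  ultimately have "K (x, s) \<in> stratum Z j'" "K (x, t) \<in> stratum Z j'"
    by blast+
  then show ?thesis
    using stratum_unique[OF Z s(2)] by auto
qed

lemma stratum_map_top_part:
  assumes X: "filtered_space X" and Y: "filtered_space Y" and dims: "sdim X = sdim Y"
    and g: "continuous_map (fspace Y) (fspace X) g" "\<And>i. g ` stratum Y i \<subseteq> stratum X i"
  shows "continuous_map (top_part Y) (top_part X) g"
proof -
  have c: "continuous_map (top_part Y) (fspace X) g"
    unfolding top_part_def by (rule continuous_map_from_subtopology[OF g(1)])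
  have "g y \<in> topspace (top_part X)" if y: "y \<in> topspace (top_part Y)" for y
  proof -
    obtain i where i: "y \<in> stratum Y i"
      using ex_stratum[OF Y, of y] y by (auto simp: topspace_top_part)
    then have "g y \<in> stratum X i" using g(2) by blast
    then show ?thesis
      using stratum_top_part[OF X] stratum_top_part[OF Y i] y dims by simp
  qed
  then show ?thesis
    using c unfolding top_part_def[of X] continuous_map_in_subtopology
    by (auto simp: topspace_top_part)
qed

lemma homotopy_top_part:
  assumes X: "filtered_space X" and Y: "filtered_space Y" and dims: "sdim X = sdim Y"
    and K: "continuous_map (prod_topology (fspace Y) unit_interval) (fspace X) K"
      "\<And>y i t. \<lbrakk>y \<in> stratum Y i; t \<in> {0..1}\<rbrakk> \<Longrightarrow> K (y, t) \<in> stratum X i"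
  shows "continuous_map (prod_topology (top_part Y) unit_interval) (top_part X) K"
proof -
  have "continuous_map (prod_topology (top_part Y) unit_interval) (prod_topology (fspace Y) unit_interval) (\<lambda>z. (fst z, snd z))"
  proof (rule continuous_map_pairedI)
    show "continuous_map (prod_topology (top_part Y) unit_interval) (fspace Y) fst"
      unfolding top_part_def by (rule continuous_map_into_fulltopology[OF continuous_map_fst])
  qed (rule continuous_map_snd)
  then have c: "continuous_map (prod_topology (top_part Y) unit_interval) (fspace X) K"
    using continuous_map_comp[OF K(1)] by simp
  have "K z \<in> topspace (top_part X)" if "z \<in> topspace (prod_topology (top_part Y) unit_interval)" for z
  proof -
    obtain y t where z: "z = (y, t)" "y \<in> topspace (top_part Y)" "t \<in> {0..1}"
      using \<open>z \<in> topspace _\<close> by auto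
    obtain i where i: "y \<in> stratum Y i"
      using ex_stratum[OF Y, of y] z by (auto simp: topspace_top_part)
    show ?thesis
      using stratum_top_part[OF X K(2)[OF i z(3)]] stratum_top_part[OF Y i] z dims by simp
  qed
  then show ?thesis
    using c unfolding top_part_def[of X] continuous_map_in_subtopology
    by (auto simp: topspace_top_part)
qed

text \<open>The covering homotopy property is applied with the total space of \<open>G'\<close> as
  parameter space and \<open>h\<close> as start. Each \<open>u\<close> is thereby transported along
  the path that \<open>K\<close> traces from its base point, and linearity of \<open>h\<close>
  persists.\<close>

lemma ex_lifted_homotopy:
  fixes K :: "'b \<times> real \<Rightarrow> 'a" and h :: "'d \<Rightarrow> 'e"
  assumes CY: "coeff_space R Y G'" and CX: "coeff_space R X G" and dims: "sdim X = sdim Y"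
    and K: "continuous_map (prod_topology (fspace Y) unit_interval) (fspace X) K"
      "\<And>y i t. \<lbrakk>y \<in> stratum Y i; t \<in> {0..1}\<rbrakk> \<Longrightarrow> K (y, t) \<in> stratum X i"
    and h: "continuous_map (cs_total G') (cs_total G) h"
    and lin: "\<And>y. y \<in> topspace (top_part Y) \<Longrightarrow> h \<in> mhom R (cs_fiber G' y) (cs_fiber G (K (y, 0)))"
  obtains H where "coeff_homotopy R Y G' X G K H" "\<And>u. u \<in> topspace (cs_total G') \<Longrightarrow> H (u, 0) = h u"
proof -
  interpret Y: coeff_space R Y G' by fact
  interpret X: coeff_space R X G by fact
  have KT: "continuous_map (prod_topology (top_part Y) unit_interval) (top_part X) K"
    by (rule homotopy_top_part[OF X.filtered Y.filtered dims K])
  have "continuous_map (prod_topology Y.E unit_interval) (prod_topology (top_part Y) unit_interval) (\<lambda>z. (Y.proj (fst z), snd z))"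
    by (intro continuous_map_pairedI continuous_map_comp[OF Y.proj_cont continuous_map_fst] continuous_map_snd)
  from continuous_map_comp[OF KT this]
  have c: "continuous_map (prod_topology Y.E unit_interval) (top_part X) (\<lambda>z. K (Y.proj (fst z), snd z))" .
  have K0: "K (y, t) \<in> topspace (top_part X)" if "y \<in> topspace (top_part Y)" "t \<in> {0..1}" for y t
    using continuous_map_image_subset_topspace[OF KT] that by auto
  have h0: "X.proj (h u) = K (Y.proj u, 0)" if "u \<in> topspace Y.E" for u
    using ahom_closed[OF mhom_ahom[OF lin[OF Y.proj_in[OF that]]] Y.in_fib[OF that]]
      X.fib_carrier[OF K0[OF Y.proj_in[OF that], of 0]] by simp
  obtain H where H: "continuous_map (prod_topology Y.E unit_interval) X.E H"
    "\<And>u. u \<in> topspace Y.E \<Longrightarrow> H (u, 0) = h u"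
    "\<And>u t. \<lbrakk>u \<in> topspace Y.E; t \<in> {0..1}\<rbrakk> \<Longrightarrow> X.proj (H (u, t)) = K (Y.proj u, t)"
    using X.lift_homotopy[OF c h] h0 by auto
  have "coeff_homotopy R Y G' X G K H"
  proof (intro coeff_homotopy.intro coeff_homotopy_axioms.intro CX CY dims K H(1))
    fix y and t :: real assume y: "y \<in> topspace (top_part Y)" and t: "t \<in> {0..1}"
    have uE: "u \<in> topspace Y.E" "Y.proj u = y" if "u \<in> carrier (Y.F y)" for u
      using that Y.fib_carrier[OF y] by auto
    have K': "continuous_map unit_interval (top_part X) (\<lambda>t. K (y, t))"
      by (rule continuous_map_comp[OF KT]) (use y in \<open>auto intro!: continuous_map_pairedI\<close>)
    show "(\<lambda>u. H (u, t)) \<in> mhom R (Y.F y) (X.F (K (y, t)))"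
    proof (rule lifted_homotopy_linear[OF Y.local_sys X.local_sys H(1) K' _ y _ t])
      show "X.proj (H (u, t)) = K (y, t)" if "u \<in> carrier (Y.F y)" "t \<in> {0..1}" for u t
        using H(3)[OF uE(1)[OF that(1)] that(2)] uE(2)[OF that(1)] by simp
      show "(\<lambda>u. H (u, 0)) \<in> mhom R (Y.F y) (X.F (K (y, 0)))"
        by (rule mhom_cong[OF lin[OF y] Y.fib_module[OF y]]) (use H(2) uE in auto)
    qed simp
  qed
  then show thesis using that H(2) by blast
qed

lemma (in coeff_homotopy) path:
  assumes u: "u \<in> topspace (cs_total G')"
  shows "continuous_map unit_interval X.E (\<lambda>t. H (u, t))"
    and "t \<in> {0..1} \<Longrightarrow> H (u, t) \<in> topspace X.E"
    and "t \<in> {0..1} \<Longrightarrow> X.proj (H (u, t)) = K (Y.proj u, t)"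
proof -
  show c: "continuous_map unit_interval X.E (\<lambda>t. H (u, t))"
    by (rule continuous_map_comp[OF H_cont]) (use u in \<open>auto intro!: continuous_map_pairedI\<close>)
  show "t \<in> {0..1} \<Longrightarrow> H (u, t) \<in> topspace X.E"
    using continuous_map_image_subset_topspace[OF c] by auto
  assume t: "t \<in> {0..1}"
  note y = Y.proj_in[OF u]
  have "K (Y.proj u, t) \<in> topspace (top_part X)"
    using K_top_iff[OF _ t] y by (simp add: topspace_top_part)
  then show "X.proj (H (u, t)) = K (Y.proj u, t)"
    using ahom_closed[OF mhom_ahom[OF H_lin[OF y t]] Y.in_fib[OF u]] X.fib_carrier by simp
qed

lemma reverse_interval: "continuous_map unit_interval unit_interval (\<lambda>t. 1 - t)"
  by (auto simp: continuous_map_in_subtopology intro!: continuous_intros)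

theorem corollary2p3:
  fixes X :: "'a filtered" and Y :: "'b filtered" and n :: nat
    and p :: "nat \<Rightarrow> int"
    and g :: "'b \<Rightarrow> 'a" and f :: "'a \<Rightarrow> 'b"
    and R :: "('r, 'k) ring_scheme" and G :: "('r, 'a, 'e) coeff_system"
    and d :: nat
  assumes "filtered_space X" and "filtered_space Y"
    and "sdim X = n" and "sdim Y = n"
    and "skel X (int n - 1) = skel X (int n - 2)"
    and "skel Y (int n - 1) = skel Y (int n - 2)"
    and "perversity p"
    and "sp_homotopy_equivalence Y X g f"
    and "local_system R (top_part X) G"
    and "\<And>i. f ` stratum X i \<subseteq> stratum Y i"
    and "\<And>i. g ` stratum Y i \<subseteq> stratum X i"
  shows "IH_induced p Y (pullback_system (top_part Y) g G) X G g snd d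
           \<in> module_iso R (IH p Y (pullback_system (top_part Y) g G) d) (IH p X G d)"
proof -
  note X = assms(1) and Y = assms(2) and fs = assms(10) and gs = assms(11)
  have dims: "sdim X = sdim Y" using assms(3,4) by simp
  define G' where "G' = pullback_system (top_part Y) g G"
  have gc: "continuous_map (fspace Y) (fspace X) g" and fc: "continuous_map (fspace X) (fspace Y) f"
    using assms(8) by (auto simp: sp_homotopy_equivalence_def stratum_preserving_def)
  have gtop: "continuous_map (top_part Y) (top_part X) g"
    by (rule stratum_map_top_part[OF X Y dims gc gs])
  have ftop: "continuous_map (top_part X) (top_part Y) f"
    by (rule stratum_map_top_part[OF Y X dims[symmetric] fc fs])
  interpret X: coeff_space R X G
    using X assms(9) by unfold_locales
  interpret Y: coeff_space R Y G'
    using Y local_system_pullback[OF assms(9) gtop] by unfold_locales (simp_all add: G'_def)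
  have G'_tot: "v \<in> topspace Y.E \<longleftrightarrow> fst v \<in> topspace (top_part Y) \<and> snd v \<in> topspace X.E \<and> g (fst v) = X.proj (snd v)" for v
    by (cases v) (auto simp: G'_def)
  have G'_proj: "Y.proj = fst" by (simp add: G'_def)
  have G'_fib: "carrier (Y.F y) = {y} \<times> carrier (X.F (g y))" for y
    by (simp add: G'_def)
  have G'_ops: "u \<oplus>\<^bsub>Y.F y\<^esub> v = (y, snd u \<oplus>\<^bsub>X.F (g y)\<^esub> snd v)" "r \<odot>\<^bsub>Y.F y\<^esub> u = (y, r \<odot>\<^bsub>X.F (g y)\<^esub> snd u)" for y u v r
    by (simp_all add: G'_def)
  have pair_cont: "continuous_map T Y.E (\<lambda>x. (a x, b x))"
    if "continuous_map T (top_part Y) a" "continuous_map T X.E b" "\<And>x. x \<in> topspace T \<Longrightarrow> g (a x) = X.proj (b x)" for T a b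
    using that by (auto simp: G'_def continuous_map_in_subtopology intro!: continuous_map_pairedI)
  have pair_lin: "(\<lambda>u. (y, b u)) \<in> mhom R M (Y.F y)" if "b \<in> mhom R M (X.F (g y))" for b M y
    using that by (auto simp: mhom_def ahom_def G'_fib G'_ops)
  have snd_lin: "snd \<in> mhom R (Y.F y) (X.F (g y))" for y
    by (auto simp: mhom_def ahom_def G'_fib G'_ops)
  have snd_cont: "continuous_map Y.E X.E snd"
    by (auto simp: G'_def intro!: continuous_map_from_subtopology continuous_map_snd)
  have gmap: "coeff_map R Y G' X G g snd"
    by (intro coeff_map.intro coeff_map_axioms.intro X.coeff_space_axioms Y.coeff_space_axioms dims gc snd_cont snd_lin)
      (use gs in auto)
  interpret g: coeff_map R Y G' X G g snd by (rule gmap)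

  \<comment> \<open>The two homotopies and the strata\<close>
  obtain P where P: "stratum_preserving (cylinder X) X P"
    "\<And>x. x \<in> topspace (fspace X) \<Longrightarrow> P (x, 0) = g (f x) \<and> P (x, 1) = x"
    using assms(8) by (auto simp: sp_homotopy_equivalence_def sp_homotopic_def)
  obtain Q where Q: "stratum_preserving (cylinder Y) Y Q"
    "\<And>y. y \<in> topspace (fspace Y) \<Longrightarrow> Q (y, 0) = f (g y) \<and> Q (y, 1) = y"
    using assms(8) by (auto simp: sp_homotopy_equivalence_def sp_homotopic_def)
  have Pc: "continuous_map (prod_topology (fspace X) unit_interval) (fspace X) P"
    using P(1) by (simp add: stratum_preserving_def cylinder_def)
  have Qc: "continuous_map (prod_topology (fspace Y) unit_interval) (fspace Y) Q"
    using Q(1) by (simp add: stratum_preserving_def cylinder_def)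
  \<comment> \<open>At time 1 the point is back at \<open>x\<close>, hence in the stratum of index
    \<open>i\<close>; this fixes the index along the whole segment.\<close>
  have Ps: "P (x, t) \<in> stratum X i" if "x \<in> stratum X i" "t \<in> {0..1}" for x t i
  proof -
    have "x \<in> topspace (fspace X)" using stratum_sub[OF X] that(1) by blast
    then show ?thesis
      using stratum_preserving_segment[OF X X P(1) that(1), of 1 i t] P(2)[of x] that by simp
  qed
  have Qs: "Q (y, t) \<in> stratum Y i" if "y \<in> stratum Y i" "t \<in> {0..1}" for y t i
  proof -
    have "y \<in> topspace (fspace Y)" using stratum_sub[OF Y] that(1) by blast
    then show ?thesis
      using stratum_preserving_segment[OF Y Y Q(1) that(1), of 1 i t] Q(2)[of y] that by simp
  qed
  have topX: "x \<in> topspace (fspace X)" if "x \<in> topspace (top_part X)" for x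
    using that by (simp add: topspace_top_part)
  have topY: "y \<in> topspace (fspace Y)" if "y \<in> topspace (top_part Y)" for y
    using that by (simp add: topspace_top_part)
  have gtopD: "g y \<in> topspace (top_part X)" if "y \<in> topspace (top_part Y)" for y
    using continuous_map_image_subset_topspace[OF gtop] that by auto
  have ftopD: "f x \<in> topspace (top_part Y)" if "x \<in> topspace (top_part X)" for x
    using continuous_map_image_subset_topspace[OF ftop] that by auto
  \<comment> \<open>Lifts are prescribed at time 0, while \<open>P\<close> and \<open>Q\<close> are
    the identity at time 1. Transport that starts from the identity has to follow the reversed
    homotopies.\<close>
  have reverse_cont: "continuous_map (prod_topology T unit_interval) (prod_topology T unit_interval) (\<lambda>z. (fst z, 1 - snd z))" for T :: "'x topology"
    by (intro continuous_map_pairedI continuous_map_fst continuous_map_comp[OF reverse_interval continuous_map_snd])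
  have id_lin: "(\<lambda>u. u) \<in> mhom R M M" for M :: "('r, 'y) module"
    by (simp add: mhom_def ahom_def)

  text \<open>Transport along the reversed homotopy \<open>P\<close> covers \<open>f\<close> by a bundle map \<open>\<phi>\<close>, with
    \<open>g \<circ> f\<close>, covered by the composite with the projection, homotopic to the identity.\<close>
  obtain F where F: "coeff_homotopy R X G X G (\<lambda>z. P (fst z, 1 - snd z)) F"
    "\<And>u. u \<in> topspace X.E \<Longrightarrow> F (u, 0) = u"
  proof (rule ex_lifted_homotopy[where h = "\<lambda>u. u" and K = "\<lambda>z. P (fst z, 1 - snd z)", OF X.coeff_space_axioms X.coeff_space_axioms refl])
    show "continuous_map (prod_topology (fspace X) unit_interval) (fspace X) (\<lambda>z. P (fst z, 1 - snd z))"
      by (rule continuous_map_comp[OF Pc reverse_cont])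
  qed (use Ps P(2) topX id_lin in auto)
  interpret F: coeff_homotopy R X G X G "\<lambda>z. P (fst z, 1 - snd z)" F by (rule F(1))
  interpret F1: coeff_map R X G X G "\<lambda>x. P (x, 0)" "\<lambda>u. F (u, 1)" using F.at_time[of 1] by simp
  interpret F0: coeff_map R X G X G "\<lambda>x. P (x, 1)" "\<lambda>u. F (u, 0)" using F.at_time[of 0] by simp
  \<comment> \<open>\<open>F (u, 1)\<close> lies over \<open>g (f x)\<close>, where \<open>x\<close>
    is the base point of \<open>u\<close>, as an element of the pullback over \<open>f x\<close>
    must.\<close>
  define \<phi> where "\<phi> = (\<lambda>u. (f (X.proj u), F (u, 1)))"
  have F1_proj: "X.proj (F (u, 1)) = g (f (X.proj u))" if "u \<in> topspace X.E" for u
    using F.path(3)[OF that, of 1] P(2)[OF topX[OF X.proj_in[OF that]]] by simp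
  have fmap: "coeff_map R X G Y G' f \<phi>"
  proof (intro coeff_map.intro coeff_map_axioms.intro X.coeff_space_axioms Y.coeff_space_axioms dims[symmetric] fc)
    show "continuous_map X.E Y.E \<phi>"
      unfolding \<phi>_def by (intro pair_cont continuous_map_comp[OF ftop X.proj_cont] F1.h_cont) (simp add: F1_proj)
    show "\<phi> \<in> mhom R (X.F x) (Y.F (f x))" if x: "x \<in> topspace (top_part X)" for x
    proof (rule mhom_cong[OF pair_lin X.fib_module[OF x]])
      show "(\<lambda>u. F (u, 1)) \<in> mhom R (X.F x) (X.F (g (f x)))"
        using F1.h_lin[OF x] P(2)[OF topX[OF x]] by simp
      show "\<phi> u = (f x, F (u, 1))" if "u \<in> carrier (X.F x)" for u
        using that X.fib_carrier[OF x] by (simp add: \<phi>_def)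
    qed
  qed (use fs in auto)
  interpret f: coeff_map R X G Y G' f \<phi> by (rule fmap)
  \<comment> \<open>The second component of \<open>\<phi>\<close> is the time 1 end of
    \<open>F\<close>, so the composite equals that end on chains, before passing to
    homology.\<close>
  have gf: "g.push d (f.push d c) = F1.push d c" if "c \<in> carrier (X.CM d)" for c
    by (rule push_comp[OF fmap gmap F1.coeff_map_axioms _ _ that]) (simp_all add: P(2) \<phi>_def)
  have F0_id: "F0.push d c = c" if "c \<in> carrier (X.CM d)" for c
    by (rule push_id[OF F0.coeff_map_axioms _ _ that]) (simp_all add: P(2) F(2))
  have surj: "g.push d (f.push d c) \<ominus>\<^bsub>X.CM d\<^esub> c \<in> IC_boundaries p X G d" if c: "c \<in> IC_cycles p X G d" for c
    using F.homotopy_boundaries[OF c] gf[OF X.IC_cyclesD(1)[OF c]] F0_id[OF X.IC_cyclesD(1)[OF c]] by simp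

  text \<open>The homotopy \<open>Q\<close> only leads from the composite over \<open>f \<circ> g\<close> to a bundle map \<open>A\<close> over the identity:
    the monodromy along the loops formed by \<open>g \<circ> Q\<close> and \<open>P\<close>. Transporting backwards along these
    loops gives a left inverse of \<open>A\<close>.\<close>
  have \<phi>snd_lin: "(\<lambda>v. \<phi> (snd v)) \<in> mhom R (Y.F y) (Y.F (f (g y)))" if "y \<in> topspace (top_part Y)" for y
    by (rule mhom_comp[OF snd_lin f.h_lin[OF gtopD[OF that]]])
  \<comment> \<open>\<open>A\<close> starts at the coefficient map of the composite over
    \<open>f \<circ> g\<close> and ends over the identity of \<open>Y\<close>.\<close>
  obtain A where A: "coeff_homotopy R Y G' Y G' Q A"
    "\<And>v. v \<in> topspace Y.E \<Longrightarrow> A (v, 0) = \<phi> (snd v)"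
  proof (rule ex_lifted_homotopy[where h = "\<lambda>v. \<phi> (snd v)" and K = Q, OF Y.coeff_space_axioms Y.coeff_space_axioms refl Qc])
    show "continuous_map Y.E Y.E (\<lambda>v. \<phi> (snd v))"
      by (rule continuous_map_comp[OF f.h_cont snd_cont])
    show "(\<lambda>v. \<phi> (snd v)) \<in> mhom R (Y.F y) (Y.F (Q (y, 0)))" if "y \<in> topspace (top_part Y)" for y
      using \<phi>snd_lin[OF that] Q(2)[OF topY[OF that]] by simp
  qed (use Qs in auto)
  interpret A: coeff_homotopy R Y G' Y G' Q A by (rule A(1))
  interpret A1: coeff_map R Y G' Y G' "\<lambda>y. Q (y, 1)" "\<lambda>u. A (u, 1)" by (rule A.at_time) simp
  interpret A0: coeff_map R Y G' Y G' "\<lambda>y. Q (y, 0)" "\<lambda>u. A (u, 0)" by (rule A.at_time) simp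
  have fg: "f.push d (g.push d c) = A0.push d c" if "c \<in> carrier (Y.CM d)" for c
    by (rule push_comp[OF gmap fmap A0.coeff_map_axioms _ _ that]) (simp_all add: Q(2) A(2))
  \<comment> \<open>First half of the way back: from the fibre over \<open>y\<close> along the
    reversed \<open>Q\<close> to the fibre over \<open>f (g y)\<close>.\<close>
  obtain C where C: "coeff_homotopy R Y G' Y G' (\<lambda>z. Q (fst z, 1 - snd z)) C"
    "\<And>v. v \<in> topspace Y.E \<Longrightarrow> C (v, 0) = v"
  proof (rule ex_lifted_homotopy[where h = "\<lambda>u. u" and K = "\<lambda>z. Q (fst z, 1 - snd z)", OF Y.coeff_space_axioms Y.coeff_space_axioms refl])
    show "continuous_map (prod_topology (fspace Y) unit_interval) (fspace Y) (\<lambda>z. Q (fst z, 1 - snd z))"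
      by (rule continuous_map_comp[OF Qc reverse_cont])
  qed (use Qs Q(2) topY id_lin in auto)
  interpret C: coeff_homotopy R Y G' Y G' "\<lambda>z. Q (fst z, 1 - snd z)" C by (rule C(1))
  have C1: "coeff_map R Y G' Y G' (\<lambda>y. Q (y, 0)) (\<lambda>u. C (u, 1))"
    using C.at_time[of 1] by simp
  interpret C1: coeff_map R Y G' Y G' "\<lambda>y. Q (y, 0)" "\<lambda>u. C (u, 1)" by (rule C1)
  \<comment> \<open>Second half: an element of the pullback over \<open>f (g y)\<close> lies in
    \<open>G\<close> over \<open>g (f (g y))\<close>, and \<open>P\<close> at the point
    \<open>g y\<close> carries it to the fibre of \<open>G\<close> over \<open>g y\<close>.\<close>
  obtain D where D: "coeff_homotopy R Y G' X G (\<lambda>z. P (g (fst z), snd z)) D"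
    "\<And>v. v \<in> topspace Y.E \<Longrightarrow> D (v, 0) = snd (C (v, 1))"
  proof (rule ex_lifted_homotopy[where h = "\<lambda>v. snd (C (v, 1))" and K = "\<lambda>z. P (g (fst z), snd z)", OF Y.coeff_space_axioms X.coeff_space_axioms dims])
    show "continuous_map (prod_topology (fspace Y) unit_interval) (fspace X) (\<lambda>z. P (g (fst z), snd z))"
      by (rule continuous_map_comp[OF Pc]) (intro continuous_map_pairedI continuous_map_comp[OF gc continuous_map_fst] continuous_map_snd)
    show "continuous_map Y.E X.E (\<lambda>v. snd (C (v, 1)))"
      by (rule continuous_map_comp[OF snd_cont C1.h_cont])
    show "(\<lambda>v. snd (C (v, 1))) \<in> mhom R (Y.F y) (X.F (P (g (fst (y, 0::real)), snd (y, 0::real))))"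
      if y: "y \<in> topspace (top_part Y)" for y
      using mhom_comp[OF C1.h_lin[OF y] snd_lin] Q(2)[OF topY[OF y]] P(2)[OF topX[OF gtopD[OF y]]] by simp
    show "P (g (fst (y, t)), snd (y, t)) \<in> stratum X i" if "y \<in> stratum Y i" "t \<in> {0..1}" for y i t
    proof -
      have "g y \<in> stratum X i" using gs that(1) by blast
      then show ?thesis using Ps that(2) by simp
    qed
  qed auto
  interpret D: coeff_homotopy R Y G' X G "\<lambda>z. P (g (fst z), snd z)" D by (rule D(1))
  interpret D1: coeff_map R Y G' X G "\<lambda>y. P (g y, 1)" "\<lambda>u. D (u, 1)" using D.at_time[of 1] by simp
  define B where "B = (\<lambda>v. (Y.proj v, D (v, 1)))"
  have Bmap: "coeff_map R Y G' Y G' (\<lambda>y. y) B"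
  proof (intro coeff_map.intro coeff_map_axioms.intro Y.coeff_space_axioms refl)
    have pr: "g (Y.proj v) = X.proj (D (v, 1))" if "v \<in> topspace Y.E" for v
      using D.path(3)[OF that, of 1] P(2)[OF topX[OF gtopD[OF Y.proj_in[OF that]]]] by simp
    show "continuous_map Y.E Y.E B"
      unfolding B_def by (intro pair_cont Y.proj_cont D1.h_cont) (simp add: pr)
    show "B \<in> mhom R (Y.F y) (Y.F y)" if y: "y \<in> topspace (top_part Y)" for y
    proof (rule mhom_cong[OF pair_lin Y.fib_module[OF y]])
      show "(\<lambda>u. D (u, 1)) \<in> mhom R (Y.F y) (X.F (g y))"
        using D1.h_lin[OF y] P(2)[OF topX[OF gtopD[OF y]]] by simp
      show "B v = (y, D (v, 1))" if "v \<in> carrier (Y.F y)" for v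
        using that Y.fib_carrier[OF y] by (simp add: B_def)
    qed
  qed auto
  interpret B: coeff_map R Y G' Y G' "\<lambda>y. y" B by (rule Bmap)
  have idmap: "coeff_map R Y G' Y G' (\<lambda>y. y) (\<lambda>v. v)"
    by (intro coeff_map.intro coeff_map_axioms.intro Y.coeff_space_axioms refl) (auto simp: id_lin)
  \<comment> \<open>Started at \<open>A (v, 1)\<close>, the lift \<open>C\<close> is
    \<open>A\<close> run backwards; started where that ends, \<open>D\<close> is \<open>F\<close>
    run backwards. Both follow from uniqueness of path lifting at the common starting point.\<close>
  have BA: "B (A (v, 1)) = v" if v: "v \<in> topspace Y.E" for v
  proof -
    let ?a = "A (v, 1)" and ?y = "fst v" and ?w = "snd v"
    have y: "?y \<in> topspace (top_part Y)" and w: "?w \<in> topspace X.E" "X.proj ?w = g ?y"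
      using v G'_tot[of v] by auto
    have a: "?a \<in> topspace Y.E" using A.path(2)[OF v, of 1] by simp
    have pa: "Y.proj ?a = ?y"
      using A.path(3)[OF v, of 1] Q(2)[OF topY[OF y]] by (simp add: G'_proj)
    have "C (?a, 1) = A (v, 1 - 1)"
    proof (rule Y.lift_unique[OF C.path(1)[OF a] continuous_map_comp[OF A.path(1)[OF v] reverse_interval], of 0])
      show "Y.proj (C (?a, t)) = Y.proj (A (v, 1 - t))" if "t \<in> {0..1}" for t
        using C.path(3)[OF a that] A.path(3)[OF v, of "1 - t"] that pa by (simp add: G'_proj)
      show "C (?a, 0) = A (v, 1 - 0)" using C(2)[OF a] by simp
    qed simp_all
    then have Ca: "C (?a, 1) = \<phi> ?w" using A(2)[OF v] by simp
    have "D (?a, 1) = F (?w, 1 - 1)"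
    proof (rule X.lift_unique[OF D.path(1)[OF a] continuous_map_comp[OF F.path(1)[OF w(1)] reverse_interval], of 0])
      show "X.proj (D (?a, t)) = X.proj (F (?w, 1 - t))" if "t \<in> {0..1}" for t
        using D.path(3)[OF a that] F.path(3)[OF w(1), of "1 - t"] that pa w(2) by simp
      show "D (?a, 0) = F (?w, 1 - 0)" using D(2)[OF a] Ca by (simp add: \<phi>_def)
    qed simp_all
    then show ?thesis
      using F(2)[OF w(1)] pa by (simp add: B_def)
  qed
  have BA_push: "B.push d (A1.push d c) = c" if "c \<in> carrier (Y.CM d)" for c
    using push_comp[OF A1.coeff_map_axioms Bmap idmap _ _ that] push_id[OF idmap _ _ that] BA Q(2) by simp
  \<comment> \<open>If the image of \<open>c\<close> under \<open>g\<close> bounds, so does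
    \<open>A0.push d c\<close>, which is the image under the composite. The cycle
    \<open>A1.push d c\<close> is homologous to it, and \<open>B\<close> recovers \<open>c\<close>
    from that.\<close>
  have inj: "c \<in> IC_boundaries p Y G' d"
    if c: "c \<in> IC_cycles p Y G' d" and b: "g.push d c \<in> IC_boundaries p X G d" for c
  proof -
    interpret M: left_module R "Y.CM d" by (rule Y.chain_left_module)
    note cc = Y.IC_cyclesD(1)[OF c]
    note Bd = Y.IC_boundaries_submod[of d p]
    have cl: "A0.push d c \<in> carrier (Y.CM d)" "A1.push d c \<in> carrier (Y.CM d)"
      using ahom_closed[OF mhom_ahom[OF A0.push_mhom] cc] ahom_closed[OF mhom_ahom[OF A1.push_mhom] cc] .
    have 0: "A0.push d c \<in> IC_boundaries p Y G' d"
      using f.push_boundaries[OF b] fg[OF cc] by simp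
    have "A1.push d c \<ominus>\<^bsub>Y.CM d\<^esub> A0.push d c \<in> IC_boundaries p Y G' d"
      by (rule A.homotopy_boundaries[OF c])
    then have "(A1.push d c \<ominus>\<^bsub>Y.CM d\<^esub> A0.push d c) \<oplus>\<^bsub>Y.CM d\<^esub> A0.push d c \<in> IC_boundaries p Y G' d"
      by (rule submodD(3)[OF Bd _ 0])
    then have "A1.push d c \<in> IC_boundaries p Y G' d"
      using cl by (simp add: M.M.minus_eq M.M.a_assoc M.M.l_neg)
    then show ?thesis
      using B.push_boundaries BA_push[OF cc] by metis
  qed

  \<comment> \<open>Passage to homology\<close>
  have "(\<lambda>A. \<Union>c\<in>A. IC_boundaries p X G d +>\<^bsub>X.CM d\<^esub> g.push d c)
     \<in> module_iso R (quotient_module (Y.CM d\<lparr>carrier := IC_cycles p Y G' d\<rparr>) (IC_boundaries p Y G' d))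
        (quotient_module (X.CM d\<lparr>carrier := IC_cycles p X G d\<rparr>) (IC_boundaries p X G d))"
  proof (rule quotient_module_iso[OF Y.chain_left_module X.chain_left_module g.push_mhom
      Y.IC_cycles_submod Y.IC_boundaries_submod X.IC_cycles_submod X.IC_boundaries_submod])
    \<comment> \<open>The preimage of a class is supplied by the chain map of \<open>f\<close> and
      \<open>\<phi>\<close>.\<close>
    show "\<exists>z\<in>IC_cycles p Y G' d. g.push d z \<ominus>\<^bsub>X.CM d\<^esub> z' \<in> IC_boundaries p X G d"
      if "z' \<in> IC_cycles p X G d" for z'
      using surj[OF that] f.push_cycles[OF that] by blast
  qed (use g.push_cycles g.push_boundaries inj in auto)
  moreover have "IH_induced p Y G' X G g snd d = (\<lambda>A. \<Union>c\<in>A. IC_boundaries p X G d +>\<^bsub>X.CM d\<^esub> g.push d c)"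
    by (rule ext) (simp add: IH_induced_def)
  ultimately show ?thesis
    by (simp add: IH_def G'_def)
qed

end
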